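(* Let $\mathbb{B}$ be the open unit ball of a complex Banach space. Let $\omega$ and $\mu$ be normal functions and let $\varphi\in H(\mathbb{B})$ be such that the set $E_{\varepsilon,\rho}$ is relatively compact in $\mathbb{B}$ for every $\varepsilon>0$ and every $\rho\in(0,1)$. Then: (i) Assume that $\int_0^1\frac{1}{\omega(t)}\,dt<\infty$. Then $T_{\varphi}:\mathcal{B}_{\mathcal{R}}(\mathbb{B})_{\omega}\to\mathcal{B}_{\mathcal{R}}(\mathbb{B})_{\mu}$ is compact if and only if $\varphi\in\mathcal{B}_{\mathcal{R}}(\mathbb{B})_{\mu}$. (ii) Assume that $\int_0^1\frac{1}{\omega(t)}\,dt=\infty$. Then $T_{\varphi}:\mathcal{B}_{\mathcal{R}}(\mathbb{B})_{\omega}\to\mathcal{B}_{\mathcal{R}}(\mathbb{B})_{\mu}$ is compact if and only if $$\lim_{\|z\|\to1}\mu(z)|\mathcal{R}\varphi(z)|\int_0^{\|z\|}\frac{1}{\omega(t)}\,dt=0.$$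
   Context: A positive continuous function $\omega$ on $[0,1)$ is normal if there are constants $\delta\in[0,1)$ and $0<a<b<\infty$ such that on $[\delta,1)$ the function $\omega(r)/(1-r)^a$ is decreasing and $\omega(r)/(1-r)^b$ is increasing. A normal function is extended to $\mathbb{B}$ by $\omega(z)=\omega(\|z\|)$. $H(\mathbb{B})$ is the set of holomorphic functions $\mathbb{B}\to\mathbb{C}$. For $f\in H(\mathbb{B})$, $\mathcal{R}f(z)=Df(z)z$, where $Df(z)$ is the Fréchet derivative of $f$ at $z$. For a normal $\omega$, the Bloch-type space $\mathcal{B}_{\mathcal{R}}(\mathbb{B})_{\omega}$ is the set of $f\in H(\mathbb{B})$ with $\sup_{z\in\mathbb{B}}\omega(z)|\mathcal{R}f(z)|<\infty$, with norm $\|f\|_{\mathcal{R},\omega}=|f(0)|+\sup_{z\in\mathbb{B}}\omega(z)|\mathcal{R}f(z)|$ (a Banach space). For $\varphi\in H(\mathbb{B})$, the extended Cesàro operator is $T_{\varphi}f(z)=\int_0^1 f(tz)\,\mathcal{R}\varphi(tz)\,\frac{1}{t}\,dt$ for $f\in H(\mathbb{B})$, $z\in\mathbb{B}$. Saying that $T_\varphi$ is compact between two spaces means that it maps the first into the second and is a compact linear operator. For $\varepsilon>0$, $\rho\in(0,1)$, $$E_{\varepsilon,\rho}=\{z\in\mathbb{B}:\ \|z\|\le\rho,\ \exists s\in[1,\rho^{-1}]\text{ with } sz\in\mathbb{B}\text{ and }\mu(sz)|\mathcal{R}\varphi(sz)|\ge\varepsilon\}.$$ Limits as $\|z\|\to1$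 are uniform over all $z\in\mathbb{B}$ with $\|z\|\to 1$. *)

theory Defs
  imports "HOL-Analysis.Analysis"
begin

section \<open>Complex Banach spaces\<close>

class complex_banach = banach +
  fixes scaleC :: "complex \<Rightarrow> 'a \<Rightarrow> 'a"
  assumes scaleC_add_right: "scaleC c (x + y) = scaleC c x + scaleC c y"
    and scaleC_add_left: "scaleC (c + d) x = scaleC c x + scaleC d x"
    and scaleC_scaleC: "scaleC c (scaleC d x) = scaleC (c * d) x"
    and scaleC_of_real: "scaleC (complex_of_real r) x = r *\<^sub>R x"
    and norm_scaleC: "norm (scaleC c x) = cmod c * norm x"

instantiation complex :: complex_banach
begin

definition scaleC_complex :: "complex \<Rightarrow> complex \<Rightarrow> complex"
  where "scaleC_complex c x = c * x"

instance
  by standard (auto simp: scaleC_complex_def algebra_simps norm_mult scaleR_conv_of_real)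

end


section \<open>Normal functions\<close>

text \<open>
  Only the values on \<open>[0,1)\<close> matter. \<open>Decreasing\<close> and \<open>increasing\<close> are read in the weak sense;
  the strict reading defines the same class of functions, because \<open>a\<close> may be made smaller
  and \<open>b\<close> larger.
\<close>

definition normal_weight :: "(real \<Rightarrow> real) \<Rightarrow> bool" where
  "normal_weight \<omega> \<longleftrightarrow>
     continuous_on {0..<1} \<omega> \<and> (\<forall>r\<in>{0..<1}. \<omega> r > 0) \<and>
     (\<exists>\<delta>\<in>{0..<1}. \<exists>a b. 0 < a \<and> a < b \<and>
        antimono_on {\<delta>..<1} (\<lambda>r. \<omega> r / (1 - r) powr a) \<and>
        mono_on {\<delta>..<1} (\<lambda>r. \<omega> r / (1 - r) powr b))"


section \<open>Holomorphic functions on the open unit ball and Bloch-type spaces\<close>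

text \<open>
  A function on the unit ball is represented by its extension by \<open>0\<close> to the whole space, so that
  equality of representatives is equality on the ball and all linear operations are pointwise.
\<close>

definition holo_ball :: "('a::complex_banach \<Rightarrow> complex) set" where
  "holo_ball =
     {f. (\<forall>z\<in>ball 0 1. \<exists>D. (f has_derivative D) (at z) \<and>
                            (\<forall>c x. D (scaleC c x) = c * D x)) \<and>
         (\<forall>z. z \<notin> ball 0 1 \<longrightarrow> f z = 0)}"

definition radial_deriv :: "('a::complex_banach \<Rightarrow> complex) \<Rightarrow> 'a \<Rightarrow> complex" where
  "radial_deriv f z = frechet_derivative f (at z) z"

definition bloch :: "(real \<Rightarrow> real) \<Rightarrow> ('a::complex_banach \<Rightarrow> complex) set" where
  "bloch \<omega> =
     {f \<in> holo_ball. bdd_above ((\<lambda>z. \<omega> (norm z) * cmod (radial_deriv f z)) ` ball 0 1)}"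

definition bloch_norm :: "(real \<Rightarrow> real) \<Rightarrow> ('a::complex_banach \<Rightarrow> complex) \<Rightarrow> real" where
  "bloch_norm \<omega> f =
     cmod (f 0) + (SUP z\<in>ball 0 1. \<omega> (norm z) * cmod (radial_deriv f z))"


section \<open>Compact operators\<close>

definition relatively_compact_in :: "'b topology \<Rightarrow> 'b set \<Rightarrow> bool" where
  "relatively_compact_in T S \<longleftrightarrow> compactin T (T closure_of S)"

definition norm_topology ::
    "('a \<Rightarrow> complex) set \<Rightarrow> (('a \<Rightarrow> complex) \<Rightarrow> real) \<Rightarrow> ('a \<Rightarrow> complex) topology" where
  "norm_topology X N =
     Metric_space.mtopology X (\<lambda>f g. if f \<in> X \<and> g \<in> X then N (\<lambda>z. f z - g z) else 0)"

text \<open>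
  The default \<open>0\<close> off \<open>X\<close> above is there because \<^locale>\<open>Metric_space\<close> demands nonnegativity and
  symmetry of the distance also outside the carrier.

  Below, \<open>X\<close> and \<open>Y\<close> are linear spaces of complex-valued functions, with norms \<open>NX\<close> and \<open>NY\<close>.
\<close>

definition compact_linear_operator ::
    "('a \<Rightarrow> complex) set \<Rightarrow> (('a \<Rightarrow> complex) \<Rightarrow> real) \<Rightarrow>
     ('b \<Rightarrow> complex) set \<Rightarrow> (('b \<Rightarrow> complex) \<Rightarrow> real) \<Rightarrow>
     (('a \<Rightarrow> complex) \<Rightarrow> ('b \<Rightarrow> complex)) \<Rightarrow> bool" where
  "compact_linear_operator X NX Y NY T \<longleftrightarrow>
     (\<forall>f\<in>X. T f \<in> Y) \<and>
     (\<forall>f\<in>X. \<forall>g\<in>X. T (\<lambda>z. f z + g z) = (\<lambda>z. T f z + T g z)) \<and>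
     (\<forall>c. \<forall>f\<in>X. T (\<lambda>z. c * f z) = (\<lambda>z. c * T f z)) \<and>
     (\<forall>S\<subseteq>X. (\<exists>C. \<forall>f\<in>S. NX f \<le> C) \<longrightarrow> relatively_compact_in (norm_topology Y NY) (T ` S))"


section \<open>The extended Cesaro operator\<close>

text \<open>
  The integrand is continuous on \<open>(0,1]\<close> and has a limit at \<open>0\<close>; its junk value at \<open>t = 0\<close> does
  not affect the integral.
\<close>

definition cesaro_op ::
    "('a::complex_banach \<Rightarrow> complex) \<Rightarrow> ('a \<Rightarrow> complex) \<Rightarrow> 'a \<Rightarrow> complex" where
  "cesaro_op \<phi> f z =
     (if z \<in> ball 0 1
      then integral {0..1}
             (\<lambda>t. f (t *\<^sub>R z) * radial_deriv \<phi> (t *\<^sub>R z) * complex_of_real (1 / t))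
      else 0)"

definition E_set ::
    "(real \<Rightarrow> real) \<Rightarrow> ('a::complex_banach \<Rightarrow> complex) \<Rightarrow> real \<Rightarrow> real \<Rightarrow> 'a set" where
  "E_set \<mu> \<phi> \<epsilon> \<rho> =
     {z \<in> ball 0 1. norm z \<le> \<rho> \<and>
        (\<exists>s\<in>{1..inverse \<rho>}. s *\<^sub>R z \<in> ball 0 1 \<and>
           \<mu> (norm (s *\<^sub>R z)) * cmod (radial_deriv \<phi> (s *\<^sub>R z)) \<ge> \<epsilon>)}"


section \<open>The Bloch-type norm induces a metric\<close>

text \<open>
  This makes \<^const>\<open>norm_topology\<close> on \<^term>\<open>bloch \<omega>\<close> a genuine metric topology.
\<close>

lemma holo_ball_has_derivative:
  assumes "f \<in> holo_ball" "z \<in> ball 0 1"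
  shows "(f has_derivative frechet_derivative f (at z)) (at z)"
  using assms unfolding holo_ball_def
  by (auto intro: differentiableI simp flip: frechet_derivative_works)

lemma radial_deriv_diff:
  assumes "f \<in> holo_ball" "g \<in> holo_ball" "z \<in> ball 0 1"
  shows "radial_deriv (\<lambda>z. f z - g z) z = radial_deriv f z - radial_deriv g z"
proof -
  have "((\<lambda>z. f z - g z) has_derivative
          (\<lambda>x. frechet_derivative f (at z) x - frechet_derivative g (at z) x)) (at z)"
    by (intro has_derivative_diff holo_ball_has_derivative assms)
  from frechet_derivative_at[OF this] show ?thesis
    unfolding radial_deriv_def by metis
qed

lemma holo_ball_diff:
  assumes "f \<in> holo_ball" "g \<in> holo_ball"
  shows "(\<lambda>z. f z - g z) \<in> holo_ball"
  unfolding holo_ball_def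
proof (intro CollectI conjI ballI allI impI)
  fix z :: 'a assume z: "z \<in> ball 0 1"
  from assms z obtain D D' where
    "(f has_derivative D) (at z)" "\<And>c x. D (scaleC c x) = c * D x"
    "(g has_derivative D') (at z)" "\<And>c x. D' (scaleC c x) = c * D' x"
    unfolding holo_ball_def by blast
  then show "\<exists>D. ((\<lambda>z. f z - g z) has_derivative D) (at z) \<and> (\<forall>c x. D (scaleC c x) = c * D x)"
    by (intro exI[of _ "\<lambda>x. D x - D' x"]) (auto intro: has_derivative_diff simp: algebra_simps)
next
  fix z :: 'a assume "z \<notin> ball 0 1"
  then show "f z - g z = 0" using assms unfolding holo_ball_def by auto
qed

lemma radial_deriv_eq_0_imp_const:
  assumes f: "f \<in> holo_ball" and 0: "\<And>z. z \<in> ball 0 1 \<Longrightarrow> radial_deriv f z = 0"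
    and z: "z \<in> ball 0 1"
  shows "f z = f 0"
proof -
  let ?g = "\<lambda>t::real. f (t *\<^sub>R z)"
  let ?D = "\<lambda>t. frechet_derivative f (at (t *\<^sub>R z))"
  have b: "t *\<^sub>R z \<in> ball 0 1" if "t \<in> {0..1}" for t
  proof -
    have "\<bar>t\<bar> * norm z \<le> 1 * norm z"
      using that by (intro mult_right_mono) auto
    with z show ?thesis by simp
  qed
  have der: "(?g has_derivative (\<lambda>h. ?D t (h *\<^sub>R z))) (at t within {0..1})"
    if t: "t \<in> {0..1}" for t
  proof (rule has_derivative_compose[where f = "\<lambda>t. t *\<^sub>R z" and g = f])
    show "((\<lambda>t. t *\<^sub>R z) has_derivative (\<lambda>h. h *\<^sub>R z)) (at t within {0..1})"
      by (auto intro!: derivative_eq_intros)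
    show "(f has_derivative ?D t) (at (t *\<^sub>R z))"
      by (rule holo_ball_has_derivative[OF f b[OF t]])
  qed
  have "?g 1 = ?g 0"
  proof (rule has_derivative_zero_unique_strong_interval[where k = "{0}" and a = 0 and b = 1])
    show "continuous_on {0..1} ?g"
      using der by (intro has_derivative_continuous_on) auto
    fix t :: real assume t: "t \<in> {0..1} - {0}"
    then have t': "t \<in> {0..1}" "t \<noteq> 0" by auto
    interpret D: bounded_linear "?D t"
      using has_derivative_bounded_linear[OF holo_ball_has_derivative[OF f b[OF t'(1)]]] .
    have "t *\<^sub>R ?D t z = 0"
      using 0[OF b[OF t'(1)]] by (simp add: radial_deriv_def D.scaleR)
    with t' have "?D t (h *\<^sub>R z) = 0" for h
      by (simp add: D.scaleR)
    with der[OF t'(1)] show "(?g has_derivative (\<lambda>h. 0)) (at t within {0..1})"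
      by simp
  qed auto
  then show ?thesis by simp
qed

lemma bloch_diff:
  assumes w: "\<And>r. r \<in> {0..<1} \<Longrightarrow> \<omega> r > 0" and "f \<in> bloch \<omega>" "g \<in> bloch \<omega>"
  shows "(\<lambda>z. f z - g z) \<in> bloch \<omega>"
    and "bloch_norm \<omega> (\<lambda>z. f z - g z) \<le> bloch_norm \<omega> f + bloch_norm \<omega> g"
proof -
  let ?S = "\<lambda>f z. \<omega> (norm z) * cmod (radial_deriv f z)"
  from assms have h: "f \<in> holo_ball" "g \<in> holo_ball"
    and bf: "bdd_above (?S f ` ball 0 1)" and bg: "bdd_above (?S g ` ball 0 1)"
    by (auto simp: bloch_def)
  have le: "?S (\<lambda>z. f z - g z) z \<le> ?S f z + ?S g z" if "z \<in> ball 0 1" for z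
    using w[of "norm z"] that norm_triangle_ineq4[of "radial_deriv f z" "radial_deriv g z"]
    by (simp add: radial_deriv_diff[OF h that] flip: distrib_left)
  have le': "?S (\<lambda>z. f z - g z) z \<le> (SUP z\<in>ball 0 1. ?S f z) + (SUP z\<in>ball 0 1. ?S g z)"
    if "z \<in> ball 0 1" for z
    using le[OF that] cSUP_upper[OF that bf] cSUP_upper[OF that bg] by linarith
  show "(\<lambda>z. f z - g z) \<in> bloch \<omega>"
    using holo_ball_diff[OF h] le' by (auto simp: bloch_def intro!: bdd_aboveI2)
  have "(SUP z\<in>ball 0 1. ?S (\<lambda>z. f z - g z) z)
          \<le> (SUP z\<in>ball 0 1. ?S f z) + (SUP z\<in>ball 0 1. ?S g z)"
    by (rule cSUP_least) (use le' in auto)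
  then show "bloch_norm \<omega> (\<lambda>z. f z - g z) \<le> bloch_norm \<omega> f + bloch_norm \<omega> g"
    unfolding bloch_norm_def using norm_triangle_ineq4[of "f 0" "g 0"] by linarith
qed

lemma bloch_norm_bounds:
  assumes w: "\<And>r. r \<in> {0..<1} \<Longrightarrow> \<omega> r > 0" and f: "f \<in> bloch \<omega>" and z: "z \<in> ball 0 1"
  shows "cmod (f 0) + \<omega> (norm z) * cmod (radial_deriv f z) \<le> bloch_norm \<omega> f"
    and "0 \<le> bloch_norm \<omega> f"
proof -
  have b: "bdd_above ((\<lambda>z. \<omega> (norm z) * cmod (radial_deriv f z)) ` ball 0 1)"
    using f by (simp add: bloch_def)
  show *: "cmod (f 0) + \<omega> (norm z) * cmod (radial_deriv f z) \<le> bloch_norm \<omega> f"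
    using cSUP_upper[OF z b] by (simp add: bloch_norm_def)
  have "0 \<le> \<omega> (norm z) * cmod (radial_deriv f z)"
    using w[of "norm z"] z by (intro mult_nonneg_nonneg) auto
  with * show "0 \<le> bloch_norm \<omega> f"
    using norm_ge_zero[of "f 0"] by linarith
qed

lemma bloch_norm_eq_0:
  assumes w: "\<And>r. r \<in> {0..<1} \<Longrightarrow> \<omega> r > 0" and f: "f \<in> bloch \<omega>" and 0: "bloch_norm \<omega> f = 0"
  shows "f z = 0"
proof (cases "z \<in> ball 0 1")
  case True
  have h: "f \<in> holo_ball" using f by (simp add: bloch_def)
  have *: "f 0 = 0 \<and> radial_deriv f x = 0" if x: "x \<in> ball 0 1" for x
  proof -
    have p: "\<omega> (norm x) > 0" using w[of "norm x"] x by simp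
    have "cmod (f 0) + \<omega> (norm x) * cmod (radial_deriv f x) \<le> 0"
      using bloch_norm_bounds(1)[OF w f x] 0 by simp
    moreover have "0 \<le> \<omega> (norm x) * cmod (radial_deriv f x)"
      using p by simp
    ultimately have "cmod (f 0) = 0" "\<omega> (norm x) * cmod (radial_deriv f x) = 0"
      using norm_ge_zero[of "f 0"] by linarith+
    with p show ?thesis by simp
  qed
  have "f z = f 0"
    by (rule radial_deriv_eq_0_imp_const[OF h _ True]) (use * in blast)
  with * True show ?thesis by simp
next
  case False
  with f show ?thesis by (simp add: bloch_def holo_ball_def)
qed

lemma bloch_norm_minus_commute:
  assumes "f \<in> holo_ball" "g \<in> holo_ball"
  shows "bloch_norm \<omega> (\<lambda>z. f z - g z) = bloch_norm \<omega> (\<lambda>z. g z - f z)"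
  unfolding bloch_norm_def
  by (intro arg_cong2[where f = "(+)"] SUP_cong refl)
     (simp_all add: radial_deriv_diff assms norm_minus_commute)

lemma Metric_space_bloch:
  assumes "normal_weight \<omega>"
  shows "Metric_space (bloch \<omega>)
           (\<lambda>f g. if f \<in> bloch \<omega> \<and> g \<in> bloch \<omega> then bloch_norm \<omega> (\<lambda>z. f z - g z) else 0)"
proof -
  have w: "\<omega> r > 0" if "r \<in> {0..<1}" for r
    using assms that by (auto simp: normal_weight_def)
  have b0: "(0::'a) \<in> ball 0 1" by simp
  show ?thesis
  proof (unfold_locales, goal_cases)
    case (1 f g)
    have "0 \<le> bloch_norm \<omega> (\<lambda>z. f z - g z)" if "f \<in> bloch \<omega>" "g \<in> bloch \<omega>"
      by (rule bloch_norm_bounds(2)[OF w bloch_diff(1)[OF w that] b0])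
    then show ?case by simp
  next
    case (2 f g)
    then show ?case
      using bloch_norm_minus_commute[of f g \<omega>] by (auto simp: bloch_def)
  next
    case (3 f g)
    have "f = g" if "bloch_norm \<omega> (\<lambda>z. f z - g z) = 0"
      using bloch_norm_eq_0[OF w bloch_diff(1)[OF w 3] that] by (auto intro!: ext)
    moreover have "bloch_norm \<omega> (\<lambda>z::'a. 0) = 0"
      by (simp add: bloch_norm_def radial_deriv_def)
    ultimately show ?case using 3 by auto
  next
    case (4 f g h)
    have "bloch_norm \<omega> (\<lambda>z. f z - h z) \<le>
            bloch_norm \<omega> (\<lambda>z. f z - g z) + bloch_norm \<omega> (\<lambda>z. h z - g z)"
      using bloch_diff(2)[OF w bloch_diff(1)[OF w 4(1,2)] bloch_diff(1)[OF w 4(3,2)]] by simp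
    then show ?case
      using 4 bloch_norm_minus_commute[of h g \<omega>] by (simp add: bloch_def)
  qed
qed

end

theory Submission
  imports Defs "HOL-Complex_Analysis.Complex_Analysis"
begin

text \<open>
  Since \<open>\<R>(T f) = f \<cdot> \<R>\<phi>\<close> and \<open>T f 0 = 0\<close>, the operator is governed by the products
  \<open>\<mu>(z) |\<R>\<phi>(z)| |f(z)|\<close>, where \<open>|f(z)|\<close> is at most a constant times
  \<open>\<parallel>f\<parallel> (1 + I(\<parallel>z\<parallel>))\<close> with \<open>I(r) = \<integral>\<^sub>0\<^sup>r dt/\<omega>(t)\<close>. For sufficiency, the points where
  \<open>\<mu> |\<R>\<phi>|\<close> is small or (in case (ii)) \<open>\<parallel>z\<parallel>\<close> is close to \<open>1\<close> contribute little; the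
  remaining points lie in a relatively compact set \<open>E\<close>, or (in case (i)) project radially onto it
  with little change in \<open>f\<close>. A bounded set of functions is equicontinuous on \<open>E\<close>, so the image is
  totally bounded. For necessity, (i) follows by applying \<open>T\<close> to the constant \<open>1\<close>; for (ii), a
  sequence violating the limit is tested against bounded functions that tend to \<open>0\<close> locally
  uniformly but are comparable to \<open>I(\<parallel>z\<^sub>n\<parallel>)\<close> at \<open>z\<^sub>n\<close>.
\<close>

section \<open>Cauchy estimates on balls of a complex Banach space\<close>

text \<open>Closed balls of an infinite-dimensional space are not compact, so neither Montel's
  theorem nor the boundedness of a continuous function on a smaller ball is at hand; the sets
  \<open>E_set\<close> are the only source of compactness. In case (i) the change under radial
  projection is governed by the tail of a convergent integral; in case (ii) there need be no small
  tail, but the limit condition itself disposes of the points near the sphere.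

  Function theory on the ball is reduced to one variable: restriction to complex lines gives Cauchy
  estimates whose constants do not depend on the direction. From them follow the continuity of
  derivatives, the holomorphy of R f and the completeness of the spaces. For the necessity in (ii),
  a norming functional (Hahn-Banach) carries a function of one variable to the ball with its size at
  a prescribed point intact. Pointwise convergence of the test functions to 0 is enough there, since
  norm convergence of their images determines the radial derivative of the limit at every
  point.\<close>

definition holo_on :: "('a::complex_banach \<Rightarrow> complex) \<Rightarrow> 'a set \<Rightarrow> bool" where
  "holo_on f U \<longleftrightarrow>
     (\<forall>z\<in>U. \<exists>D. (f has_derivative D) (at z) \<and> (\<forall>c x. D (scaleC c x) = c * D x))"

abbreviation fderiv :: "('a::complex_banach \<Rightarrow> complex) \<Rightarrow> 'a \<Rightarrow> 'a \<Rightarrow> complex" where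
  "fderiv f z \<equiv> frechet_derivative f (at z)"

lemma holo_ball_iff: "f \<in> holo_ball \<longleftrightarrow> holo_on f (ball 0 1) \<and> (\<forall>z. z \<notin> ball 0 1 \<longrightarrow> f z = 0)"
  by (simp add: holo_ball_def holo_on_def)

lemma holo_on_subset: "holo_on f U \<Longrightarrow> V \<subseteq> U \<Longrightarrow> holo_on f V"
  by (auto simp: holo_on_def)

lemma holo_onI:
  assumes "\<And>z. z \<in> U \<Longrightarrow> (f has_derivative D z) (at z)"
    and "\<And>z c x. z \<in> U \<Longrightarrow> D z (scaleC c x) = c * D z x"
  shows "holo_on f U"
  using assms unfolding holo_on_def by blast

lemma holo_on_has_derivative:
  assumes "holo_on f U" "z \<in> U"
  shows "(f has_derivative fderiv f z) (at z)"
  using assms unfolding holo_on_def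
  by (auto intro: differentiableI simp flip: frechet_derivative_works)

lemma holo_on_fderiv_scaleC:
  assumes "holo_on f U" "z \<in> U"
  shows "fderiv f z (scaleC c x) = c * fderiv f z x"
proof -
  obtain D where D: "(f has_derivative D) (at z)" "\<And>c x. D (scaleC c x) = c * D x"
    using assms unfolding holo_on_def by blast
  then show ?thesis using frechet_derivative_at[OF D(1)] by metis
qed

lemma fderiv_eq: "(f has_derivative D) (at z) \<Longrightarrow> fderiv f z = D"
  by (rule frechet_derivative_at[symmetric])

lemma holo_on_imp_continuous_on: "holo_on f U \<Longrightarrow> continuous_on U f"
  unfolding holo_on_def
  by (intro continuous_at_imp_continuous_on) (auto intro: has_derivative_continuous)

lemma bounded_linear_fderiv:
  "holo_on f U \<Longrightarrow> z \<in> U \<Longrightarrow> bounded_linear (fderiv f z)"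
  using has_derivative_bounded_linear holo_on_has_derivative by blast

lemma bounded_linear_scaleC_left: "bounded_linear (\<lambda>c. scaleC c (x::'a::complex_banach))"
proof (rule bounded_linear_intro[where K = "norm x"])
  show "scaleC (r *\<^sub>R c) x = r *\<^sub>R scaleC c x" for r c
    by (metis scaleC_of_real scaleC_scaleC scaleR_conv_of_real)
qed (auto simp: scaleC_add_left norm_scaleC)

lemma scaleC_simps [simp]:
  "scaleC 0 (x::'a::complex_banach) = 0" "scaleC c (0::'a) = 0" "scaleC 1 x = x"
proof -
  show "scaleC 0 x = 0" using norm_scaleC[of 0 x] by simp
  show "scaleC c (0::'a) = 0" using norm_scaleC[of c "0::'a"] by simp
  show "scaleC 1 x = x" using scaleC_of_real[of 1 x] by simp
qed

lemma holo_on_line_deriv: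
  assumes "holo_on f U" "z + scaleC l h \<in> U"
  shows "((\<lambda>l. f (z + scaleC l h)) has_field_derivative fderiv f (z + scaleC l h) h) (at l)"
proof -
  have *: "((\<lambda>l. z + scaleC l h) has_derivative (\<lambda>\<mu>. scaleC \<mu> h)) (at l)"
    using has_derivative_add[OF has_derivative_const
        bounded_linear_imp_has_derivative[OF bounded_linear_scaleC_left]] by simp
  have "((\<lambda>l. f (z + scaleC l h)) has_derivative (\<lambda>\<mu>. fderiv f (z + scaleC l h) (scaleC \<mu> h))) (at l)"
    by (rule has_derivative_compose[OF * holo_on_has_derivative[OF assms]])
  then show ?thesis
    by (simp add: has_field_derivative_def holo_on_fderiv_scaleC[OF assms] mult.commute[of _ "fderiv _ _ _"])
qed

text \<open>A disc of radius R/4 about any point of the half disc stays strictly inside the domain,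
  so Cauchy's inequality bounds the first two derivatives there, and Taylor's formula does the rest.
  The constants are explicit but not sharp: 4 and 32 come from 1/(R/4) and 2!/(R/4)^2.\<close>

lemma holomorphic_ball_estimates:
  fixes u :: "complex \<Rightarrow> complex"
  assumes u: "u holomorphic_on ball 0 R" and R: "R > 0"
    and M: "\<And>z. z \<in> ball 0 R \<Longrightarrow> cmod (u z) \<le> M"
  shows "cmod (deriv u 0) \<le> 2 * M / R"
    and "cmod z \<le> R / 2 \<Longrightarrow> cmod (u z - u 0) \<le> 4 * M / R * cmod z"
    and "cmod z \<le> R / 2 \<Longrightarrow> cmod (u z - u 0 - z * deriv u 0) \<le> 32 * M / R\<^sup>2 * (cmod z)\<^sup>2"
proof -
  have est: "cmod ((deriv ^^ n) u w) \<le> fact n * M / r ^ n"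
    if w: "cmod w + r < R" and r: "r > 0" for n w r
  proof (rule Cauchy_inequality)
    have sub: "cball w r \<subseteq> ball 0 R"
    proof
      fix x assume "x \<in> cball w r"
      then have "norm (x - w) \<le> r" by (simp add: dist_norm norm_minus_commute)
      then show "x \<in> ball 0 R" using norm_triangle_sub[of x w] w by simp
    qed
    show "u holomorphic_on ball w r"
      using u sub by (meson holomorphic_on_subset ball_subset_cball order_trans)
    show "continuous_on (cball w r) u"
      using u sub by (meson holomorphic_on_subset holomorphic_on_imp_continuous_on)
    show "r > 0" by fact
    show "cmod (u x) \<le> M" if "cmod (w - x) = r" for x
      using that sub M[of x] by (force simp: dist_norm)
  qed
  have "cmod (deriv u 0) \<le> M / (R/2)" using est[of 0 "R/2" 1] R by simp
  then show "cmod (deriv u 0) \<le> 2 * M / R" by (simp add: mult.commute)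
  define S where "S = cball (0::complex) (R/2)"
  have der: "((deriv ^^ i) u has_field_derivative (deriv ^^ Suc i) u x) (at x within S)"
    if "x \<in> S" for i x
  proof -
    have "(deriv ^^ i) u holomorphic_on ball 0 R"
      by (intro holomorphic_higher_deriv u) auto
    moreover have "x \<in> ball 0 R" using that R by (auto simp: S_def)
    ultimately show ?thesis
      by (simp add: holomorphic_derivI has_field_derivative_at_within)
  qed
  have e1: "cmod ((deriv ^^ 1) u x) \<le> 4 * M / R" and e2: "cmod ((deriv ^^ 2) u x) \<le> 32 * M / R\<^sup>2"
    if "x \<in> S" for x
  proof -
    have "cmod x + R / 4 < R" using that R by (auto simp: S_def)
    from est[OF this, of 1] est[OF this, of 2] R
    have "cmod ((deriv ^^ 1) u x) \<le> M / (R / 4)" "cmod ((deriv ^^ 2) u x) \<le> 2 * M / (R / 4)\<^sup>2"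
      by simp_all
    then show "cmod ((deriv ^^ 1) u x) \<le> 4 * M / R" "cmod ((deriv ^^ 2) u x) \<le> 32 * M / R\<^sup>2"
      by (simp_all add: power2_eq_square mult.commute)
  qed
  show "cmod (u z - u 0) \<le> 4 * M / R * cmod z" if "cmod z \<le> R / 2"
    using complex_Taylor[where f = "\<lambda>i. (deriv ^^ i) u" and n = 0, OF _ der, of "4 * M / R" 0 z] e1 that R
    by (auto simp: S_def)
  show "cmod (u z - u 0 - z * deriv u 0) \<le> 32 * M / R\<^sup>2 * (cmod z)\<^sup>2" if "cmod z \<le> R / 2"
    using complex_Taylor[where f = "\<lambda>i. (deriv ^^ i) u" and n = 1, OF _ der, of "32 * M / R\<^sup>2" 0 z]
      e2 that R
    by (auto simp: S_def numeral_2_eq_2 algebra_simps)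
qed

text \<open>Apply the one-variable estimates to l \<mapsto> f(z + l k), where k is the unit vector
  in the direction of h. The disc then has the same radius R in every direction, which makes the
  bounds uniform in h.\<close>

lemma holo_on_ball_estimates:
  assumes f: "holo_on f (ball z R)" and R: "R > 0"
    and M: "\<And>w. w \<in> ball z R \<Longrightarrow> cmod (f w) \<le> M"
  shows "cmod (fderiv f z h) \<le> 2 * M / R * norm h"
    and "norm h \<le> R / 2 \<Longrightarrow> cmod (f (z + h) - f z) \<le> 4 * M / R * norm h"
    and "norm h \<le> R / 2 \<Longrightarrow>
           cmod (f (z + h) - f z - fderiv f z h) \<le> 32 * M / R\<^sup>2 * (norm h)\<^sup>2"
proof -
  have z: "z \<in> ball z R" using R by simp
  have "cmod (fderiv f z h) \<le> 2 * M / R * norm h \<and>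
    (norm h \<le> R / 2 \<longrightarrow> cmod (f (z + h) - f z) \<le> 4 * M / R * norm h) \<and>
    (norm h \<le> R / 2 \<longrightarrow> cmod (f (z + h) - f z - fderiv f z h) \<le> 32 * M / R\<^sup>2 * (norm h)\<^sup>2)"
  proof (cases "h = 0")
    case True
    then show ?thesis using linear_0[OF bounded_linear.linear[OF bounded_linear_fderiv[OF f z]]] by simp
  next
    case False
    define k where "k = scaleC (complex_of_real (1 / norm h)) h"
    have nk: "norm k = 1" using False by (simp add: k_def norm_scaleC norm_divide)
    have hk: "h = scaleC (complex_of_real (norm h)) k"
      using False by (simp add: k_def scaleC_scaleC del: of_real_mult of_real_divide flip: of_real_mult)
    define u where "u = (\<lambda>l. f (z + scaleC l k))"
    have inb: "z + scaleC l k \<in> ball z R" if "l \<in> ball 0 R" for l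
      using that nk by (simp add: dist_norm norm_scaleC)
    have du: "(u has_field_derivative fderiv f (z + scaleC l k) k) (at l)" if "l \<in> ball 0 R" for l
      unfolding u_def by (rule holo_on_line_deriv[OF f inb[OF that]])
    have hol: "u holomorphic_on ball 0 R"
      using du unfolding holomorphic_on_open[OF open_ball] by blast
    have d0: "deriv u 0 = fderiv f z k"
      using DERIV_imp_deriv[OF du[of 0]] R by simp
    have fh: "fderiv f z h = complex_of_real (norm h) * fderiv f z k"
      by (subst hk) (rule holo_on_fderiv_scaleC[OF f z])
    have uh: "u (complex_of_real (norm h)) = f (z + h)" "u 0 = f z"
      by (simp_all add: u_def flip: hk)
    note est = holomorphic_ball_estimates[OF hol R, of M, unfolded d0]
    have Mu: "cmod (u l) \<le> M" if "l \<in> ball 0 R" for l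
      using M[OF inb[OF that]] by (simp add: u_def)
    have "cmod (fderiv f z h) \<le> 2 * M / R * norm h"
      using mult_right_mono[OF est(1)[OF Mu], of "norm h"] fh by (simp add: norm_mult mult.commute)
    then show ?thesis
      using est(2,3)[OF Mu, of "complex_of_real (norm h)"] by (simp add: uh fh)
  qed
  then show "cmod (fderiv f z h) \<le> 2 * M / R * norm h"
    and "norm h \<le> R / 2 \<Longrightarrow> cmod (f (z + h) - f z) \<le> 4 * M / R * norm h"
    and "norm h \<le> R / 2 \<Longrightarrow>
           cmod (f (z + h) - f z - fderiv f z h) \<le> 32 * M / R\<^sup>2 * (norm h)\<^sup>2"
    by blast+
qed

lemma holo_on_diff:
  assumes f: "holo_on f U" and g: "holo_on g U"
  shows "holo_on (\<lambda>z. f z - g z) U"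
    and "z \<in> U \<Longrightarrow> fderiv (\<lambda>z. f z - g z) z h = fderiv f z h - fderiv g z h"
proof -
  have *: "((\<lambda>z. f z - g z) has_derivative (\<lambda>h. fderiv f z h - fderiv g z h)) (at z)" if "z \<in> U" for z
    by (intro has_derivative_diff holo_on_has_derivative[OF f] holo_on_has_derivative[OF g] that)
  show "holo_on (\<lambda>z. f z - g z) U"
    by (rule holo_onI[OF *])
      (auto simp: holo_on_fderiv_scaleC[OF f] holo_on_fderiv_scaleC[OF g] right_diff_distrib)
  show "z \<in> U \<Longrightarrow> fderiv (\<lambda>z. f z - g z) z h = fderiv f z h - fderiv g z h"
    by (simp add: fderiv_eq[OF *])
qed

lemma holo_on_mult:
  assumes f: "holo_on f U" and g: "holo_on g U"
  shows "holo_on (\<lambda>z. f z * g z) U"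
  by (rule holo_onI[OF has_derivative_mult[OF holo_on_has_derivative[OF f] holo_on_has_derivative[OF g]]])
     (auto simp: holo_on_fderiv_scaleC[OF f] holo_on_fderiv_scaleC[OF g] algebra_simps)

lemma holo_on_cmult:
  assumes f: "holo_on f U"
  shows "holo_on (\<lambda>z. c * f z) U" 
proof -
  have "((\<lambda>z. c * f z) has_derivative (\<lambda>h. c * fderiv f z h)) (at z)" if "z \<in> U" for z
    by (rule has_derivative_mult_right[OF holo_on_has_derivative[OF f that]])
  then show ?thesis
    by (rule holo_onI) (auto simp: holo_on_fderiv_scaleC[OF f])
qed

text \<open>One statement for two substitutions: translations (c = 1) serve the continuity of the
  derivative, dilations (a = 0) the difference quotients of the radial derivative.\<close>

lemma holo_on_compose_scaleC_shift:
  assumes f: "holo_on f V" and V: "\<And>z. z \<in> U \<Longrightarrow> a + scaleC c z \<in> V"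
  shows "holo_on (\<lambda>z. f (a + scaleC c z)) U"
    and "z \<in> U \<Longrightarrow> fderiv (\<lambda>z. f (a + scaleC c z)) z h = c * fderiv f (a + scaleC c z) h"
proof -
  have bl: "bounded_linear (\<lambda>x::'a. scaleC c x)"
  proof (rule bounded_linear_intro[where K = "cmod c"])
    show "scaleC c (r *\<^sub>R x) = r *\<^sub>R scaleC c x" for r and x :: 'a
      by (simp add: scaleC_scaleC mult.commute flip: scaleC_of_real)
  qed (auto simp: scaleC_add_right norm_scaleC)
  have *: "((\<lambda>z. f (a + scaleC c z)) has_derivative (\<lambda>h. c * fderiv f (a + scaleC c z) h)) (at z)"
    if "z \<in> U" for z
  proof -
    have "((\<lambda>z. a + scaleC c z) has_derivative (\<lambda>h. scaleC c h)) (at z)"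
      using has_derivative_add[OF has_derivative_const bounded_linear_imp_has_derivative[OF bl]] by simp
    from has_derivative_compose[OF this holo_on_has_derivative[OF f V[OF that]]]
    show ?thesis by (simp add: holo_on_fderiv_scaleC[OF f V[OF that]])
  qed
  show "holo_on (\<lambda>z. f (a + scaleC c z)) U"
    by (rule holo_onI[OF *]) (auto simp: holo_on_fderiv_scaleC[OF f V])
  show "z \<in> U \<Longrightarrow> fderiv (\<lambda>z. f (a + scaleC c z)) z h = c * fderiv f (a + scaleC c z) h"
    by (simp add: fderiv_eq[OF *])
qed

text \<open>The bound that the Cauchy estimates need comes from continuity at the centre;
  compactness of closed balls could not provide it.\<close>

lemma holo_on_locally_bounded:
  assumes f: "holo_on f U" and U: "open U" and z: "z \<in> U"
  obtains R M where "R > 0" "ball z R \<subseteq> U" "M > 0" "\<And>w. w \<in> ball z R \<Longrightarrow> cmod (f w) \<le> M"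
proof -
  have "isCont f z"
    using holo_on_imp_continuous_on[OF f] U z by (simp add: continuous_on_eq_continuous_at)
  then obtain d where d: "d > 0" "\<And>w. dist w z < d \<Longrightarrow> dist (f w) (f z) < 1"
    unfolding continuous_at_eps_delta by (metis zero_less_one)
  obtain e where e: "e > 0" "ball z e \<subseteq> U" using U z openE by blast
  have "cmod (f w) \<le> cmod (f z) + 1" if "dist w z < d" for w
    using d(2)[OF that] norm_triangle_sub[of "f w" "f z"] by (simp add: dist_norm)
  then have "\<And>w. w \<in> ball z (min d e) \<Longrightarrow> cmod (f w) \<le> cmod (f z) + 1"
    by (simp add: dist_commute)
  moreover have "ball z (min d e) \<subseteq> U" using e by auto
  moreover have "min d e > 0" "cmod (f z) + 1 > 0" using d e by (auto intro: add_nonneg_pos)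
  ultimately show ?thesis using that by blast
qed

text \<open>The translate of f by w - z, minus f, has derivative Df(w) - Df(z) at z. A Cauchy
  estimate bounds this by the size of the difference near z, and a second one shows that this size
  is O(\<parallel>w - z\<parallel>).\<close>

lemma continuous_on_fderiv:
  assumes f: "holo_on f U" and U: "open U"
  shows "continuous_on U (\<lambda>w. fderiv f w h)"
proof (rule continuous_at_imp_continuous_on, rule ballI)
  fix z assume "z \<in> U"
  then obtain R M where R: "R > 0" "ball z R \<subseteq> U" "M > 0"
    and M: "\<And>w. w \<in> ball z R \<Longrightarrow> cmod (f w) \<le> M"
    using holo_on_locally_bounded[OF f U] by metis
  \<comment> \<open>Leaves room inside \<open>ball z R\<close> both for the shift by w - z and for
    balls of radius R/2 around the points of \<open>ball z r\<close>.\<close>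
  define r where "r = R / 4"
  have r: "r > 0" using R by (simp add: r_def)
  have fR: "holo_on f (ball z R)" by (rule holo_on_subset[OF f R(2)])
  have lip: "cmod (fderiv f w h - fderiv f z h) \<le> (2 * (4 * M / (R/2)) / r * norm h) * norm (w - z)"
    if w: "dist w z < r" for w
  proof -
    let ?k = "\<lambda>x. f ((w - z) + scaleC 1 x) - f x"
    have mem: "(w - z) + scaleC 1 x \<in> ball z R" if "x \<in> ball z r" for x
      using norm_triangle_ineq[of "x - z" "w - z"] that w R
      by (auto simp: dist_norm r_def norm_minus_commute algebra_simps)
    have h1: "holo_on (\<lambda>x. f ((w - z) + scaleC 1 x)) (ball z r)"
      by (rule holo_on_compose_scaleC_shift(1)[OF fR mem])
    have h2: "holo_on f (ball z r)"
      by (rule holo_on_subset[OF fR]) (use R in \<open>auto simp: r_def intro: subset_ball\<close>)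
    have z: "z \<in> ball z r" using r by simp
    have eq: "fderiv ?k z h = fderiv f w h - fderiv f z h"
      using holo_on_diff(2)[OF h1 h2 z] holo_on_compose_scaleC_shift(2)[OF fR mem z] by simp
    have "cmod (?k x) \<le> 4 * M / (R/2) * norm (w - z)" if x: "x \<in> ball z r" for x
    proof -
      have sub: "ball x (R/2) \<subseteq> ball z R"
      proof
        fix y assume "y \<in> ball x (R/2)"
        with x R(1) dist_triangle[of z y x] show "y \<in> ball z R" by (simp add: r_def)
      qed
      have "norm (w - z) \<le> R / 2 / 2" using w by (simp add: dist_norm r_def)
      have "cmod (f w) \<le> M" if "w \<in> ball x (R/2)" for w using that M sub by blast
      from holo_on_ball_estimates(2)[OF holo_on_subset[OF fR sub] _ this \<open>norm (w - z) \<le> R / 2 / 2\<close>] R(1)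
      show ?thesis by (simp add: add.commute)
    qed
    from holo_on_ball_estimates(1)[OF holo_on_diff(1)[OF h1 h2] r this, of h] show ?thesis
      by (simp only: eq) (simp add: mult_ac)
  qed
  have "\<forall>\<^sub>F w in at z. dist w z < r" using r by (auto simp: eventually_at)
  then have "\<forall>\<^sub>F w in at z. norm (fderiv f w h - fderiv f z h) \<le> (2 * (4 * M / (R/2)) / r * norm h) * norm (w - z)"
    by eventually_elim (use lip in blast)
  moreover have "((\<lambda>w. (2 * (4 * M / (R/2)) / r * norm h) * norm (w - z)) \<longlongrightarrow> 0) (at z)"
    using R r by (auto intro!: tendsto_eq_intros)
  ultimately have "((\<lambda>w. fderiv f w h - fderiv f z h) \<longlongrightarrow> 0) (at z)"
    by (rule Lim_null_comparison)
  then show "isCont (\<lambda>w. fderiv f w h) z"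
    unfolding isCont_def by (simp add: LIM_zero_iff)
qed

section \<open>Uniform limits, radial derivatives and the Cesaro operator\<close>

text \<open>The Cauchy estimate on balls of radius R/2 turns uniform convergence of the functions
  into uniform convergence of the derivatives relative to \<parallel>h\<parallel>, which is what
  differentiating a limit requires.\<close>

lemma holo_on_uniform_limit:
  assumes F: "\<And>n. holo_on (F n) (ball z R)" and R: "R > 0"
    and ul: "uniform_limit (ball z R) F f sequentially"
  shows "holo_on f (ball z (R/2))"
    and "(\<lambda>n. fderiv (F n) z h) \<longlonglongrightarrow> fderiv f z h"
proof -
  define S where "S = ball z (R/2)"
  have sub: "ball x (R/2) \<subseteq> ball z R" if "x \<in> S" for x
  proof
    fix y assume "y \<in> ball x (R/2)"
    with that dist_triangle[of z y x] show "y \<in> ball z R" by (simp add: S_def)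
  qed
  have xS: "x \<in> ball z R" if "x \<in> S" for x using that R by (auto simp: S_def)
  have fd: "cmod (fderiv (F n) x h - fderiv (F m) x h) \<le> 8 * e / R * norm h"
    if e: "\<And>y. y \<in> ball z R \<Longrightarrow> cmod (F n y - f y) < e" "\<And>y. y \<in> ball z R \<Longrightarrow> cmod (F m y - f y) < e"
      and x: "x \<in> S" for n m x h e
  proof -
    have b: "cmod (F n y - F m y) \<le> 2 * e" if "y \<in> ball x (R/2)" for y
    proof -
      have y: "y \<in> ball z R" using that sub x by blast
      show ?thesis
        using norm_triangle_ineq4[of "F n y - f y" "F m y - f y"] e(1)[OF y] e(2)[OF y] by simp
    qed
    have "holo_on (\<lambda>y. F n y - F m y) (ball x (R/2))"
      by (intro holo_on_diff(1) holo_on_subset[OF F sub[OF x]])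
    from holo_on_ball_estimates(1)[OF this _ b] R
    show ?thesis using holo_on_diff(2)[OF F F xS[OF x]] by simp
  qed
  have ev: "\<exists>N. \<forall>n\<ge>N. \<forall>y\<in>ball z R. cmod (F n y - f y) < e" if "e > 0" for e
    using uniform_limitD[OF ul that] by (auto simp: eventually_sequentially dist_norm)
  have ucauchy: "\<exists>N. \<forall>n\<ge>N. \<forall>m\<ge>N. \<forall>x\<in>S. \<forall>h. cmod (fderiv (F n) x h - fderiv (F m) x h) \<le> e * norm h"
    if "e > 0" for e
  proof -
    have "e * R / 8 > 0" using that R by simp
    from ev[OF this] obtain N where
      N: "\<And>n y. n \<ge> N \<Longrightarrow> y \<in> ball z R \<Longrightarrow> cmod (F n y - f y) < e * R / 8" by blast
    have "cmod (fderiv (F n) x h - fderiv (F m) x h) \<le> 8 * (e * R / 8) / R * norm h"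
      if "n \<ge> N" "m \<ge> N" "x \<in> S" for n m x h
      by (rule fd) (use N that in auto)
    then show ?thesis using R by (intro exI[of _ N]) auto
  qed
  define g' where "g' = (\<lambda>x h. lim (\<lambda>n. fderiv (F n) x h))"
  have conv: "(\<lambda>n. fderiv (F n) x h) \<longlonglongrightarrow> g' x h" if x: "x \<in> S" for x h
  proof -
    have "Cauchy (\<lambda>n. fderiv (F n) x h)"
    proof (rule CauchyI)
      fix e :: real assume e: "e > 0"
      define e' where "e' = e / (norm h + 1)"
      have e': "e' > 0" using e by (simp add: e'_def add_nonneg_pos)
      have "e' * norm h < e"
        using e by (simp add: e'_def divide_less_eq add_nonneg_pos)
      with ucauchy[OF e'] x show "\<exists>M. \<forall>m\<ge>M. \<forall>n\<ge>M. norm (fderiv (F m) x h - fderiv (F n) x h) < e"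
        by (meson le_less_trans)
    qed
    then show ?thesis
      unfolding g'_def using Cauchy_convergent convergent_LIMSEQ_iff by blast
  qed
  have "\<forall>\<^sub>F n in sequentially. \<forall>x\<in>S. \<forall>h. norm (fderiv (F n) x h - g' x h) \<le> e * norm h"
    if e: "e > 0" for e
  proof -
    obtain N where N: "\<And>n m x h. n \<ge> N \<Longrightarrow> m \<ge> N \<Longrightarrow> x \<in> S \<Longrightarrow>
        cmod (fderiv (F n) x h - fderiv (F m) x h) \<le> e * norm h"
      using ucauchy[OF e] by blast
    have "norm (fderiv (F n) x h - g' x h) \<le> e * norm h" if n: "n \<ge> N" and x: "x \<in> S" for n x h
    proof (rule tendsto_upperbound)
      show "(\<lambda>m. norm (fderiv (F n) x h - fderiv (F m) x h)) \<longlonglongrightarrow> norm (fderiv (F n) x h - g' x h)"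
        by (intro tendsto_intros conv x)
      show "\<forall>\<^sub>F m in sequentially. norm (fderiv (F n) x h - fderiv (F m) x h) \<le> e * norm h"
        using N[OF n _ x] by (auto simp: eventually_sequentially)
    qed simp
    then show ?thesis by (auto simp: eventually_sequentially)
  qed
  moreover have "((F n) has_derivative fderiv (F n) x) (at x within S)" if "x \<in> S" for n x
    using holo_on_has_derivative[OF F xS[OF that]] has_derivative_at_withinI by blast
  moreover have limF: "(\<lambda>n. F n x) \<longlonglongrightarrow> f x" if "x \<in> ball z R" for x
    using tendsto_uniform_limitI[OF ul that] .
  moreover have zS: "z \<in> S" and "convex S" using R by (auto simp: S_def)
  ultimately obtain g where
    g: "\<And>x. x \<in> S \<Longrightarrow> (\<lambda>n. F n x) \<longlonglongrightarrow> g x \<and> (g has_derivative g' x) (at x within S)"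
    using has_derivative_sequence[of S F "\<lambda>n. fderiv (F n)" g' z "f z"] xS[of z] by blast
  have gf: "g x = f x" if "x \<in> S" for x
    using g[OF that] limF[OF xS[OF that]] LIMSEQ_unique by blast
  have der: "(f has_derivative g' x) (at x)" if x: "x \<in> S" for x
  proof -
    have "(g has_derivative g' x) (at x)"
      using g[OF x] x by (simp add: S_def at_within_open[OF _ open_ball])
    then show ?thesis
      by (rule has_derivative_transform_within_open[of _ _ _ _ S]) (use x gf in \<open>auto simp: S_def\<close>)
  qed
  show "holo_on f (ball z (R/2))"
  proof (rule holo_onI[of _ _ g'])
    fix x c h assume x: "x \<in> ball z (R/2)"
    then have x: "x \<in> S" by (simp add: S_def)
    show "(f has_derivative g' x) (at x)" by (rule der[OF x])
    have "(\<lambda>n. c * fderiv (F n) x h) \<longlonglongrightarrow> g' x (scaleC c h)"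
      using conv[OF x, of "scaleC c h"] by (simp add: holo_on_fderiv_scaleC[OF F xS[OF x]])
    moreover have "(\<lambda>n. c * fderiv (F n) x h) \<longlonglongrightarrow> c * g' x h"
      by (intro tendsto_intros conv x)
    ultimately show "g' x (scaleC c h) = c * g' x h" by (rule LIMSEQ_unique)
  qed
  show "(\<lambda>n. fderiv (F n) z h) \<longlonglongrightarrow> fderiv f z h"
    using conv[OF zS] fderiv_eq[OF der[OF zS]] by simp
qed

text \<open>R f is a locally uniform limit of the holomorphic difference quotients (f((1 + q)w) -
  f(w))/q, so no second derivative of f has to be constructed. The quadratic Taylor remainder makes
  the error O(q).\<close>

lemma holo_on_radial_deriv:
  assumes f: "holo_on f (ball 0 1)"
  shows "holo_on (radial_deriv f) (ball 0 1)"
proof -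
  have "\<exists>r>0. holo_on (radial_deriv f) (ball z r)" if z: "z \<in> ball 0 1" for z :: 'a
  proof -
    obtain R M where R: "R > 0" "ball z R \<subseteq> ball 0 1" "M > 0"
      and M: "\<And>w. w \<in> ball z R \<Longrightarrow> cmod (f w) \<le> M"
      using holo_on_locally_bounded[OF f open_ball z] by metis
    define r where "r = R/2"
    have r: "r > 0" using R by (simp add: r_def)
    \<comment> \<open>The sequence starts at index k so that every increment q w has norm at most
      r/2, the range of the remainder estimate.\<close>
    obtain k :: nat where k: "1 / real (Suc k) < r / 2"
      using r nat_approx_posE[of "r/2"] by auto
    define q :: "nat \<Rightarrow> real" where "q = (\<lambda>n. 1 / real (Suc (n + k)))"
    have q: "q n > 0" "q n \<le> r / 2" for n
    proof -
      show "q n > 0" by (simp add: q_def)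
      have "q n \<le> 1 / real (Suc k)" by (simp add: q_def frac_le)
      with k show "q n \<le> r / 2" by simp
    qed
    have sub: "ball w r \<subseteq> ball z R" if "w \<in> ball z r" for w
    proof
      fix y assume "y \<in> ball w r"
      with that dist_triangle[of z y w] show "y \<in> ball z R" by (simp add: r_def)
    qed
    have norm1: "norm w \<le> 1" if "w \<in> ball z r" for w
    proof -
      have "w \<in> ball 0 1" using sub[OF that] r R(2) by force
      then show ?thesis by simp
    qed
    define F where "F = (\<lambda>n w. complex_of_real (1 / q n) *
        (f (0 + scaleC (complex_of_real (1 + q n)) w) - f w))"
    have arg: "0 + scaleC (complex_of_real (1 + q n)) w = w + q n *\<^sub>R w" for n w
      using scaleC_of_real[of "1 + q n" w] by (simp add: scaleR_add_left)
    have step: "norm (q n *\<^sub>R w) \<le> r / 2" if "w \<in> ball z r" for n w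
    proof -
      have "q n * norm w \<le> q n" using norm1[OF that] q(1)[of n] by simp
      also have "\<dots> \<le> r / 2" by (rule q(2))
      finally show ?thesis using q(1)[of n] by simp
    qed
    have "holo_on (F n) (ball z r)" for n
    proof -
      have "0 + scaleC (complex_of_real (1 + q n)) w \<in> ball z R" if w: "w \<in> ball z r" for w
      proof -
        have "w + q n *\<^sub>R w \<in> ball w r" using step[OF w, of n] r by (simp add: dist_norm)
        with sub[OF w] show ?thesis unfolding arg by blast
      qed
      moreover have "ball z r \<subseteq> ball 0 1" using R by (auto simp: r_def)
      ultimately show ?thesis
        unfolding F_def
        by (intro holo_on_cmult holo_on_diff(1) holo_on_compose_scaleC_shift(1)[OF holo_on_subset[OF f R(2)]]
            holo_on_subset[OF f]) auto
    qed
    moreover have "uniform_limit (ball z r) F (radial_deriv f) sequentially"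
    proof (rule uniform_limitI)
      fix e :: real assume e: "e > 0"
      have b: "dist (F n w) (radial_deriv f w) \<le> 32 * M / r\<^sup>2 * q n" if w: "w \<in> ball z r" for n w
      proof -
        have "cmod (f x) \<le> M" if "x \<in> ball w r" for x using sub[OF w] M that by blast
        note est = holo_on_ball_estimates(3)[OF holo_on_subset[OF f] r this step[OF w, of n]]
        have w1: "w \<in> ball 0 1" using sub[OF w] r R(2) by force
        interpret D: bounded_linear "fderiv f w" by (rule bounded_linear_fderiv[OF f w1])
        have "F n w - radial_deriv f w =
            complex_of_real (1 / q n) * (f (w + q n *\<^sub>R w) - f w - fderiv f w (q n *\<^sub>R w))"
          using q(1)[of n] unfolding F_def arg
          by (simp add: radial_deriv_def D.scaleR scaleR_conv_of_real algebra_simps)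
        then have "dist (F n w) (radial_deriv f w) =
            1 / q n * cmod (f (w + q n *\<^sub>R w) - f w - fderiv f w (q n *\<^sub>R w))"
          using q(1)[of n] by (simp add: dist_norm norm_mult norm_divide)
        also have "\<dots> \<le> 1 / q n * (32 * M / r\<^sup>2 * (norm (q n *\<^sub>R w))\<^sup>2)"
          using est sub[OF w] R(2) q(1)[of n] by (intro mult_left_mono) auto
        also have "\<dots> \<le> 1 / q n * (32 * M / r\<^sup>2 * (q n)\<^sup>2)"
        proof -
          have "norm (q n *\<^sub>R w) \<le> q n" 
            using norm1[OF w] q(1)[of n] mult_left_mono[of "norm w" 1 "q n"] by simp
          then show ?thesis
            using q(1)[of n] R(3) by (intro mult_left_mono power_mono) auto
        qed
        also have "\<dots> = 32 * M / r\<^sup>2 * q n"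
          using q(1)[of n] by (simp add: power2_eq_square)
        finally show ?thesis .
      qed
      have "q \<longlonglongrightarrow> 0"
        unfolding q_def using LIMSEQ_ignore_initial_segment[OF lim_1_over_n[where 'a = real], of "Suc k"] by simp
      then have "(\<lambda>n. 32 * M / r\<^sup>2 * q n) \<longlonglongrightarrow> 0"
        by (rule tendsto_mult_right_zero)
      then have "\<forall>\<^sub>F n in sequentially. 32 * M / r\<^sup>2 * q n < e"
        using e by (rule order_tendstoD(2))
      then show "\<forall>\<^sub>F n in sequentially. \<forall>x\<in>ball z r. dist (F n x) (radial_deriv f x) < e"
        by eventually_elim (use b in \<open>meson le_less_trans\<close>)
    qed
    ultimately have "holo_on (radial_deriv f) (ball z (r/2))"
      using holo_on_uniform_limit(1)[OF _ r] by blast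
    then show ?thesis using r by (intro exI[of _ "r/2"]) auto
  qed
  then show ?thesis unfolding holo_on_def by (meson centre_in_ball)
qed

text \<open>Provides one radius and one bound for the whole segment from 0 to z, so that remainders
  can be integrated along it.\<close>

lemma holo_on_bounded_near_compact:
  assumes f: "holo_on f U" and U: "open U" and K: "compact K" "K \<subseteq> U"
  obtains e M where "e > 0" "M > 0" "\<And>x. x \<in> K \<Longrightarrow> ball x e \<subseteq> U"
    "\<And>x w. x \<in> K \<Longrightarrow> w \<in> ball x e \<Longrightarrow> cmod (f w) \<le> M"
proof -
  have cont: "continuous_on U f" by (rule holo_on_imp_continuous_on[OF f])
  have "bounded (f ` K)"
    using K cont by (meson compact_continuous_image compact_imp_bounded continuous_on_subset)
  then obtain B where B: "B > 0" "\<And>x. x \<in> K \<Longrightarrow> cmod (f x) \<le> B"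
    unfolding bounded_pos by blast
  define V where "V = U \<inter> f -` ball 0 (B + 1)"
  have "open V" unfolding V_def
    by (rule continuous_open_preimage[OF cont U open_ball])
  moreover have "K \<subseteq> V" using B K(2) unfolding V_def by force
  ultimately obtain e where "e > 0" "(\<Union>x\<in>K. ball x e) \<subseteq> V"
    using compact_subset_open_imp_ball_epsilon_subset[OF K(1)] by metis
  then show ?thesis
    using B(1) by (intro that[of e "B + 1"]) (auto simp: V_def subset_iff less_imp_le)
qed

section \<open>Integration along rays from the origin\<close>

lemma scaleR_mem_unit_ball:
  assumes "z \<in> ball (0::'a::real_normed_vector) 1" "0 \<le> t" "t \<le> 1"
  shows "t *\<^sub>R z \<in> ball 0 1"
proof -
  have "\<bar>t\<bar> * norm z \<le> 1 * norm z" using assms by (intro mult_right_mono) auto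
  with assms show ?thesis by simp
qed

lemma holo_on_ray_deriv:
  assumes f: "holo_on f U" and z: "t *\<^sub>R z \<in> U"
  shows "((\<lambda>t. f (t *\<^sub>R z)) has_vector_derivative fderiv f (t *\<^sub>R z) z) (at t within S)"
proof -
  interpret D: bounded_linear "fderiv f (t *\<^sub>R z)" by (rule bounded_linear_fderiv[OF f z])
  have "((\<lambda>t. f (t *\<^sub>R z)) has_derivative (\<lambda>h. fderiv f (t *\<^sub>R z) (h *\<^sub>R z))) (at t within S)"
    by (rule has_derivative_compose[where f = "\<lambda>t. t *\<^sub>R z" and g = f, OF _ holo_on_has_derivative[OF f z]])
       (auto intro!: derivative_eq_intros)
  then show ?thesis by (simp add: has_vector_derivative_def D.scaleR)
qed

context
  fixes \<psi> :: "'a::complex_banach \<Rightarrow> complex"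
  assumes hol: "holo_on \<psi> (ball 0 1)" and psi0: "\<psi> 0 = 0"
begin

text \<open>Since \<psi>(0) = 0, the singularity of \<psi>(lz)/l at l = 0 is removable, and the
  continuous extension agrees with the integrand except possibly at t = 0.\<close>

lemma ray_quotient_integrable:
  assumes z: "z \<in> ball 0 1"
  shows "(\<lambda>t. \<psi> (t *\<^sub>R z) * complex_of_real (1 / t)) integrable_on {0..1}"
proof -
  define S where "S = {l. scaleC l z \<in> ball 0 1}"
  have "continuous_on UNIV (\<lambda>l. scaleC l z)"
    using bounded_linear.linear[OF bounded_linear_scaleC_left]
      linear_continuous_on[OF bounded_linear_scaleC_left] by blast
  then have "open S" 
    unfolding S_def using open_vimage[OF open_ball[of "0::'a" 1]] by (simp only: vimage_def)
  define u where "u = (\<lambda>l. \<psi> (0 + scaleC l z))"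
  have "\<exists>D. (u has_field_derivative D) (at l)" if "l \<in> S" for l
    using holo_on_line_deriv[OF hol, of 0 l z] that unfolding u_def S_def by auto
  then have "u holomorphic_on S"
    unfolding holomorphic_on_open[OF \<open>open S\<close>] by blast
  then have "(\<lambda>l. if l = 0 then deriv u 0 else (u l - u 0) / (l - 0)) holomorphic_on S"
    using \<open>open S\<close> by (rule pole_lemma_open)
  then have *: "continuous_on S (\<lambda>l. if l = 0 then deriv u 0 else (u l - u 0) / (l - 0))"
    by (rule holomorphic_on_imp_continuous_on)
  have sub: "complex_of_real ` {0..1} \<subseteq> S"
    using scaleR_mem_unit_ball[OF z] by (auto simp: S_def scaleC_of_real)
  have "continuous_on {0..1} (\<lambda>t. if complex_of_real t = 0 then deriv u 0
      else (u (complex_of_real t) - u 0) / (complex_of_real t - 0))"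
    by (rule continuous_on_compose2[OF *]) (use sub in \<open>auto intro!: continuous_intros\<close>)
  then have "(\<lambda>t. if complex_of_real t = 0 then deriv u 0
      else (u (complex_of_real t) - u 0) / (complex_of_real t - 0)) integrable_on {0..1}"
    by (rule integrable_continuous_real)
  then show ?thesis
    by (rule integrable_spike_finite[of "{0}", rotated 2])
       (auto simp: u_def scaleC_of_real psi0 divide_inverse)
qed

lemma fderiv_ray_integrable:
  assumes z: "z \<in> ball 0 1"
  shows "(\<lambda>t. fderiv \<psi> (t *\<^sub>R z) h) integrable_on {0..1}"
  by (intro integrable_continuous_real continuous_on_compose2[OF continuous_on_fderiv[OF hol open_ball]])
     (use scaleR_mem_unit_ball[OF z] in \<open>auto intro!: continuous_intros\<close>)

text \<open>
  The factor \<open>t\<close> coming from the chain rule cancels the singularity \<open>1 / t\<close>.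
\<close>

lemma ray_integral_has_derivative:
  assumes z: "z \<in> ball 0 1"
  shows "((\<lambda>z. integral {0..1} (\<lambda>t. \<psi> (t *\<^sub>R z) * complex_of_real (1 / t))) has_derivative
          (\<lambda>h. integral {0..1} (\<lambda>t. fderiv \<psi> (t *\<^sub>R z) h))) (at z)"
proof -
  let ?g = "\<lambda>z. integral {0..1} (\<lambda>t. \<psi> (t *\<^sub>R z) * complex_of_real (1 / t))"
  let ?D = "\<lambda>h. integral {0..1} (\<lambda>t. fderiv \<psi> (t *\<^sub>R z) h)"
  define K where "K = (\<lambda>t. t *\<^sub>R z) ` {0..1}"
  have "compact K" unfolding K_def
    by (intro compact_continuous_image continuous_intros) auto
  moreover have K1: "K \<subseteq> ball 0 1" using scaleR_mem_unit_ball[OF z] by (auto simp: K_def)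
  ultimately obtain e M where e: "e > 0" "M > 0" "\<And>x. x \<in> K \<Longrightarrow> ball x e \<subseteq> ball 0 1"
    and M: "\<And>x w. x \<in> K \<Longrightarrow> w \<in> ball x e \<Longrightarrow> cmod (\<psi> w) \<le> M"
    using holo_on_bounded_near_compact[OF hol open_ball] by metis
  have tK: "t *\<^sub>R z \<in> K" if "t \<in> {0..1}" for t using that by (auto simp: K_def)
  have hole: "holo_on \<psi> (ball (t *\<^sub>R z) e)" if "t \<in> {0..1}" for t
    using holo_on_subset[OF hol e(3)[OF tK[OF that]]] .
  have bl: "bounded_linear (fderiv \<psi> (t *\<^sub>R z))" if "t \<in> {0..1}" for t
    using bounded_linear_fderiv[OF hol] tK[OF that] K1 by blast
  have Dbl: "bounded_linear ?D"
  proof (rule bounded_linear_intro)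
    fix x y :: 'a and r :: real
    have "?D (x + y) = integral {0..1} (\<lambda>t. fderiv \<psi> (t *\<^sub>R z) x + fderiv \<psi> (t *\<^sub>R z) y)"
      using linear_add[OF bounded_linear.linear[OF bl]] by (intro integral_cong) auto
    then show "?D (x + y) = ?D x + ?D y"
      by (simp only: integral_add[OF fderiv_ray_integrable[OF z] fderiv_ray_integrable[OF z]])
    have "?D (r *\<^sub>R x) = integral {0..1} (\<lambda>t. r *\<^sub>R fderiv \<psi> (t *\<^sub>R z) x)"
      using linear_cmul[OF bounded_linear.linear[OF bl]] by (intro integral_cong) auto
    then show "?D (r *\<^sub>R x) = r *\<^sub>R ?D x" by simp
    have "norm (?D x) \<le> (2 * M / e * norm x) * measure lborel (cbox 0 (1::real))"
      unfolding cbox_interval[symmetric]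
      by (rule has_integral_bound[OF _ integrable_integral])
         (use e holo_on_ball_estimates(1)[OF hole e(1) M[OF tK]] fderiv_ray_integrable[OF z] in \<open>auto\<close>)
    then show "norm (?D x) \<le> norm x * (2 * M / e)" by (simp add: mult.commute)
  qed
  have rem: "norm (?g (z + h) - ?g z - ?D h) \<le> 32 * M / e\<^sup>2 * (norm h)\<^sup>2"
    if h: "norm h \<le> e / 2" for h
  proof -
    have "z + h \<in> ball z e" using h e(1) by (simp add: dist_norm)
    moreover have "z \<in> K" using tK[of 1] by simp
    ultimately have zh: "z + h \<in> ball 0 1" using e(3) by blast
    let ?r = "\<lambda>t. \<psi> (t *\<^sub>R (z + h)) * complex_of_real (1 / t) -
        \<psi> (t *\<^sub>R z) * complex_of_real (1 / t) - fderiv \<psi> (t *\<^sub>R z) h"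
    have int: "(?r has_integral (?g (z + h) - ?g z - ?D h)) (cbox 0 1)"
      unfolding cbox_interval
      by (intro has_integral_diff integrable_integral ray_quotient_integrable fderiv_ray_integrable z zh)
    have "norm (?g (z + h) - ?g z - ?D h) \<le> 32 * M / e\<^sup>2 * (norm h)\<^sup>2 * measure lborel (cbox 0 (1::real))"
    \<comment> \<open>The point t = 0 has to be excluded: there the quotients are 0 because 1/0 = 0,
      and what remains, -D\<psi>(0)h, is only linear in h.\<close>
    proof (rule has_integral_bound_spike_finite[OF _ _ int, of _ "{0}"])
      show "0 \<le> 32 * M / e\<^sup>2 * (norm h)\<^sup>2" using e by simp
      fix t :: real assume "t \<in> cbox 0 1 - {0}"
      then have t: "t \<in> {0..1}" "t > 0" by auto
      interpret D: bounded_linear "fderiv \<psi> (t *\<^sub>R z)" by (rule bl[OF t(1)])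
      have th: "norm (t *\<^sub>R h) \<le> e / 2"
        using h t mult_right_mono[of t 1 "norm h"] by simp
      have "cmod (\<psi> (t *\<^sub>R z + t *\<^sub>R h) - \<psi> (t *\<^sub>R z) - fderiv \<psi> (t *\<^sub>R z) (t *\<^sub>R h))
          \<le> 32 * M / e\<^sup>2 * (norm (t *\<^sub>R h))\<^sup>2"
        by (rule holo_on_ball_estimates(3)[OF hole[OF t(1)] e(1) M[OF tK[OF t(1)]] th])
      moreover have "?r t = complex_of_real (1 / t) *
          (\<psi> (t *\<^sub>R z + t *\<^sub>R h) - \<psi> (t *\<^sub>R z) - fderiv \<psi> (t *\<^sub>R z) (t *\<^sub>R h))"
        using t(2) by (simp add: D.scaleR scaleR_conv_of_real field_simps scaleR_add_right)
      moreover have "cmod (complex_of_real (1 / t)) = 1 / t" using t(2) by (simp add: norm_divide)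
      ultimately have "norm (?r t) \<le> 1 / t * (32 * M / e\<^sup>2 * (norm (t *\<^sub>R h))\<^sup>2)"
        using t(2) by (simp only: norm_mult) (intro mult_left_mono, auto)
      also have "\<dots> = t * (32 * M / e\<^sup>2 * (norm h)\<^sup>2)"
        using t(2) by (simp add: power2_eq_square)
      also have "\<dots> \<le> 1 * (32 * M / e\<^sup>2 * (norm h)\<^sup>2)"
        using t e by (intro mult_right_mono) auto
      finally show "norm (?r t) \<le> 32 * M / e\<^sup>2 * (norm h)\<^sup>2" by simp
    qed simp
    then show ?thesis by simp
  qed
  have "((\<lambda>h. norm (?g (z + h) - ?g z - ?D h) / norm h) \<longlongrightarrow> 0) (at 0)"
  proof (rule Lim_null_comparison)
    have "norm (norm (?g (z + h) - ?g z - ?D h) / norm h) \<le> 32 * M / e\<^sup>2 * norm h"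
      if h: "h \<noteq> 0" "norm h \<le> e / 2" for h
      using divide_right_mono[OF rem[OF h(2)], of "norm h"] h(1)
      by (simp add: power2_eq_square)
    moreover have "\<forall>\<^sub>F h in at (0::'a). h \<noteq> 0 \<and> norm h \<le> e / 2"
      unfolding eventually_at using e(1) by (intro exI[of _ "e/2"]) auto
    ultimately show "\<forall>\<^sub>F h in at 0. norm (norm (?g (z + h) - ?g z - ?D h) / norm h) \<le> 32 * M / e\<^sup>2 * norm h"
      by (auto elim: eventually_mono)
    have "((\<lambda>h::'a. 32 * M / e\<^sup>2 * norm h) \<longlongrightarrow> 32 * M / e\<^sup>2 * norm (0::'a)) (at 0)"
      by (intro tendsto_intros)
    then show "((\<lambda>h::'a. 32 * M / e\<^sup>2 * norm h) \<longlongrightarrow> 0) (at 0)" by simp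
  qed
  with Dbl show ?thesis by (simp add: has_derivative_at)
qed

text \<open>This yields R(T f) = f R\<phi>: the derivative of the ray integral in the direction z
  has the integrand d/dt \<psi>(tz).\<close>

lemma ray_integral_fderiv:
  assumes z: "z \<in> ball 0 1"
  shows "integral {0..1} (\<lambda>t. fderiv \<psi> (t *\<^sub>R z) z) = \<psi> z"
proof -
  have "((\<lambda>t. fderiv \<psi> (t *\<^sub>R z) z) has_integral (\<psi> (1 *\<^sub>R z) - \<psi> (0 *\<^sub>R z))) {0..1}"
    by (rule fundamental_theorem_of_calculus)
       (use holo_on_ray_deriv[OF hol] scaleR_mem_unit_ball[OF z] in auto)
  then show ?thesis by (simp add: integral_unique psi0)
qed

end

section \<open>The Cesaro operator and its radial derivative\<close>

lemma radial_deriv_0: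
  assumes "f \<in> holo_ball" shows "radial_deriv f 0 = 0"
  using linear_0[OF bounded_linear.linear[OF has_derivative_bounded_linear[OF holo_ball_has_derivative[OF assms]]]]
  by (simp add: radial_deriv_def)

lemma
  assumes f: "f \<in> holo_ball" and \<phi>: "\<phi> \<in> holo_ball"
  shows cesaro_op_holo: "cesaro_op \<phi> f \<in> holo_ball"
    and radial_deriv_cesaro_op:
      "\<And>z. z \<in> ball 0 1 \<Longrightarrow> radial_deriv (cesaro_op \<phi> f) z = f z * radial_deriv \<phi> z"
    and cesaro_op_0: "cesaro_op \<phi> f 0 = 0"
    and cesaro_op_integrable: "\<And>z. z \<in> ball 0 1 \<Longrightarrow>
      (\<lambda>t. f (t *\<^sub>R z) * radial_deriv \<phi> (t *\<^sub>R z) * complex_of_real (1 / t)) integrable_on {0..1}"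
proof -
  define \<psi> where "\<psi> = (\<lambda>z. f z * radial_deriv \<phi> z)"
  have h: "holo_on \<psi> (ball 0 1)"
    unfolding \<psi>_def using f \<phi> by (intro holo_on_mult holo_on_radial_deriv) (auto simp: holo_ball_iff)
  have 0: "\<psi> 0 = 0" by (simp add: \<psi>_def radial_deriv_0[OF \<phi>])
  let ?D = "\<lambda>z h. integral {0..1} (\<lambda>t. fderiv \<psi> (t *\<^sub>R z) h)"
  have der: "(cesaro_op \<phi> f has_derivative ?D z) (at z)" if z: "z \<in> ball 0 1" for z
    by (rule has_derivative_transform_within_open[OF ray_integral_has_derivative[OF h 0 z] open_ball z])
       (simp add: cesaro_op_def \<psi>_def)
  have "holo_on (cesaro_op \<phi> f) (ball 0 1)"
  proof (rule holo_onI[OF der])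
    fix z :: 'a and c x assume z: "z \<in> ball 0 1"
    have "?D z (scaleC c x) = integral {0..1} (\<lambda>t. c * fderiv \<psi> (t *\<^sub>R z) x)"
      by (intro integral_cong holo_on_fderiv_scaleC[OF h] scaleR_mem_unit_ball[OF z]) auto
    then show "?D z (scaleC c x) = c * ?D z x" by simp
  qed auto
  then show "cesaro_op \<phi> f \<in> holo_ball" by (simp add: holo_ball_iff cesaro_op_def)
  show "radial_deriv (cesaro_op \<phi> f) z = f z * radial_deriv \<phi> z" if z: "z \<in> ball 0 1" for z
    using ray_integral_fderiv[OF h 0 z] fderiv_eq[OF der[OF z]] by (simp add: radial_deriv_def \<psi>_def)
  show "cesaro_op \<phi> f 0 = 0" by (simp add: cesaro_op_def radial_deriv_0[OF \<phi>])
  show "(\<lambda>t. f (t *\<^sub>R z) * radial_deriv \<phi> (t *\<^sub>R z) * complex_of_real (1 / t)) integrable_on {0..1}"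
    if "z \<in> ball 0 1" for z
    using ray_quotient_integrable[OF h 0 that] by (simp add: \<psi>_def)
qed

lemma cesaro_op_add:
  assumes "f \<in> holo_ball" "g \<in> holo_ball" "\<phi> \<in> holo_ball"
  shows "cesaro_op \<phi> (\<lambda>z. f z + g z) = (\<lambda>z. cesaro_op \<phi> f z + cesaro_op \<phi> g z)"
  using integral_add[OF cesaro_op_integrable[OF assms(1,3)] cesaro_op_integrable[OF assms(2,3)]]
  by (simp add: cesaro_op_def fun_eq_iff distrib_right del: of_real_divide)

lemma cesaro_op_cmult: "cesaro_op \<phi> (\<lambda>z. c * f z) = (\<lambda>z. c * cesaro_op \<phi> f z)"
  by (simp add: cesaro_op_def fun_eq_iff mult.assoc del: of_real_divide)

lemma cesaro_op_diff:
  assumes "f \<in> holo_ball" "g \<in> holo_ball" "\<phi> \<in> holo_ball"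
  shows "cesaro_op \<phi> (\<lambda>z. f z - g z) = (\<lambda>z. cesaro_op \<phi> f z - cesaro_op \<phi> g z)"
  using integral_diff[OF cesaro_op_integrable[OF assms(1,3)] cesaro_op_integrable[OF assms(2,3)]]
  by (simp add: cesaro_op_def fun_eq_iff left_diff_distrib del: of_real_divide)

section \<open>Growth and completeness of Bloch-type spaces\<close>

definition weight_integral :: "(real \<Rightarrow> real) \<Rightarrow> real \<Rightarrow> real" where
  "weight_integral \<omega> r = integral {0..r} (\<lambda>t. 1 / \<omega> t)"

lemma normal_weight_pos: "normal_weight \<omega> \<Longrightarrow> 0 \<le> r \<Longrightarrow> r < 1 \<Longrightarrow> \<omega> r > 0"
  by (auto simp: normal_weight_def)

context
  fixes \<omega> :: "real \<Rightarrow> real"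
  assumes \<omega>: "normal_weight \<omega>"
begin

lemma inverse_weight_continuous: "continuous_on {0..<1} (\<lambda>t. 1 / \<omega> t)"
  using \<omega> unfolding normal_weight_def by (intro continuous_intros) force+

lemma inverse_weight_integrable: "0 \<le> a \<Longrightarrow> b < 1 \<Longrightarrow> (\<lambda>t. 1 / \<omega> t) integrable_on {a..b}"
  by (rule integrable_continuous_real[OF continuous_on_subset[OF inverse_weight_continuous]]) auto

lemma weight_integral_diff:
  assumes "0 \<le> a" "a \<le> b" "b < 1"
  shows "weight_integral \<omega> b - weight_integral \<omega> a = integral {a..b} (\<lambda>t. 1 / \<omega> t)"
  using Henstock_Kurzweil_Integration.integral_combine[OF assms(1,2) inverse_weight_integrable] assms
  by (simp add: weight_integral_def)

lemma weight_integral_mono: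
  assumes "0 \<le> a" "a \<le> b" "b < 1"
  shows "weight_integral \<omega> a \<le> weight_integral \<omega> b"
proof -
  have "0 \<le> integral {a..b} (\<lambda>t. 1 / \<omega> t)"
    using assms normal_weight_pos[OF \<omega>]
    by (intro integral_nonneg inverse_weight_integrable) (auto intro: less_imp_le)
  then show ?thesis using weight_integral_diff[OF assms] by simp
qed

lemma weight_integral_nonneg: "0 \<le> r \<Longrightarrow> r < 1 \<Longrightarrow> 0 \<le> weight_integral \<omega> r"
  using weight_integral_mono[of 0 r] by (simp add: weight_integral_def)

text \<open>Connects the hypothesis on 1/\<omega>, a Lebesgue integral with values in
  [0,\<infinity>], with the gauge integrals over [0,r] that occur in the estimates.\<close>

lemma nn_integral_weight:
  assumes "0 \<le> r" "r < 1"
  shows "(\<integral>\<^sup>+t\<in>{0..r}. ennreal (1 / \<omega> t) \<partial>lborel) = ennreal (weight_integral \<omega> r)"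
proof -
  have "((\<lambda>t. 1 / \<omega> t) has_integral weight_integral \<omega> r) {0..r}"
    unfolding weight_integral_def by (intro integrable_integral inverse_weight_integrable) (use assms in auto)
  then have I: "((\<lambda>t. if t \<in> {0..r} then 1 / \<omega> t else 0) has_integral weight_integral \<omega> r) UNIV"
    by (subst has_integral_restrict_UNIV)
  have "continuous_on {0..r} (\<lambda>t. 1 / \<omega> t)"
    using assms by (intro continuous_on_subset[OF inverse_weight_continuous]) auto
  then have "(\<lambda>t. if t \<in> {0..r} then 1 / \<omega> t else 0) \<in> borel_measurable borel"
    by (intro borel_measurable_continuous_on_if) auto
  then have "(\<integral>\<^sup>+t. ennreal (if t \<in> {0..r} then 1 / \<omega> t else 0) \<partial>lborel) = ennreal (weight_integral \<omega> r)"
    by (rule nn_integral_has_integral_lborel[OF _ _ I])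
       (use assms normal_weight_pos[OF \<omega>] in \<open>auto intro: less_imp_le\<close>)
  also have "(\<integral>\<^sup>+t. ennreal (if t \<in> {0..r} then 1 / \<omega> t else 0) \<partial>lborel)
      = (\<integral>\<^sup>+t\<in>{0..r}. ennreal (1 / \<omega> t) \<partial>lborel)"
    by (intro nn_integral_cong) (auto simp: indicator_def)
  finally show ?thesis .
qed

lemma weight_integral_bounded:
  assumes "(\<integral>\<^sup>+t\<in>{0..<1}. ennreal (1 / \<omega> t) \<partial>lborel) < \<infinity>"
  obtains B where "B \<ge> 0" "\<And>r. 0 \<le> r \<Longrightarrow> r < 1 \<Longrightarrow> weight_integral \<omega> r \<le> B"
proof -
  let ?J = "\<integral>\<^sup>+t\<in>{0..<1}. ennreal (1 / \<omega> t) \<partial>lborel"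
  have "weight_integral \<omega> r \<le> enn2real ?J" if r: "0 \<le> r" "r < 1" for r
  proof -
    have "ennreal (weight_integral \<omega> r) \<le> ?J"
      unfolding nn_integral_weight[OF r, symmetric]
      by (intro nn_integral_mono mult_left_mono) (use r in \<open>auto simp: indicator_def\<close>)
    then show ?thesis using assms weight_integral_nonneg[OF r]
      by (metis enn2real_ennreal enn2real_mono infinity_ennreal_def)
  qed
  then show ?thesis by (intro that[of "enn2real ?J"]) auto
qed

text \<open>If all integrals over [0,r] were at most B, monotone convergence along
  \<open>r n\<close> would make the full integral finite. Monotonicity then passes from one radius
  to all larger ones.\<close>

lemma weight_integral_unbounded:
  assumes inf: "(\<integral>\<^sup>+t\<in>{0..<1}. ennreal (1 / \<omega> t) \<partial>lborel) = \<infinity>"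
  obtains \<rho> where "0 \<le> \<rho>" "\<rho> < 1" "\<And>r. \<rho> \<le> r \<Longrightarrow> r < 1 \<Longrightarrow> weight_integral \<omega> r > B"
proof -
  have "\<exists>\<rho>\<ge>0. \<rho> < 1 \<and> weight_integral \<omega> \<rho> > B"
  proof (rule ccontr)
    assume "\<not> ?thesis"
    then have le: "weight_integral \<omega> r \<le> B" if "0 \<le> r" "r < 1" for r using that by force
    define r where "r = (\<lambda>n. 1 - 1 / real (Suc n))"
    have r: "0 \<le> r n" "r n < 1" for n by (auto simp: r_def)
    have mono: "r n \<le> r m" if "n \<le> m" for n m using that by (simp add: r_def frac_le)
    have c: "(\<lambda>t. if t \<in> {0..r n} then 1 / \<omega> t else 0) \<in> borel_measurable borel" for n
    proof (rule borel_measurable_continuous_on_if)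
      show "continuous_on {0..r n} (\<lambda>t. 1 / \<omega> t)"
        using r[of n] by (intro continuous_on_subset[OF inverse_weight_continuous]) auto
    qed auto
    have eq: "ennreal (1 / \<omega> t) * indicator {0..<1} t = (SUP n. ennreal (1 / \<omega> t) * indicator {0..r n} t)" for t
    proof (cases "0 \<le> t \<and> t < 1")
      case True
      then obtain n where n: "1 / real (Suc n) < 1 - t" using nat_approx_posE[of "1 - t"] by auto
      show ?thesis
      proof (rule antisym)
        show "ennreal (1 / \<omega> t) * indicator {0..<1} t \<le> (SUP n. ennreal (1 / \<omega> t) * indicator {0..r n} t)"
          by (rule SUP_upper2[of n]) (use True n in \<open>auto simp: r_def indicator_def\<close>)
        show "(SUP n. ennreal (1 / \<omega> t) * indicator {0..r n} t) \<le> ennreal (1 / \<omega> t) * indicator {0..<1} t"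
          by (rule SUP_least) (use True in \<open>auto simp: indicator_def\<close>)
      qed
    next
      case False
      then have "indicator {0..r n} t = (0::ennreal)" for n using r[of n] by (auto simp: indicator_def)
      with False show ?thesis by (auto simp: indicator_def)
    qed
    have "(\<integral>\<^sup>+t\<in>{0..<1}. ennreal (1 / \<omega> t) \<partial>lborel)
        = (\<integral>\<^sup>+t. (SUP n. ennreal (1 / \<omega> t) * indicator {0..r n} t) \<partial>lborel)"
      by (simp only: eq)
    also have "\<dots> = (SUP n. \<integral>\<^sup>+t\<in>{0..r n}. ennreal (1 / \<omega> t) \<partial>lborel)"
    proof (rule nn_integral_monotone_convergence_SUP)
      show "incseq (\<lambda>n t. ennreal (1 / \<omega> t) * indicator {0..r n} t)"
        unfolding incseq_def le_fun_def
        using mono order_trans by (auto intro!: mult_left_mono simp: indicator_def) blast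
      have "(\<lambda>t. ennreal (1 / \<omega> t) * indicator {0..r n} t) = (\<lambda>t. ennreal (if t \<in> {0..r n} then 1 / \<omega> t else 0))" for n
        by (auto simp: indicator_def)
      then show "(\<lambda>t. ennreal (1 / \<omega> t) * indicator {0..r n} t) \<in> borel_measurable lborel" for n
        using c[of n] by simp
    qed
    also have "\<dots> \<le> ennreal B"
      by (rule SUP_least) (simp only: nn_integral_weight[OF r], intro ennreal_leI le r)
    finally show False using inf by (simp add: top_unique)
  qed
  then obtain \<rho> where "0 \<le> \<rho>" "\<rho> < 1" "weight_integral \<omega> \<rho> > B" by blast
  then show ?thesis
    using that[of \<rho>] weight_integral_mono[of \<rho>] by force
qed

text \<open>On a ray R f(te) = t Df(te)e, so the norm controls the derivative of t \<mapsto> f(te)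
  only up to the factor 1/t; the lower limit 1/4 bounds this factor by 4.\<close>

lemma bloch_increment:
  assumes f: "f \<in> bloch \<omega>" and e: "norm (e::'a::complex_banach) = 1"
    and \<rho>: "1/4 \<le> \<rho>" "\<rho> \<le> r" "r < 1"
  shows "cmod (f (r *\<^sub>R e) - f (\<rho> *\<^sub>R e))
           \<le> 4 * bloch_norm \<omega> f * (weight_integral \<omega> r - weight_integral \<omega> \<rho>)"
proof -
  have h: "holo_on f (ball 0 1)" using f by (auto simp: bloch_def holo_ball_iff)
  have tb: "t *\<^sub>R e \<in> ball 0 1" if "0 \<le> t" "t < 1" for t using that e by simp
  have der: "((\<lambda>t. f (t *\<^sub>R e)) has_vector_derivative fderiv f (t *\<^sub>R e) e) (at t within {\<rho>..r})"
    if "t \<in> {\<rho>..r}" for t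
    by (rule holo_on_ray_deriv[OF h]) (use tb that \<rho> in auto)
  have b: "norm (fderiv f (t *\<^sub>R e) e) \<le> 4 * bloch_norm \<omega> f * (1 / \<omega> t)" if t: "t \<in> {\<rho>..r}" for t
  proof -
    have t': "0 \<le> t" "t < 1" "t > 0" "t \<ge> 1/4" using t \<rho> by auto
    interpret D: bounded_linear "fderiv f (t *\<^sub>R e)" by (rule bounded_linear_fderiv[OF h tb[OF t'(1,2)]])
    have wp: "\<omega> t > 0" using normal_weight_pos[OF \<omega>] t' by simp
    have "cmod (f 0) + \<omega> (norm (t *\<^sub>R e)) * cmod (radial_deriv f (t *\<^sub>R e)) \<le> bloch_norm \<omega> f"
      by (rule bloch_norm_bounds(1)[OF _ f tb[OF t'(1,2)]]) (use normal_weight_pos[OF \<omega>] in auto)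
    then have "\<omega> t * cmod (radial_deriv f (t *\<^sub>R e)) \<le> bloch_norm \<omega> f"
      using t' e norm_ge_zero[of "f 0"] by (simp del: norm_ge_zero)
    moreover have "cmod (radial_deriv f (t *\<^sub>R e)) = t * cmod (fderiv f (t *\<^sub>R e) e)"
      using t' by (simp add: radial_deriv_def D.scaleR)
    moreover have "1/4 * cmod (fderiv f (t *\<^sub>R e) e) \<le> t * cmod (fderiv f (t *\<^sub>R e) e)"
      by (rule mult_right_mono) (use t' in auto)
    ultimately have "\<omega> t * (1/4 * cmod (fderiv f (t *\<^sub>R e) e)) \<le> bloch_norm \<omega> f"
      using wp mult_left_mono[of _ _ "\<omega> t"] by (smt (verit))
    then show ?thesis using wp by (simp add: field_simps)
  qed
  have int: "((\<lambda>t. fderiv f (t *\<^sub>R e) e) has_integral (f (r *\<^sub>R e) - f (\<rho> *\<^sub>R e))) {\<rho>..r}"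
    by (rule fundamental_theorem_of_calculus[OF \<rho>(2) der])
  moreover have "(\<lambda>t. 4 * bloch_norm \<omega> f * (1 / \<omega> t)) integrable_on {\<rho>..r}"
    by (rule integrable_on_mult_right, rule inverse_weight_integrable) (use \<rho> in auto)
  ultimately have "norm (integral {\<rho>..r} (\<lambda>t. fderiv f (t *\<^sub>R e) e))
      \<le> integral {\<rho>..r} (\<lambda>t. 4 * bloch_norm \<omega> f * (1 / \<omega> t))"
    by (intro integral_norm_bound_integral b) auto
  moreover have "integral {\<rho>..r} (\<lambda>t. 4 * bloch_norm \<omega> f * (1 / \<omega> t))
      = 4 * bloch_norm \<omega> f * (weight_integral \<omega> r - weight_integral \<omega> \<rho>)"
    using \<rho> by (simp only: integral_mult_right weight_integral_diff)
  ultimately show ?thesis using integral_unique[OF int] by simp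
qed

lemma bloch_growth:
  obtains A where "A > 0"
    "\<And>(f :: 'a::complex_banach \<Rightarrow> complex) z. f \<in> bloch \<omega> \<Longrightarrow> z \<in> ball 0 1 \<Longrightarrow>
       cmod (f z) \<le> A * bloch_norm \<omega> f * (1 + weight_integral \<omega> (norm z))"
proof -
  have "continuous_on {0..1/2} \<omega>"
    using \<omega> unfolding normal_weight_def by (auto intro: continuous_on_subset)
  then obtain x where x: "x \<in> {0..1/2}" "\<And>y. y \<in> {0..1/2} \<Longrightarrow> \<omega> x \<le> \<omega> y"
    using continuous_attains_inf[of "{0..1/2}" \<omega>] by auto
  define m where "m = \<omega> x"
  have m: "m > 0" using x(1) normal_weight_pos[OF \<omega>] by (auto simp: m_def)
  \<comment> \<open>Dominates both 1 + 2/m, the bound for f on the ball of radius 1/4 in units of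
    its norm, and 4, the factor in \<open>bloch_increment\<close>.\<close>
  define A where "A = 5 + 2 / m"
  have A: "A > 0" using m by (simp add: A_def add_pos_pos)
  have "cmod (f z) \<le> A * bloch_norm \<omega> f * (1 + weight_integral \<omega> (norm z))"
    if f: "f \<in> bloch \<omega>" and z: "z \<in> ball 0 1" for f :: "'a \<Rightarrow> complex" and z
  proof -
    have h: "holo_on f (ball 0 1)" and f': "f \<in> holo_ball" using f by (auto simp: bloch_def holo_ball_iff)
    define N where "N = bloch_norm \<omega> f"
    have bn: "cmod (f 0) + \<omega> (norm w) * cmod (radial_deriv f w) \<le> N" if "w \<in> ball 0 1" for w
      unfolding N_def by (rule bloch_norm_bounds(1)[OF _ f that]) (use normal_weight_pos[OF \<omega>] in auto)
    have N: "N \<ge> 0" unfolding N_def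
      by (rule bloch_norm_bounds(2)[OF _ f z]) (use normal_weight_pos[OF \<omega>] in auto)
    have f0: "cmod (f 0) \<le> N" using bn[of 0] normal_weight_pos[OF \<omega>, of 0]
      by (simp add: radial_deriv_0[OF f'])
    have rb: "cmod (radial_deriv f w) \<le> N / m" if w: "w \<in> ball 0 (1/2)" for w
    proof -
      have "m \<le> \<omega> (norm w)" unfolding m_def using w by (intro x(2)) auto
      then have "m * cmod (radial_deriv f w) \<le> \<omega> (norm w) * cmod (radial_deriv f w)"
        by (intro mult_right_mono) auto
      also have "\<dots> \<le> N" using bn[of w] w norm_ge_zero[of "f 0"] by (simp del: norm_ge_zero)
      finally show ?thesis using m by (simp add: field_simps)
    qed
    \<comment> \<open>The radial derivative vanishes at the origin, so by the Cauchy estimate its quotient by the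
      radius stays bounded there.\<close>
    have near: "cmod (f w) \<le> A * N" if w: "norm w \<le> 1/4" for w
    proof -
      have w1: "w \<in> ball 0 1" using w by simp
      have rl: "cmod (radial_deriv f v) \<le> 8 * (N / m) * norm v" if v: "norm v \<le> 1/4" for v
        using holo_on_ball_estimates(2)[of "radial_deriv f" 0 "1/2" "N/m" v]
          holo_on_subset[OF holo_on_radial_deriv[OF h], of "ball 0 (1/2)"] rb v radial_deriv_0[OF f']
        by (auto simp: subset_ball)
      have int: "((\<lambda>t. fderiv f (t *\<^sub>R w) w) has_integral (f (1 *\<^sub>R w) - f (0 *\<^sub>R w))) (cbox 0 1)"
        unfolding cbox_interval
        by (rule fundamental_theorem_of_calculus)
           (use holo_on_ray_deriv[OF h] scaleR_mem_unit_ball[OF w1] in auto)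
      have "norm (f (1 *\<^sub>R w) - f (0 *\<^sub>R w)) \<le> 2 * (N / m) * measure lborel (cbox 0 (1::real))"
      proof (rule has_integral_bound_spike_finite[OF _ _ int, of _ "{0}"])
        show "0 \<le> 2 * (N / m)" using N m by simp
        fix t :: real assume "t \<in> cbox 0 1 - {0}"
        then have t: "0 < t" "t \<le> 1" by auto
        have tw: "norm (t *\<^sub>R w) \<le> 1/4" using t w mult_mono[of t 1 "norm w" "1/4"] by simp
        interpret D: bounded_linear "fderiv f (t *\<^sub>R w)"
          by (rule bounded_linear_fderiv[OF h]) (use tw in simp)
        have "t * cmod (fderiv f (t *\<^sub>R w) w) = cmod (radial_deriv f (t *\<^sub>R w))"
          using t by (simp add: radial_deriv_def D.scaleR)
        also have "\<dots> \<le> 8 * (N / m) * (t * norm w)" using rl[OF tw] t by simp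
        finally have "t * cmod (fderiv f (t *\<^sub>R w) w) \<le> t * (8 * (N / m) * norm w)" by (simp add: mult_ac)
        then have "cmod (fderiv f (t *\<^sub>R w) w) \<le> 8 * (N / m) * norm w"
          using t(1) by (rule mult_left_le_imp_le)
        also have "\<dots> \<le> 8 * (N / m) * (1/4)" using w N m by (intro mult_left_mono) auto
        finally show "norm (fderiv f (t *\<^sub>R w) w) \<le> 2 * (N / m)" by simp
      qed simp
      then have "cmod (f w - f 0) \<le> 2 * (N / m)" by simp
      then have "cmod (f w) \<le> N + 2 * (N / m)"
        using f0 norm_triangle_sub[of "f w" "f 0"] by linarith
      also have "\<dots> \<le> A * N" using N m by (simp add: A_def algebra_simps)
      finally show ?thesis .
    qed
    show ?thesis
    proof (cases "norm z \<le> 1/4")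
      case True
      have "A * N * 1 \<le> A * N * (1 + weight_integral \<omega> (norm z))"
        using A N weight_integral_nonneg[of "norm z"] z by (intro mult_left_mono) auto
      then show ?thesis using near[OF True] by (simp add: N_def)
    next
      case False
      define e where "e = (1 / norm z) *\<^sub>R z"
      have ze: "norm e = 1" "norm z *\<^sub>R e = z" using False by (auto simp: e_def)
      have z4: "1/4 \<le> norm z" "norm z < 1" using False z by auto
      have "cmod (f z - f ((1/4) *\<^sub>R e)) \<le> 4 * N * (weight_integral \<omega> (norm z) - weight_integral \<omega> (1/4))"
        using bloch_increment[OF f ze(1) order_refl z4] by (simp add: ze(2) N_def)
      also have "\<dots> \<le> 4 * N * weight_integral \<omega> (norm z)"
        using N weight_integral_nonneg[of "1/4"] by (intro mult_left_mono) auto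
      also have "\<dots> \<le> A * N * weight_integral \<omega> (norm z)"
        using N m weight_integral_nonneg[of "norm z"] z by (intro mult_right_mono) (auto simp: A_def)
      finally have "cmod (f z) \<le> A * N + A * N * weight_integral \<omega> (norm z)"
        using near[of "(1/4) *\<^sub>R e"] ze(1) norm_triangle_sub[of "f z" "f ((1/4) *\<^sub>R e)"] by simp
      then show ?thesis by (simp add: N_def algebra_simps)
    qed
  qed
  with A show ?thesis by (rule that)
qed

end

section \<open>Completeness of Bloch-type spaces\<close>

lemma bloch_normI:
  assumes g: "g \<in> holo_ball"
    and c: "\<And>z. z \<in> ball 0 1 \<Longrightarrow> cmod (g 0) + \<omega> (norm z) * cmod (radial_deriv g z) \<le> c"
  shows "g \<in> bloch \<omega>" and "bloch_norm \<omega> g \<le> c"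
proof -
  have le: "\<omega> (norm z) * cmod (radial_deriv g z) \<le> c - cmod (g 0)" if "z \<in> ball 0 1" for z
    using c[OF that] by linarith
  then show "g \<in> bloch \<omega>"
    using g unfolding bloch_def by (auto intro!: bdd_aboveI2)
  have "(SUP z\<in>ball 0 1. \<omega> (norm z) * cmod (radial_deriv g z)) \<le> c - cmod (g 0)"
    by (rule cSUP_least) (use le in auto)
  then show "bloch_norm \<omega> g \<le> c" by (simp add: bloch_norm_def)
qed

text \<open>Spelled exactly like the distance inside \<open>norm_topology\<close>, so that results
  about this metric space speak of that topology.\<close>

abbreviation bloch_dist ::
    "(real \<Rightarrow> real) \<Rightarrow> ('a::complex_banach \<Rightarrow> complex) \<Rightarrow> ('a \<Rightarrow> complex) \<Rightarrow> real" where
  "bloch_dist \<omega> \<equiv>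
     \<lambda>f g. if f \<in> bloch \<omega> \<and> g \<in> bloch \<omega> then bloch_norm \<omega> (\<lambda>z. f z - g z) else 0"

text \<open>The growth estimate turns a Cauchy sequence into a locally uniformly Cauchy one, so it
  has a holomorphic limit, whose radial derivative is the limit of the radial derivatives. Letting m
  tend to infinity in the Cauchy condition for \<sigma> n - \<sigma> m gives convergence in
  norm.\<close>

lemma mcomplete_bloch:
  assumes \<omega>: "normal_weight \<omega>"
  shows "Metric_space.mcomplete (bloch \<omega> :: ('a::complex_banach \<Rightarrow> complex) set) (bloch_dist \<omega>)"
proof -
  interpret M: Metric_space "bloch \<omega> :: ('a \<Rightarrow> complex) set" "bloch_dist \<omega>"
    by (rule Metric_space_bloch[OF \<omega>])
  have wp: "\<And>r. r \<in> {0..<1} \<Longrightarrow> \<omega> r > 0" using normal_weight_pos[OF \<omega>] by simp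
  obtain A where A: "A > 0" "\<And>(f :: 'a \<Rightarrow> complex) z. f \<in> bloch \<omega> \<Longrightarrow> z \<in> ball 0 1 \<Longrightarrow>
       cmod (f z) \<le> A * bloch_norm \<omega> f * (1 + weight_integral \<omega> (norm z))"
    using bloch_growth[OF \<omega>] by metis
  show ?thesis
    unfolding M.mcomplete_def
  proof (intro allI impI)
    fix \<sigma> :: "nat \<Rightarrow> 'a \<Rightarrow> complex" assume "M.MCauchy \<sigma>"
    then have \<sigma>: "\<sigma> n \<in> bloch \<omega>" and
      cauchy: "e > 0 \<Longrightarrow> \<exists>N. \<forall>n m. N \<le> n \<longrightarrow> N \<le> m \<longrightarrow> bloch_norm \<omega> (\<lambda>z. \<sigma> n z - \<sigma> m z) < e" for n e
      unfolding M.MCauchy_def by (auto simp: image_subset_iff)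
    have hol: "holo_on (\<sigma> n) (ball 0 1)" and hb: "\<sigma> n \<in> holo_ball" for n
      using \<sigma>[of n] by (auto simp: bloch_def holo_ball_iff)
    \<comment> \<open>Off the ball every \<open>\<sigma> n\<close> vanishes, so the limit is 0
      there, as membership in \<open>holo_ball\<close> demands.\<close>
    define f where "f = (\<lambda>z. lim (\<lambda>n. \<sigma> n z))"
    have key: "\<exists>R>0. ball z R \<subseteq> ball 0 1 \<and> uniform_limit (ball z R) \<sigma> f sequentially"
      if z: "z \<in> ball 0 1" for z
    proof -
      define R where "R = (1 - norm z) / 2"
      have R: "R > 0" using z by (simp add: R_def)
      define r where "r = (1 + norm z) / 2"
      have r: "0 \<le> r" "r < 1" using z by (auto simp: r_def)
      have nw: "norm w \<le> r" if "w \<in> ball z R" for w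
        using norm_triangle_sub[of w z] that by (simp add: R_def r_def dist_norm norm_minus_commute field_simps)
      have sub: "ball z R \<subseteq> ball 0 1"
      proof
        fix w assume "w \<in> ball z R"
        from nw[OF this] r(2) show "w \<in> ball 0 1" by simp
      qed
      define c where "c = A * (1 + weight_integral \<omega> r)"
      have c: "c > 0" using A(1) weight_integral_nonneg[OF \<omega> r] by (simp add: c_def)
      have bd: "cmod (\<sigma> n w - \<sigma> m w) \<le> c * bloch_norm \<omega> (\<lambda>z. \<sigma> n z - \<sigma> m z)"
        if w: "w \<in> ball z R" for n m w
      proof -
        have w1: "w \<in> ball 0 1" using w sub by blast
        note bl = bloch_diff(1)[OF wp \<sigma>[of n] \<sigma>[of m]]
        have "cmod (\<sigma> n w - \<sigma> m w) \<le> A * bloch_norm \<omega> (\<lambda>z. \<sigma> n z - \<sigma> m z) * (1 + weight_integral \<omega> (norm w))"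
          by (rule A(2)[OF bl w1])
        also have "\<dots> \<le> A * bloch_norm \<omega> (\<lambda>z. \<sigma> n z - \<sigma> m z) * (1 + weight_integral \<omega> r)"
          using weight_integral_mono[OF \<omega> norm_ge_zero nw[OF w] r(2)] A(1) bloch_norm_bounds(2)[OF wp bl w1]
          by (intro mult_left_mono) auto
        finally show ?thesis by (simp add: c_def mult_ac)
      qed
      have "uniformly_Cauchy_on (ball z R) \<sigma>"
      proof (rule uniformly_Cauchy_onI)
        fix e :: real assume "e > 0"
        then have "e / c > 0" using c by simp
        from cauchy[OF this] obtain N where
          "\<And>n m. N \<le> n \<Longrightarrow> N \<le> m \<Longrightarrow> bloch_norm \<omega> (\<lambda>z. \<sigma> n z - \<sigma> m z) < e / c" by blast
        then have "c * bloch_norm \<omega> (\<lambda>z. \<sigma> n z - \<sigma> m z) < e" if "N \<le> n" "N \<le> m" for n m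
          using that c by (simp add: less_divide_eq mult.commute)
        then show "\<exists>M. \<forall>x\<in>ball z R. \<forall>m\<ge>M. \<forall>n\<ge>M. dist (\<sigma> m x) (\<sigma> n x) < e"
          using bd unfolding dist_norm by (meson le_less_trans)
      qed
      then have "uniform_limit (ball z R) \<sigma> f sequentially"
        unfolding f_def uniformly_convergent_uniform_limit_iff[symmetric]
        by (rule Cauchy_uniformly_convergent)
      with R sub show ?thesis by blast
    qed
    have conv: "(\<lambda>n. \<sigma> n z) \<longlonglongrightarrow> f z" if z: "z \<in> ball 0 1" for z
      using key[OF z] tendsto_uniform_limitI centre_in_ball by metis
    have "holo_on f (ball 0 1)"
    proof -
      have "\<exists>r>0. holo_on f (ball z r)" if "z \<in> ball 0 1" for z
      proof -
        from key[OF that] obtain R where R: "R > 0" "ball z R \<subseteq> ball 0 1" "uniform_limit (ball z R) \<sigma> f sequentially"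
          by blast
        from holo_on_uniform_limit(1)[OF holo_on_subset[OF hol R(2)] R(1,3)] R(1) show ?thesis
          by (intro exI[of _ "R/2"]) auto
      qed
      then show ?thesis unfolding holo_on_def by (meson centre_in_ball)
    qed
    moreover have "f z = 0" if "z \<notin> ball 0 1" for z
    proof -
      have "\<sigma> n z = 0" for n using hb[of n] that by (auto simp: holo_ball_iff)
      then show ?thesis by (simp add: f_def)
    qed
    ultimately have fh: "f \<in> holo_ball" by (simp add: holo_ball_iff)
    have rconv: "(\<lambda>n. radial_deriv (\<sigma> n) z) \<longlonglongrightarrow> radial_deriv f z" if z: "z \<in> ball 0 1" for z
    proof -
      from key[OF z] obtain R where R: "R > 0" "ball z R \<subseteq> ball 0 1" "uniform_limit (ball z R) \<sigma> f sequentially"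
        by blast
      show ?thesis unfolding radial_deriv_def
        by (rule holo_on_uniform_limit(2)[OF holo_on_subset[OF hol R(2)] R(1,3)])
    qed
    have main: "\<exists>N. \<forall>n\<ge>N. (\<lambda>z. \<sigma> n z - f z) \<in> bloch \<omega> \<and> bloch_norm \<omega> (\<lambda>z. \<sigma> n z - f z) < e"
      if e: "e > 0" for e
    proof -
      obtain N where N: "\<And>n m. N \<le> n \<Longrightarrow> N \<le> m \<Longrightarrow> bloch_norm \<omega> (\<lambda>z. \<sigma> n z - \<sigma> m z) < e / 2"
        using cauchy[of "e/2"] e by auto
      have "(\<lambda>z. \<sigma> n z - f z) \<in> bloch \<omega> \<and> bloch_norm \<omega> (\<lambda>z. \<sigma> n z - f z) \<le> e / 2" if n: "N \<le> n" for n
      proof -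
        have "cmod (\<sigma> n 0 - f 0) + \<omega> (norm z) * cmod (radial_deriv (\<lambda>z. \<sigma> n z - f z) z) \<le> e / 2"
          if z: "z \<in> ball 0 1" for z
        proof (rule tendsto_upperbound)
          show "(\<lambda>m. cmod (\<sigma> n 0 - \<sigma> m 0) + \<omega> (norm z) * cmod (radial_deriv (\<sigma> n) z - radial_deriv (\<sigma> m) z))
            \<longlonglongrightarrow> cmod (\<sigma> n 0 - f 0) + \<omega> (norm z) * cmod (radial_deriv (\<lambda>z. \<sigma> n z - f z) z)"
            unfolding radial_deriv_diff[OF hb fh z]
            by (intro tendsto_intros conv rconv z) simp
          have "cmod (\<sigma> n 0 - \<sigma> m 0) + \<omega> (norm z) * cmod (radial_deriv (\<sigma> n) z - radial_deriv (\<sigma> m) z) \<le> e / 2"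
            if "N \<le> m" for m
            using bloch_norm_bounds(1)[OF wp bloch_diff(1)[OF wp \<sigma>[of n] \<sigma>[of m]] z] N[OF n that]
            by (simp add: radial_deriv_diff[OF hb hb z])
          then show "\<forall>\<^sub>F m in sequentially.
              cmod (\<sigma> n 0 - \<sigma> m 0) + \<omega> (norm z) * cmod (radial_deriv (\<sigma> n) z - radial_deriv (\<sigma> m) z) \<le> e / 2"
            by (auto simp: eventually_sequentially)
        qed simp
        then show ?thesis
          using bloch_normI[OF holo_ball_diff[OF hb fh], of n \<omega> "e/2"] by blast
      qed
      then show ?thesis using e by (intro exI[of _ N]) force
    qed
    \<comment> \<open>Membership of f is read off from f = \<sigma> n - (\<sigma> n - f).\<close>
    obtain n where "(\<lambda>z. \<sigma> n z - f z) \<in> bloch \<omega>" using main[of 1] by auto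
    from bloch_diff(1)[OF wp \<sigma>[of n] this] have fb: "f \<in> bloch \<omega>" by simp
    have "limitin M.mtopology \<sigma> f sequentially"
      unfolding M.limit_metric_sequentially
    proof (intro conjI allI impI)
      fix e :: real assume "e > 0"
      from main[OF this] show "\<exists>N. \<forall>n\<ge>N. \<sigma> n \<in> bloch \<omega> \<and> bloch_dist \<omega> (\<sigma> n) f < e"
        using fb \<sigma> by auto
    qed (rule fb)
    then show "\<exists>x. limitin M.mtopology \<sigma> x sequentially" by blast
  qed
qed

section \<open>Sufficiency\<close>

text \<open>Total boundedness of a bounded set of complex vectors indexed by P, but with the net
  inside S. Centres of discs are therefore no candidates; the induction splits S by the value at the
  new point p into cells, in which two values at p differ by less than s, and takes a net of each
  cell.\<close>

lemma finite_pointwise_net: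
  fixes S :: "('a \<Rightarrow> complex) set"
  assumes "finite P" and "s > 0" and "\<And>f w. f \<in> S \<Longrightarrow> w \<in> P \<Longrightarrow> cmod (f w) \<le> M"
  shows "\<exists>F. finite F \<and> F \<subseteq> S \<and> (\<forall>f\<in>S. \<exists>g\<in>F. \<forall>w\<in>P. cmod (f w - g w) < s)"
  using assms(1,3)
proof (induction P arbitrary: S)
  case empty
  show ?case
  proof (cases "S = {}")
    case False
    then obtain g where "g \<in> S" by blast
    then show ?thesis by (intro exI[of _ "{g}"]) auto
  qed auto
next
  case (insert p P)
  obtain Z where Z: "finite Z" "cball 0 M \<subseteq> (\<Union>x\<in>Z. ball (x::complex) (s/2))"
    using compact_cball[of "0::complex" M] assms(2) unfolding compact_eq_totally_bounded
    by (meson half_gt_zero)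
  define S' where "S' = (\<lambda>x. {f\<in>S. f p \<in> ball x (s/2)})"
  have "\<exists>F. finite F \<and> F \<subseteq> S' x \<and> (\<forall>f\<in>S' x. \<exists>g\<in>F. \<forall>w\<in>P. cmod (f w - g w) < s)" for x
    by (rule insert.IH) (use insert.prems in \<open>auto simp: S'_def\<close>)
  then obtain F where F: "\<And>x. finite (F x)" "\<And>x. F x \<subseteq> S' x"
    "\<And>x f. f \<in> S' x \<Longrightarrow> \<exists>g\<in>F x. \<forall>w\<in>P. cmod (f w - g w) < s"
    by metis
  show ?case
  proof (intro exI[of _ "\<Union>x\<in>Z. F x"] conjI ballI)
    show "finite (\<Union>x\<in>Z. F x)" using Z F by blast
    show "(\<Union>x\<in>Z. F x) \<subseteq> S" using F(2) by (auto simp: S'_def)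
    fix f assume f: "f \<in> S"
    then have "f p \<in> cball 0 M" using insert.prems by auto
    then obtain x where x: "x \<in> Z" "f p \<in> ball x (s/2)" using Z(2) by blast
    then have "f \<in> S' x" using f by (simp add: S'_def)
    from F(3)[OF this] obtain g where g: "g \<in> F x" "\<And>w. w \<in> P \<Longrightarrow> cmod (f w - g w) < s" by blast
    have "g p \<in> ball x (s/2)" using g(1) F(2) by (auto simp: S'_def)
    with x(2) have "cmod (f p - g p) < s"
      using dist_triangle_half_r[of x "f p" s "g p"] by (auto simp: dist_norm)
    with g x show "\<exists>g\<in>\<Union>x\<in>Z. F x. \<forall>w\<in>insert p P. cmod (f w - g w) < s" by auto
  qed
qed

lemma relatively_compact_in_obtain:
  assumes "relatively_compact_in (top_of_set U) E" "E \<subseteq> U"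
  obtains K where "compact K" "K \<subseteq> U" "E \<subseteq> K"
proof -
  have "compactin (top_of_set U) (top_of_set U closure_of E)"
    using assms(1) by (simp add: relatively_compact_in_def)
  then have "compact (top_of_set U closure_of E)" "top_of_set U closure_of E \<subseteq> U"
    by (auto simp: compactin_subtopology)
  moreover have "E \<subseteq> top_of_set U closure_of E"
    by (rule closure_of_subset) (use assms(2) in simp)
  ultimately show ?thesis by (rule that)
qed

lemma E_set_subset: "E_set \<mu> \<phi> \<epsilon> \<rho> \<subseteq> ball 0 1"
  by (auto simp: E_set_def)

lemma cesaro_bloch:
  assumes \<omega>: "normal_weight \<omega>" and \<phi>: "\<phi> \<in> holo_ball"
    and N: "\<And>z. z \<in> ball 0 1 \<Longrightarrow>
      \<mu> (norm z) * cmod (radial_deriv \<phi> z) * (1 + weight_integral \<omega> (norm z)) \<le> N"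
    and f: "f \<in> bloch \<omega>"
  shows "cesaro_op \<phi> f \<in> bloch \<mu>"
proof -
  obtain A where A: "A > 0" "\<And>(f :: 'a \<Rightarrow> complex) z. f \<in> bloch \<omega> \<Longrightarrow> z \<in> ball 0 1 \<Longrightarrow>
       cmod (f z) \<le> A * bloch_norm \<omega> f * (1 + weight_integral \<omega> (norm z))"
    using bloch_growth[OF \<omega>] by metis
  have fh: "f \<in> holo_ball" using f by (simp add: bloch_def)
  have nn: "0 \<le> bloch_norm \<omega> f"
    by (rule bloch_norm_bounds(2)[OF _ f, of 0]) (use normal_weight_pos[OF \<omega>] in auto)
  show ?thesis
  proof (rule bloch_normI(1)[OF cesaro_op_holo[OF fh \<phi>]])
    fix z :: 'a assume z: "z \<in> ball 0 1"
    let ?a = "\<mu> (norm z) * cmod (radial_deriv \<phi> z)"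
    show "cmod (cesaro_op \<phi> f 0) + \<mu> (norm z) * cmod (radial_deriv (cesaro_op \<phi> f) z)
       \<le> \<bar>N\<bar> * (A * bloch_norm \<omega> f)"
    \<comment> \<open>The sign of \<mu> is left open in this lemma, hence the case distinction and
      the absolute value of N.\<close>
    proof (cases "?a \<ge> 0")
      case True
      have "?a * cmod (f z) \<le> ?a * (A * bloch_norm \<omega> f * (1 + weight_integral \<omega> (norm z)))"
        by (intro mult_left_mono A(2) f z True)
      also have "\<dots> = ?a * (1 + weight_integral \<omega> (norm z)) * (A * bloch_norm \<omega> f)"
        by (simp add: mult_ac)
      also have "\<dots> \<le> \<bar>N\<bar> * (A * bloch_norm \<omega> f)"
        using N[OF z] A(1) nn by (intro mult_right_mono) auto
      finally show ?thesis
        by (simp add: cesaro_op_0[OF fh \<phi>] radial_deriv_cesaro_op[OF fh \<phi> z] norm_mult mult_ac)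
    next
      case False
      then have "?a \<le> 0" by linarith
      then have "?a * cmod (f z) \<le> 0" by (rule mult_nonpos_nonneg) simp
      also have "0 \<le> \<bar>N\<bar> * (A * bloch_norm \<omega> f)" using A(1) nn by simp
      finally show ?thesis
        by (simp add: cesaro_op_0[OF fh \<phi>] radial_deriv_cesaro_op[OF fh \<phi> z] norm_mult mult_ac)
    qed
  qed
qed

text \<open>
  The last assumption says that the size of \<open>T h\<close> is controlled by the size of \<open>h\<close> on one of the
  relatively compact sets, where a bounded subset of the Bloch-type space is equicontinuous.
\<close>

lemma compact_cesaroI:
  fixes \<phi> :: "'a::complex_banach \<Rightarrow> complex"
  assumes \<omega>: "normal_weight \<omega>" and \<mu>: "normal_weight \<mu>" and \<phi>: "\<phi> \<in> holo_ball"
    and N: "\<And>z. z \<in> ball 0 1 \<Longrightarrow>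
      \<mu> (norm z) * cmod (radial_deriv \<phi> z) * (1 + weight_integral \<omega> (norm z)) \<le> N"
    and rc: "\<And>\<epsilon> \<rho>. \<epsilon> > 0 \<Longrightarrow> 0 < \<rho> \<Longrightarrow> \<rho> < 1 \<Longrightarrow>
           relatively_compact_in (top_of_set (ball 0 1)) (E_set \<mu> \<phi> \<epsilon> \<rho>)"
    and Q: "\<And>C \<eta>. C > 0 \<Longrightarrow> \<eta> > 0 \<Longrightarrow> \<exists>\<epsilon> \<rho>. 0 < \<epsilon> \<and> 0 < \<rho> \<and> \<rho> < 1 \<and>
      (\<forall>h s. h \<in> bloch \<omega> \<longrightarrow> bloch_norm \<omega> h \<le> C \<longrightarrow> 0 \<le> s \<longrightarrow> (\<forall>w\<in>E_set \<mu> \<phi> \<epsilon> \<rho>. cmod (h w) \<le> s) \<longrightarrow>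
         (\<forall>z\<in>ball 0 1. \<mu> (norm z) * cmod (radial_deriv \<phi> z) * cmod (h z) \<le> \<eta> + N * s))"
  shows "compact_linear_operator (bloch \<omega>) (bloch_norm \<omega>) (bloch \<mu>) (bloch_norm \<mu>) (cesaro_op \<phi>)"
  unfolding compact_linear_operator_def
proof (intro conjI ballI allI impI)
  note T = cesaro_bloch[OF \<omega> \<phi> N]
  have hb: "f \<in> holo_ball" if "f \<in> bloch \<omega>" for f :: "'a \<Rightarrow> complex" using that by (simp add: bloch_def)
  show "cesaro_op \<phi> f \<in> bloch \<mu>" if "f \<in> bloch \<omega>" for f using T[OF _ that] by blast
  show "cesaro_op \<phi> (\<lambda>z. f z + g z) = (\<lambda>z. cesaro_op \<phi> f z + cesaro_op \<phi> g z)"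
    if "f \<in> bloch \<omega>" "g \<in> bloch \<omega>" for f g
    using cesaro_op_add[OF hb hb \<phi>] that by blast
  show "cesaro_op \<phi> (\<lambda>z. c * f z) = (\<lambda>z. c * cesaro_op \<phi> f z)" for c f by (rule cesaro_op_cmult)
  fix S :: "('a \<Rightarrow> complex) set"
  assume S: "S \<subseteq> bloch \<omega>" and "\<exists>C. \<forall>f\<in>S. bloch_norm \<omega> f \<le> C"
  then obtain C0 where C0: "\<And>f. f \<in> S \<Longrightarrow> bloch_norm \<omega> f \<le> C0" by blast
  \<comment> \<open>The maximum makes C positive, as \<open>Q\<close> requires.\<close>
  define C where "C = max C0 1"
  have C: "C > 0" "\<And>f. f \<in> S \<Longrightarrow> bloch_norm \<omega> f \<le> C" using C0 by (auto simp: C_def intro: max.coboundedI1)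
  have wp: "\<And>r. r \<in> {0..<1} \<Longrightarrow> \<omega> r > 0" using normal_weight_pos[OF \<omega>] by simp
  have Sb: "f \<in> bloch \<omega>" if "f \<in> S" for f using that S by blast
  obtain A where A: "A > 0" "\<And>(f :: 'a \<Rightarrow> complex) z. f \<in> bloch \<omega> \<Longrightarrow> z \<in> ball 0 1 \<Longrightarrow>
       cmod (f z) \<le> A * bloch_norm \<omega> f * (1 + weight_integral \<omega> (norm z))"
    using bloch_growth[OF \<omega>] by metis
  have growth: "cmod (f z) \<le> A * C * (1 + weight_integral \<omega> r)"
    if f: "f \<in> S" and z: "norm z \<le> r" "r < 1" for f z r
  proof -
    have "cmod (f z) \<le> A * bloch_norm \<omega> f * (1 + weight_integral \<omega> (norm z))"
      by (rule A(2)[OF Sb[OF f]]) (use z in simp)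
    also have "\<dots> \<le> A * C * (1 + weight_integral \<omega> r)"
      using C f A(1) weight_integral_mono[OF \<omega> norm_ge_zero z] weight_integral_nonneg[OF \<omega>, of "norm z"] z
        bloch_norm_bounds(2)[OF wp Sb[OF f], of 0]
      by (intro mult_mono) auto
    finally show ?thesis .
  qed
  interpret M: Metric_space "bloch \<mu> :: ('a \<Rightarrow> complex) set" "bloch_dist \<mu>"
    by (rule Metric_space_bloch[OF \<mu>])
  have "M.mtotally_bounded (cesaro_op \<phi> ` S)"
    unfolding M.mtotally_bounded_def
  proof (intro allI impI)
    fix \<eta> :: real assume \<eta>: "\<eta> > 0"
    \<comment> \<open>2 * C bounds the norm of a difference of two members of S. With N * s \<le>
      \<eta>/4 for the \<open>s\<close> below, the total is \<eta>/2, strictly less than the radius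
      \<eta>.\<close>
    from Q[of "2 * C" "\<eta> / 4"] C(1) \<eta> obtain \<epsilon> \<rho> where er: "0 < \<epsilon>" "0 < \<rho>" "\<rho> < 1"
      and Q': "\<And>h s z. h \<in> bloch \<omega> \<Longrightarrow> bloch_norm \<omega> h \<le> 2 * C \<Longrightarrow> 0 \<le> s \<Longrightarrow>
          (\<And>w. w \<in> E_set \<mu> \<phi> \<epsilon> \<rho> \<Longrightarrow> cmod (h w) \<le> s) \<Longrightarrow> z \<in> ball 0 1 \<Longrightarrow>
          \<mu> (norm z) * cmod (radial_deriv \<phi> z) * cmod (h z) \<le> \<eta> / 4 + N * s"
      by auto
    \<comment> \<open>The denominator is positive and at least N, whatever the sign of N.\<close>
    define s where "s = \<eta> / 4 / (\<bar>N\<bar> + 1)"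
    have N1: "\<bar>N\<bar> + 1 > 0" by linarith
    have s: "s > 0" using \<eta> N1 by (simp add: s_def)
    have Ns: "N * s \<le> \<eta> / 4"
    proof -
      have "N * s \<le> (\<bar>N\<bar> + 1) * s" using s by (intro mult_right_mono) auto
      also have "\<dots> = \<eta> / 4" using N1 unfolding s_def by (metis less_irrefl nonzero_mult_div_cancel_left times_divide_eq_right)
      finally show ?thesis .
    qed
    obtain K where K: "compact K" "K \<subseteq> ball 0 1" "E_set \<mu> \<phi> \<epsilon> \<rho> \<subseteq> K"
      using relatively_compact_in_obtain[OF rc[OF er] E_set_subset] by blast
    have "\<exists>r>0. \<forall>f\<in>S. \<forall>x\<in>ball w r. cmod (f x - f w) \<le> s / 3" if w: "w \<in> K" for w
    proof -
      define R where "R = (1 - norm w) / 2"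
      have R: "R > 0" using w K(2) by (auto simp: R_def)
      define r where "r = (1 + norm w) / 2"
      have r: "0 \<le> r" "r < 1" using w K(2) by (auto simp: r_def)
      have nx: "norm x \<le> r" if "x \<in> ball w R" for x
        using norm_triangle_sub[of x w] that by (simp add: R_def r_def dist_norm norm_minus_commute field_simps)
      have sub: "ball w R \<subseteq> ball 0 1"
      proof
        fix x assume "x \<in> ball w R"
        from nx[OF this] r(2) show "x \<in> ball 0 1" by simp
      qed
      define L where "L = 4 * (A * C * (1 + weight_integral \<omega> r)) / R"
      have L: "L > 0" using A(1) C(1) R weight_integral_nonneg[OF \<omega> r]
        by (simp add: L_def add_pos_nonneg)
      \<comment> \<open>R/2 is the range of the Lipschitz estimate with constant L, and s / (3 * L)
        makes the change at most s / 3; L does not depend on f, so the whole set S is equicontinuous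
        at w.\<close>
      have "cmod (f x - f w) \<le> s / 3" if f: "f \<in> S" and x: "x \<in> ball w (min (R/2) (s / (3 * L)))" for f x
      proof -
        have hol: "holo_on f (ball w R)"
          using hb[OF Sb[OF f]] holo_on_subset[OF _ sub] by (auto simp: holo_ball_iff)
        have "norm (x - w) \<le> R / 2" using x by (simp add: dist_norm norm_minus_commute)
        from holo_on_ball_estimates(2)[OF hol R growth[OF f nx r(2)] this]
        have "cmod (f x - f w) \<le> L * norm (x - w)" by (simp add: L_def)
        also have "\<dots> \<le> L * (s / (3 * L))"
          using x L by (intro mult_left_mono) (auto simp: dist_norm norm_minus_commute)
        finally show ?thesis using L by simp
      qed
      then show ?thesis using R L s by (intro exI[of _ "min (R/2) (s / (3 * L))"]) auto
    qed
    then obtain r where r: "\<And>w. w \<in> K \<Longrightarrow> r w > 0"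
      "\<And>w f x. w \<in> K \<Longrightarrow> f \<in> S \<Longrightarrow> x \<in> ball w (r w) \<Longrightarrow> cmod (f x - f w) \<le> s / 3"
      by metis
    obtain P where P: "P \<subseteq> K" "finite P" "K \<subseteq> (\<Union>w\<in>P. ball w (r w))"
      using compactE_image[OF K(1), of K "\<lambda>w. ball w (r w)"] r(1) by force
    have "\<exists>M. \<forall>f\<in>S. \<forall>w\<in>P. cmod (f w) \<le> M"
    proof -
      \<comment> \<open>Finitely many points of the ball lie within a radius below 1, where the
        growth estimate is uniform over S; 0 is inserted in case P is empty.\<close>
      have "norm w \<le> Max (insert 0 (norm ` P))" if "w \<in> P" for w
        using that P(2) by (intro Max_ge) auto
      moreover have "Max (insert 0 (norm ` P)) < 1"
        using P K(2) by (subst Max_less_iff) auto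
      ultimately show ?thesis using growth by blast
    qed
    then obtain M0 where M0: "\<And>f w. f \<in> S \<Longrightarrow> w \<in> P \<Longrightarrow> cmod (f w) \<le> M0" by blast
    obtain F where F: "finite F" "F \<subseteq> S" "\<And>f. f \<in> S \<Longrightarrow> \<exists>g\<in>F. \<forall>w\<in>P. cmod (f w - g w) < s / 3"
      using finite_pointwise_net[where S = S and s = "s / 3" and M = M0, OF P(2)] M0 s by auto
    show "\<exists>K. finite K \<and> K \<subseteq> cesaro_op \<phi> ` S \<and> cesaro_op \<phi> ` S \<subseteq> (\<Union>x\<in>K. M.mball x \<eta>)"
    proof (intro exI[of _ "cesaro_op \<phi> ` F"] conjI)
      show "finite (cesaro_op \<phi> ` F)" "cesaro_op \<phi> ` F \<subseteq> cesaro_op \<phi> ` S" using F by auto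
      show "cesaro_op \<phi> ` S \<subseteq> (\<Union>x\<in>cesaro_op \<phi> ` F. M.mball x \<eta>)"
      proof clarify
        fix f assume f: "f \<in> S"
        then obtain g where g: "g \<in> F" "\<And>w. w \<in> P \<Longrightarrow> cmod (f w - g w) < s / 3" using F(3) by blast
        then have gS: "g \<in> S" using F(2) by blast
        note gb = Sb[OF gS] and fb = Sb[OF f]
        have onE: "cmod (g x - f x) \<le> s" if xE: "x \<in> E_set \<mu> \<phi> \<epsilon> \<rho>" for x
        proof -
          obtain w where w: "w \<in> P" "x \<in> ball w (r w)" using xE K(3) P(3) by blast
          then have wK: "w \<in> K" using P(1) by blast
          have "g x - f x = (g x - g w) - (f x - f w) - (f w - g w)" by simp
          also have "cmod \<dots> \<le> s / 3 + s / 3 + s / 3"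
            using r(2)[OF wK f w(2)] r(2)[OF wK gS w(2)] g(2)[OF w(1)]
              norm_triangle_ineq4[of "(g x - g w) - (f x - f w)" "f w - g w"]
              norm_triangle_ineq4[of "g x - g w" "f x - f w"] by linarith
          finally show ?thesis by simp
        qed
        have hbl: "(\<lambda>z. g z - f z) \<in> bloch \<omega>" by (rule bloch_diff(1)[OF wp gb fb])
        have hn: "bloch_norm \<omega> (\<lambda>z. g z - f z) \<le> 2 * C"
          using bloch_diff(2)[OF wp gb fb] C(2)[OF f] C(2)[OF gS] by linarith
        have "bloch_norm \<mu> (cesaro_op \<phi> (\<lambda>z. g z - f z)) \<le> \<eta> / 2"
        proof (rule bloch_normI(2)[OF cesaro_op_holo[OF hb[OF hbl] \<phi>]])
          fix z :: 'a assume z: "z \<in> ball 0 1"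
          have "\<mu> (norm z) * cmod (radial_deriv \<phi> z) * cmod (g z - f z) \<le> \<eta> / 4 + N * s"
            by (rule Q'[OF hbl hn less_imp_le[OF s] onE z])
          then show "cmod (cesaro_op \<phi> (\<lambda>z. g z - f z) 0) +
              \<mu> (norm z) * cmod (radial_deriv (cesaro_op \<phi> (\<lambda>z. g z - f z)) z) \<le> \<eta> / 2"
            using Ns by (simp add: cesaro_op_0[OF hb[OF hbl] \<phi>]
                radial_deriv_cesaro_op[OF hb[OF hbl] \<phi> z] norm_mult mult_ac)
        qed
        then have "bloch_dist \<mu> (cesaro_op \<phi> g) (cesaro_op \<phi> f) < \<eta>"
          using \<eta> by (simp add: cesaro_op_diff[OF hb[OF gb] hb[OF fb] \<phi>])
        then have "cesaro_op \<phi> f \<in> M.mball (cesaro_op \<phi> g) \<eta>"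
          using T[OF _ fb] T[OF _ gb] by simp
        then show "cesaro_op \<phi> f \<in> (\<Union>x\<in>cesaro_op \<phi> ` F. M.mball x \<eta>)" using g(1) by blast
      qed
    qed
  qed
  then show "relatively_compact_in (norm_topology (bloch \<mu>) (bloch_norm \<mu>)) (cesaro_op \<phi> ` S)"
    unfolding M.mtotally_bounded_eq_compact_closure_of[OF mcomplete_bloch[OF \<mu>]]
    by (simp add: relatively_compact_in_def norm_topology_def)
qed

lemma mem_E_set:
  assumes "z \<in> ball 0 1" "norm z \<le> \<rho>" "\<rho> < 1" "\<rho> > 0"
    and "\<mu> (norm z) * cmod (radial_deriv \<phi> z) \<ge> \<epsilon>"
  shows "z \<in> E_set \<mu> \<phi> \<epsilon> \<rho>"
  using assms unfolding E_set_def
  by (auto intro!: bexI[of _ 1] simp: one_le_inverse_iff)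

text \<open>This is the purpose of the factor s in \<open>E_set\<close>: the projected point is
  scaled back to z by s = \<parallel>z\<parallel>/\<rho>, which is at most 1/\<rho>.\<close>

lemma radial_projection_mem_E_set:
  assumes "z \<in> ball 0 1" "\<rho> \<le> norm z" "\<rho> < 1" "\<rho> > 0"
    and "\<mu> (norm z) * cmod (radial_deriv \<phi> z) \<ge> \<epsilon>"
  shows "(\<rho> / norm z) *\<^sub>R z \<in> E_set \<mu> \<phi> \<epsilon> \<rho>"
proof -
  have z: "norm z > 0" using assms by linarith
  have n: "norm ((\<rho> / norm z) *\<^sub>R z) = \<rho>" using z assms(4) by simp
  have s: "(norm z / \<rho>) *\<^sub>R (\<rho> / norm z) *\<^sub>R z = z" using z assms(4) by simp
  have "norm z / \<rho> \<in> {1..inverse \<rho>}"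
    using assms by (auto simp: divide_simps)
  then show ?thesis
    unfolding E_set_def mem_Collect_eq using assms n s
    by (intro conjI bexI[of _ "norm z / \<rho>"]) (simp_all only: s, simp_all)
qed

section \<open>The two sufficient conditions for compactness\<close>

context
  fixes \<omega> \<mu> :: "real \<Rightarrow> real" and \<phi> :: "'a::complex_banach \<Rightarrow> complex"
  assumes \<omega>: "normal_weight \<omega>" and \<mu>: "normal_weight \<mu>" and \<phi>: "\<phi> \<in> holo_ball"
    and rc: "\<And>\<epsilon> \<rho>. \<epsilon> > 0 \<Longrightarrow> 0 < \<rho> \<Longrightarrow> \<rho> < 1 \<Longrightarrow>
           relatively_compact_in (top_of_set (ball 0 1)) (E_set \<mu> \<phi> \<epsilon> \<rho>)"
begin

text \<open>With a finite integral, functions of norm at most C are uniformly bounded on the whole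
  ball. So \<epsilon> can be fixed independently of \<rho>, and \<rho> can then be taken from the
  tail of the integral.\<close>

lemma compact_cesaro_if_integrable:
  assumes fin: "(\<integral>\<^sup>+t\<in>{0..<1}. ennreal (1 / \<omega> t) \<partial>lborel) < \<infinity>" and bl: "\<phi> \<in> bloch \<mu>"
  shows "compact_linear_operator (bloch \<omega>) (bloch_norm \<omega>) (bloch \<mu>) (bloch_norm \<mu>) (cesaro_op \<phi>)"
proof -
  obtain B where B: "B \<ge> 0" "\<And>r. 0 \<le> r \<Longrightarrow> r < 1 \<Longrightarrow> weight_integral \<omega> r \<le> B"
    using weight_integral_bounded[OF \<omega> fin] by metis
  have mp: "\<mu> (norm z) > 0" if "z \<in> ball 0 1" for z :: 'a
    using normal_weight_pos[OF \<mu>] that by simp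
  define N0 where "N0 = bloch_norm \<mu> \<phi> + 1"
  have N0: "\<mu> (norm z) * cmod (radial_deriv \<phi> z) \<le> N0" if z: "z \<in> ball 0 1" for z
    using bloch_norm_bounds(1)[OF _ bl z] normal_weight_pos[OF \<mu>] norm_ge_zero[of "\<phi> 0"]
    unfolding N0_def by (smt (verit) atLeastLessThan_iff)
  have N0p: "N0 > 0"
    using bloch_norm_bounds(2)[OF _ bl, of 0] normal_weight_pos[OF \<mu>] by (force simp: N0_def)
  define N where "N = N0 * (1 + B)"
  have N: "N0 \<le> N" "N > 0" using N0p B(1) by (auto simp: N_def algebra_simps add_pos_nonneg)
  obtain A where A: "A > 0" "\<And>(f :: 'a \<Rightarrow> complex) z. f \<in> bloch \<omega> \<Longrightarrow> z \<in> ball 0 1 \<Longrightarrow>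
       cmod (f z) \<le> A * bloch_norm \<omega> f * (1 + weight_integral \<omega> (norm z))"
    using bloch_growth[OF \<omega>] by metis
  show ?thesis
  proof (rule compact_cesaroI[OF \<omega> \<mu> \<phi> _ rc])
    fix z :: 'a assume z: "z \<in> ball 0 1"
    show "\<mu> (norm z) * cmod (radial_deriv \<phi> z) * (1 + weight_integral \<omega> (norm z)) \<le> N"
      unfolding N_def using N0[OF z] N0p B(2)[of "norm z"] weight_integral_nonneg[OF \<omega>, of "norm z"] z
      by (intro mult_mono) auto
  next
    fix C \<eta> :: real assume C: "C > 0" and \<eta>: "\<eta> > 0"
    \<comment> \<open>Here \<epsilon> times the uniform bound of h is \<eta>; below, e is such that
      N * (4 * C * e) is \<eta>.\<close>
    define \<epsilon> where "\<epsilon> = \<eta> / (A * C * (1 + B))"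
    have \<epsilon>: "\<epsilon> > 0" using A(1) C \<eta> B(1) by (simp add: \<epsilon>_def)
    define e where "e = \<eta> / (4 * C * N)"
    have e: "e > 0" using C \<eta> N by (simp add: e_def)
    \<comment> \<open>The supremum of the increasing function
      \<open>weight_integral \<omega>\<close> stands for the integral over [0,1); beyond r0 less
      than e of it is left.\<close>
    define J where "J = weight_integral \<omega> ` {0..<1}"
    have bdd: "bdd_above J" unfolding J_def using B(2) by (auto intro!: bdd_aboveI2)
    have "Sup J - e < Sup J" using e by simp
    then obtain r0 where r0: "r0 \<in> {0..<1}" "Sup J - e < weight_integral \<omega> r0"
      using less_cSup_iff[OF _ bdd] unfolding J_def by auto
    \<comment> \<open>1/4 is the least radius that \<open>bloch_increment\<close> admits.\<close>
    define \<rho> where "\<rho> = max r0 (1/4)"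
    have \<rho>: "1/4 \<le> \<rho>" "\<rho> < 1" "r0 \<le> \<rho>" using r0(1) by (auto simp: \<rho>_def)
    have tail: "weight_integral \<omega> r - weight_integral \<omega> \<rho> \<le> e" if "\<rho> \<le> r" "r < 1" for r
    proof -
      have "weight_integral \<omega> r \<le> Sup J"
        using bdd that \<rho> by (intro cSup_upper) (auto simp: J_def)
      moreover have "weight_integral \<omega> r0 \<le> weight_integral \<omega> \<rho>"
        using r0(1) \<rho> by (intro weight_integral_mono[OF \<omega>]) auto
      ultimately show ?thesis using r0(2) by linarith
    qed
    have "\<mu> (norm z) * cmod (radial_deriv \<phi> z) * cmod (h z) \<le> \<eta> + N * s"
      if h: "h \<in> bloch \<omega>" "bloch_norm \<omega> h \<le> C" and s: "0 \<le> s"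
        and E: "\<And>w. w \<in> E_set \<mu> \<phi> \<epsilon> \<rho> \<Longrightarrow> cmod (h w) \<le> s" and z: "z \<in> ball 0 1" for h s z
    proof (cases "\<mu> (norm z) * cmod (radial_deriv \<phi> z) < \<epsilon>")
      case True
      have hz: "cmod (h z) \<le> A * C * (1 + B)"
      proof -
        have "0 \<le> bloch_norm \<omega> h"
          by (rule bloch_norm_bounds(2)[OF _ h(1), of 0]) (use normal_weight_pos[OF \<omega>] in auto)
        have "cmod (h z) \<le> A * bloch_norm \<omega> h * (1 + weight_integral \<omega> (norm z))"
          by (rule A(2)[OF h(1) z])
        also have "\<dots> \<le> A * C * (1 + B)"
          using \<open>0 \<le> bloch_norm \<omega> h\<close> A(1) C h(2) B(2)[of "norm z"] weight_integral_nonneg[OF \<omega>, of "norm z"] z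
          by (intro mult_mono) auto
        finally show ?thesis .
      qed
      have "\<mu> (norm z) * cmod (radial_deriv \<phi> z) * cmod (h z) \<le> \<epsilon> * (A * C * (1 + B))"
        using True hz mp[OF z] \<epsilon> by (intro mult_mono) auto
      also have "\<dots> = \<eta>" using A(1) C B(1) by (simp add: \<epsilon>_def)
      finally show ?thesis using N(2) s by (simp add: add_increasing2)
    next
      case False
      then have ge: "\<mu> (norm z) * cmod (radial_deriv \<phi> z) \<ge> \<epsilon>" by simp
      have "cmod (h z) \<le> s + 4 * C * e"
      proof (cases "norm z \<le> \<rho>")
        case True
        then have "z \<in> E_set \<mu> \<phi> \<epsilon> \<rho>" using \<rho> by (intro mem_E_set z ge) auto
        then show ?thesis using E C e by (smt (verit) mult_pos_pos)
      next
        case False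
        define u where "u = (1 / norm z) *\<^sub>R z"
        have u: "norm u = 1" "norm z *\<^sub>R u = z" "\<rho> *\<^sub>R u = (\<rho> / norm z) *\<^sub>R z"
          using False \<rho> by (auto simp: u_def)
        have "cmod (h (norm z *\<^sub>R u) - h (\<rho> *\<^sub>R u))
            \<le> 4 * bloch_norm \<omega> h * (weight_integral \<omega> (norm z) - weight_integral \<omega> \<rho>)"
          using False z by (intro bloch_increment[OF \<omega> h(1) u(1) \<rho>(1)]) auto
        also have "\<dots> \<le> 4 * C * (weight_integral \<omega> (norm z) - weight_integral \<omega> \<rho>)"
          using h(2) False z \<rho> weight_integral_mono[OF \<omega>, of \<rho> "norm z"]
          by (intro mult_right_mono mult_left_mono) auto
        also have "\<dots> \<le> 4 * C * e"
          using tail[of "norm z"] False z C by (intro mult_left_mono) auto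
        finally have "cmod (h z - h (\<rho> *\<^sub>R u)) \<le> 4 * C * e" by (simp only: u(2))
        moreover have "cmod (h (\<rho> *\<^sub>R u)) \<le> s"
          unfolding u(3) using False \<rho> by (intro E radial_projection_mem_E_set z ge) auto
        ultimately show ?thesis using norm_triangle_sub[of "h z" "h (\<rho> *\<^sub>R u)"] by linarith
      qed
      then have "\<mu> (norm z) * cmod (radial_deriv \<phi> z) * cmod (h z) \<le> N * (s + 4 * C * e)"
        using N0[OF z] N mp[OF z] by (intro mult_mono) auto
      also have "\<dots> = \<eta> + N * s" using C N by (simp add: e_def field_simps)
      finally show ?thesis .
    qed
    then show "\<exists>\<epsilon> \<rho>. 0 < \<epsilon> \<and> 0 < \<rho> \<and> \<rho> < 1 \<and>
      (\<forall>h s. h \<in> bloch \<omega> \<longrightarrow> bloch_norm \<omega> h \<le> C \<longrightarrow> 0 \<le> s \<longrightarrow> (\<forall>w\<in>E_set \<mu> \<phi> \<epsilon> \<rho>. cmod (h w) \<le> s) \<longrightarrow>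
         (\<forall>z\<in>ball 0 1. \<mu> (norm z) * cmod (radial_deriv \<phi> z) * cmod (h z) \<le> \<eta> + N * s))"
      using \<epsilon> \<rho> by (intro exI[of _ \<epsilon>] exI[of _ \<rho>]) auto
  qed
qed

text \<open>The factor 1 + I instead of I matches the growth estimate, which has to cover functions
  that do not vanish at 0. Points near the sphere are settled by the hypothesis, so no radial
  projection occurs.\<close>

lemma compact_cesaro_if_vanishing:
  assumes van: "\<And>e. e > 0 \<Longrightarrow> \<exists>\<rho>>0. \<rho> < 1 \<and> (\<forall>z\<in>ball 0 1. norm z > \<rho> \<longrightarrow>
      \<mu> (norm z) * cmod (radial_deriv \<phi> z) * (1 + weight_integral \<omega> (norm z)) < e)"
  shows "compact_linear_operator (bloch \<omega>) (bloch_norm \<omega>) (bloch \<mu>) (bloch_norm \<mu>) (cesaro_op \<phi>)"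
proof -
  let ?m = "\<lambda>z. \<mu> (norm z) * cmod (radial_deriv \<phi> z)"
  let ?I = "\<lambda>z::'a. 1 + weight_integral \<omega> (norm z)"
  have m0: "?m z \<ge> 0" if "z \<in> ball 0 1" for z
    using normal_weight_pos[OF \<mu>, of "norm z"] that by simp
  have I1: "?I z \<ge> 1" if "z \<in> ball 0 1" for z
    using weight_integral_nonneg[OF \<omega>, of "norm z"] that by simp
  have Ir: "?I z \<le> 1 + weight_integral \<omega> r" if "norm z \<le> r" "r < 1" for z r
    using weight_integral_mono[OF \<omega> norm_ge_zero that] by simp
  obtain \<rho> where \<rho>: "\<rho> > 0" "\<rho> < 1" "\<And>z. z \<in> ball 0 1 \<Longrightarrow> norm z > \<rho> \<Longrightarrow> ?m z * ?I z < 1"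
    using van[of 1] by auto
  \<comment> \<open>Continuity alone does not bound \<mu>|R\<phi>| on the ball of radius \<rho>.
    Points of this ball where it is at least 1 lie in \<open>E_set\<close> with \<epsilon> = 1,
    hence in the compact set K, and there continuity gives a bound.\<close>
  obtain K where K: "compact K" "K \<subseteq> ball 0 1" "E_set \<mu> \<phi> 1 \<rho> \<subseteq> K"
    using relatively_compact_in_obtain[OF rc[OF zero_less_one \<rho>(1,2)] E_set_subset] by blast
  have "continuous_on (ball 0 1) (\<lambda>z. \<mu> (norm z))"
    by (rule continuous_on_compose2[of "{0..<1}" \<mu>])
       (use \<mu> in \<open>auto simp: normal_weight_def intro!: continuous_intros\<close>)
  moreover have "continuous_on (ball 0 1) (radial_deriv \<phi>)"
    using \<phi> by (intro holo_on_imp_continuous_on holo_on_radial_deriv) (simp add: holo_ball_iff)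
  ultimately have "continuous_on K ?m"
    by (intro continuous_intros) (auto intro: continuous_on_subset[OF _ K(2)])
  then have "bounded (?m ` K)" using K(1) by (meson compact_continuous_image compact_imp_bounded)
  then obtain b where b: "\<And>z. z \<in> K \<Longrightarrow> \<bar>?m z\<bar> \<le> b" "b > 0"
    unfolding bounded_pos by auto
  define N where "N = (b + 1) * (1 + weight_integral \<omega> \<rho>)"
  have I\<rho>: "weight_integral \<omega> \<rho> \<ge> 0" using weight_integral_nonneg[OF \<omega>] \<rho> by simp
  have N1: "N \<ge> 1" using b(2) I\<rho> mult_mono[of 1 "b+1" 1 "1 + weight_integral \<omega> \<rho>"] by (simp add: N_def)
  have N: "?m z * ?I z \<le> N" if z: "z \<in> ball 0 1" for z
  proof (cases "norm z \<le> \<rho>")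
    case True
    have "?m z \<le> b + 1"
    proof (cases "?m z \<ge> 1")
      case True
      then have "z \<in> K" using K(3) mem_E_set[OF z \<open>norm z \<le> \<rho>\<close> \<rho>(2,1)] by blast
      then show ?thesis using b(1)[of z] by simp
    next
      case False
      then show ?thesis using b(2) by simp
    qed
    then show ?thesis unfolding N_def using Ir[OF True \<rho>(2)] m0[OF z] I1[OF z] b(2)
      by (intro mult_mono) auto
  next
    case False
    then show ?thesis using \<rho>(3)[OF z] N1 by simp
  qed
  obtain A where A: "A > 0" "\<And>(f :: 'a \<Rightarrow> complex) z. f \<in> bloch \<omega> \<Longrightarrow> z \<in> ball 0 1 \<Longrightarrow>
       cmod (f z) \<le> A * bloch_norm \<omega> f * (1 + weight_integral \<omega> (norm z))"
    using bloch_growth[OF \<omega>] by metis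
  show ?thesis
  proof (rule compact_cesaroI[OF \<omega> \<mu> \<phi> N rc])
    fix C \<eta> :: real assume C: "C > 0" and \<eta>: "\<eta> > 0"
    obtain r where r: "r > 0" "r < 1" "\<And>z. z \<in> ball 0 1 \<Longrightarrow> norm z > r \<Longrightarrow> ?m z * ?I z < \<eta> / (A * C)"
      using van[of "\<eta> / (A * C)"] A(1) C \<eta> by auto
    have Ir0: "1 + weight_integral \<omega> r > 0" using weight_integral_nonneg[OF \<omega>, of r] r by simp
    \<comment> \<open>Chosen after r, so that \<epsilon> times the bound of h on the ball of radius
      r is \<eta>.\<close>
    define \<epsilon> where "\<epsilon> = \<eta> / (A * C * (1 + weight_integral \<omega> r))"
    have \<epsilon>: "\<epsilon> > 0" using A(1) C \<eta> Ir0 by (simp add: \<epsilon>_def)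
    have "?m z * cmod (h z) \<le> \<eta> + N * s"
      if h: "h \<in> bloch \<omega>" "bloch_norm \<omega> h \<le> C" and s: "0 \<le> s"
        and E: "\<And>w. w \<in> E_set \<mu> \<phi> \<epsilon> r \<Longrightarrow> cmod (h w) \<le> s" and z: "z \<in> ball 0 1" for h s z
    proof -
      have hz: "cmod (h z) \<le> A * C * ?I z"
      proof -
        have "cmod (h z) \<le> A * bloch_norm \<omega> h * ?I z" by (rule A(2)[OF h(1) z])
        also have "\<dots> \<le> A * C * ?I z"
          using A(1) h(2) I1[OF z] by (intro mult_right_mono mult_left_mono) auto
        finally show ?thesis .
      qed
      have Ns: "0 \<le> N * s" using N1 s by simp
      consider "norm z > r" | "norm z \<le> r" "?m z < \<epsilon>" | "norm z \<le> r" "?m z \<ge> \<epsilon>" by linarith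
      then show ?thesis
      proof cases
        case 1
        have "?m z * cmod (h z) \<le> ?m z * (A * C * ?I z)" by (intro mult_left_mono hz m0 z)
        also have "\<dots> = (?m z * ?I z) * (A * C)" by (simp add: mult_ac)
        also have "\<dots> \<le> \<eta> / (A * C) * (A * C)"
          using r(3)[OF z 1] A(1) C by (intro mult_right_mono) auto
        also have "\<dots> = \<eta>" using A(1) C by simp
        finally show ?thesis using Ns by simp
      next
        case 2
        have "cmod (h z) \<le> A * C * (1 + weight_integral \<omega> r)"
          using hz Ir[OF 2(1) r(2)] A(1) C by (smt (verit) mult_left_mono mult_pos_pos)
        then have "?m z * cmod (h z) \<le> \<epsilon> * (A * C * (1 + weight_integral \<omega> r))"
          using 2(2) m0[OF z] by (intro mult_mono) auto
        also have "\<dots> = \<eta>" using A(1) C Ir0 by (simp add: \<epsilon>_def)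
        finally show ?thesis using Ns by simp
      next
        case 3
        have "cmod (h z) \<le> s" using 3 r by (intro E mem_E_set z) auto
        moreover have "?m z \<le> N"
          using N[OF z] mult_left_mono[OF I1[OF z] m0[OF z]] by simp
        ultimately have "?m z * cmod (h z) \<le> N * s" using N1 by (intro mult_mono) auto
        then show ?thesis using \<eta> by simp
      qed
    qed
    then show "\<exists>\<epsilon> \<rho>. 0 < \<epsilon> \<and> 0 < \<rho> \<and> \<rho> < 1 \<and>
      (\<forall>h s. h \<in> bloch \<omega> \<longrightarrow> bloch_norm \<omega> h \<le> C \<longrightarrow> 0 \<le> s \<longrightarrow> (\<forall>w\<in>E_set \<mu> \<phi> \<epsilon> \<rho>. cmod (h w) \<le> s) \<longrightarrow>
         (\<forall>z\<in>ball 0 1. \<mu> (norm z) * cmod (radial_deriv \<phi> z) * cmod (h z) \<le> \<eta> + N * s))"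
      using \<epsilon> r by (intro exI[of _ \<epsilon>] exI[of _ r]) auto
  qed
qed

end

section \<open>Norming functionals\<close>

text \<open>Domination by the norm also bounds p from below by minus the norm, since 0 = p 0 \<le> p
  x + p(-x); hence pointwise infima of families of such functionals are finite.\<close>

definition sublinear_le_norm :: "('a::real_normed_vector \<Rightarrow> real) \<Rightarrow> bool" where
  "sublinear_le_norm p \<longleftrightarrow>
     (\<forall>x y. p (x + y) \<le> p x + p y) \<and> (\<forall>t x. t \<ge> 0 \<longrightarrow> p (t *\<^sub>R x) = t * p x) \<and> (\<forall>x. p x \<le> norm x)"

text \<open>One inequality for positive t is enough: applied to 1/t it yields the reverse
  one.\<close>

lemma sublinear_le_normI:
  assumes "\<And>x y. p (x + y) \<le> p x + p y" and "p 0 = 0"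
    and c: "\<And>t x. t > 0 \<Longrightarrow> p (t *\<^sub>R x) \<le> t * p x" and "\<And>x. p x \<le> norm x"
  shows "sublinear_le_norm p"
proof -
  have "p (t *\<^sub>R x) = t * p x" if t: "t > 0" for t x
  proof (rule antisym[OF c[OF t]])
    have "p ((1/t) *\<^sub>R t *\<^sub>R x) \<le> (1/t) * p (t *\<^sub>R x)" using t by (intro c) simp
    then show "t * p x \<le> p (t *\<^sub>R x)" using t by (simp add: field_simps)
  qed
  then have "p (t *\<^sub>R x) = t * p x" if "t \<ge> 0" for t x
    using that assms(2) by (cases "t = 0") auto
  then show ?thesis using assms unfolding sublinear_le_norm_def by blast
qed

lemma sublinear_le_normD:
  assumes "sublinear_le_norm p"
  shows "p (x + y) \<le> p x + p y" "t \<ge> 0 \<Longrightarrow> p (t *\<^sub>R x) = t * p x" "p x \<le> norm x" "p 0 = 0"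
    "- norm x \<le> p x"
proof -
  show add: "p (x + y) \<le> p x + p y" and "t \<ge> 0 \<Longrightarrow> p (t *\<^sub>R x) = t * p x" and "p x \<le> norm x" for x y t
    using assms unfolding sublinear_le_norm_def by blast+
  then show 0: "p 0 = 0" using assms unfolding sublinear_le_norm_def
    by (metis mult_zero_left order_refl scaleR_zero_left)
  show "- norm x \<le> p x"
    using add[of x "- x"] assms 0 unfolding sublinear_le_norm_def
    by (metis add.right_inverse add_le_cancel_left le_minus_iff minus_le_iff norm_minus_cancel
        order_trans diff_0 le_diff_eq add.commute diff_minus_eq_add)
qed

text \<open>Take the infimum over t \<ge> 0 of p(x + ty) - t p(y). It forces q(-y) \<le> -p(y), and
  if q coincides with p, then p(x + y) = p(x) + p(y) for all x.\<close>

lemma sublinear_shift: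
  assumes p: "sublinear_le_norm (p :: 'a::real_normed_vector \<Rightarrow> real)"
  obtains q where "sublinear_le_norm q" "\<And>x. q x \<le> p x" "\<And>x. q x \<le> p (x + y) - p y"
proof -
  note P = sublinear_le_normD[OF p]
  define q where "q = (\<lambda>x. INF t\<in>{0..}. p (x + t *\<^sub>R y) - t * p y)"
  have bdd: "bdd_below ((\<lambda>t. p (x + t *\<^sub>R y) - t * p y) ` {0..})" for x
  proof (rule bdd_belowI2[of _ "- p (- x)"])
    fix t :: real assume "t \<in> {0..}"
    then show "- p (- x) \<le> p (x + t *\<^sub>R y) - t * p y"
      using P(1)[of "x + t *\<^sub>R y" "- x"] P(2)[of t y] by simp
  qed
  have le: "q x \<le> p (x + t *\<^sub>R y) - t * p y" if "t \<ge> 0" for x t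
    unfolding q_def by (rule cINF_lower[OF bdd]) (use that in simp)
  have ge: "c \<le> q x" if "\<And>t. t \<ge> 0 \<Longrightarrow> c \<le> p (x + t *\<^sub>R y) - t * p y" for c x
    unfolding q_def by (rule cINF_greatest) (use that in auto)
  have qp: "q x \<le> p x" for x using le[of 0 x] by simp
  have "sublinear_le_norm q"
  proof (rule sublinear_le_normI)
    fix x x'
    have "q (x + x') - q x' \<le> q x"
    proof (rule ge)
      fix t :: real assume t: "t \<ge> 0"
      have "q (x + x') - (p (x + t *\<^sub>R y) - t * p y) \<le> q x'"
      proof (rule ge)
        fix s :: real assume s: "s \<ge> 0"
        have "q (x + x') \<le> p ((x + x') + (t + s) *\<^sub>R y) - (t + s) * p y"
          using t s by (intro le) simp
        also have "(x + x') + (t + s) *\<^sub>R y = (x + t *\<^sub>R y) + (x' + s *\<^sub>R y)"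
          by (simp add: algebra_simps)
        also have "p \<dots> \<le> p (x + t *\<^sub>R y) + p (x' + s *\<^sub>R y)" by (rule P(1))
        finally show "q (x + x') - (p (x + t *\<^sub>R y) - t * p y) \<le> p (x' + s *\<^sub>R y) - s * p y"
          by (simp add: algebra_simps)
      qed
      then show "q (x + x') - q x' \<le> p (x + t *\<^sub>R y) - t * p y" by simp
    qed
    then show "q (x + x') \<le> q x + q x'" by simp
  next
    show "q 0 = 0"
    proof (rule antisym)
      show "q 0 \<le> 0" using qp[of 0] P(4) by simp
      show "0 \<le> q 0" by (rule ge) (simp add: P(2))
    qed
  next
    fix t :: real and x assume t: "t > 0"
    have "q (t *\<^sub>R x) / t \<le> q x"
    proof (rule ge)
      fix s :: real assume s: "s \<ge> 0"
      have "q (t *\<^sub>R x) \<le> p (t *\<^sub>R x + (t * s) *\<^sub>R y) - (t * s) * p y"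
        using t s by (intro le) simp
      also have "t *\<^sub>R x + (t * s) *\<^sub>R y = t *\<^sub>R (x + s *\<^sub>R y)" by (simp add: algebra_simps)
      also have "p \<dots> = t * p (x + s *\<^sub>R y)" using t by (intro P(2)) simp
      finally show "q (t *\<^sub>R x) / t \<le> p (x + s *\<^sub>R y) - s * p y"
        using t by (simp add: field_simps)
    qed
    then show "q (t *\<^sub>R x) \<le> t * q x" using t by (simp add: field_simps)
  next
    show "q x \<le> norm x" for x using qp[of x] P(3)[of x] by linarith
  qed
  moreover have "q x \<le> p (x + y) - p y" for x using le[of 1 x] by simp
  ultimately show ?thesis using qp by (intro that)
qed

text \<open>
  The Hahn-Banach theorem: a minimal sublinear functional \<open>m\<close> is linear, because the shift of \<open>m\<close>
  by any vector is no larger than \<open>m\<close> and hence equal to it.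
\<close>

lemma real_norming_functional:
  fixes z :: "'a::real_normed_vector"
  obtains l :: "'a \<Rightarrow> real" where "linear l" "\<And>x. l x \<le> norm x" "l z = norm z"
proof -
  have "sublinear_le_norm (norm :: 'a \<Rightarrow> real)"
    by (rule sublinear_le_normI) (auto intro: norm_triangle_ineq)
  \<comment> \<open>Every linear l below \<open>p0\<close> satisfies l(-z) \<le> p0(-z) \<le>
    -\<parallel>z\<parallel>, which makes it norming at z.\<close>
  then obtain p0 :: "'a \<Rightarrow> real" where p0: "sublinear_le_norm p0" "\<And>x. p0 x \<le> norm (x + z) - norm z"
    using sublinear_shift by metis
  define A where "A = {p. sublinear_le_norm p \<and> (\<forall>x. p x \<le> p0 x)}"
  \<comment> \<open>The order is reversed: the upper bounds in Zorn's lemma are pointwise infima,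
    and its maximal element is a minimal functional.\<close>
  define P where "P = (\<lambda>(p :: 'a \<Rightarrow> real) q. \<forall>x. q x \<le> p x)"
  have "\<exists>m\<in>A. \<forall>a\<in>A. P m a \<longrightarrow> a = m"
  proof (rule predicate_Zorn)
    show "partial_order_on A (relation_of P A)"
      by (rule partial_order_on_relation_ofI) (auto simp: P_def fun_eq_iff intro: order_trans antisym)
    fix C assume C: "C \<in> Chains (relation_of P A)"
    show "\<exists>u\<in>A. \<forall>a\<in>C. P a u"
    proof (cases "C = {}")
      case True
      then show ?thesis using p0 by (auto simp: A_def)
    next
      case False
      have CA: "C \<subseteq> A" by (rule Chains_relation_of[OF C])
      have chain: "P p q \<or> P q p" if "p \<in> C" "q \<in> C" for p q
        using C that unfolding Chains_def relation_of_def by blast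
      have S: "sublinear_le_norm p" if "p \<in> C" for p using that CA by (auto simp: A_def)
      define u where "u = (\<lambda>x. INF p\<in>C. p x)"
      have le: "u x \<le> p x" if "p \<in> C" for p x
        unfolding u_def by (rule cINF_lower) (use that sublinear_le_normD(5)[OF S] in \<open>auto intro!: bdd_belowI2\<close>)
      have ge: "c \<le> u x" if "\<And>p. p \<in> C \<Longrightarrow> c \<le> p x" for c x
        unfolding u_def by (rule cINF_greatest[OF False]) (use that in auto)
      obtain p where p: "p \<in> C" using False by blast
      have "sublinear_le_norm u"
      proof (rule sublinear_le_normI)
        fix x y
        have "u (x + y) - u y \<le> u x"
        proof (rule ge)
          fix p assume p: "p \<in> C"
          have "u (x + y) - p x \<le> u y"
          proof (rule ge)
            fix q assume q: "q \<in> C"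
            \<comment> \<open>In a chain the smaller of p and q serves as r.\<close>
            obtain r where r: "r \<in> C" "r x \<le> p x" "r y \<le> q y"
              using chain[OF p q] p q unfolding P_def by blast
            show "u (x + y) - p x \<le> q y"
              using le[OF r(1), of "x + y"] sublinear_le_normD(1)[OF S[OF r(1)], of x y] r(2,3) by linarith
          qed
          then show "u (x + y) - u y \<le> p x" by simp
        qed
        then show "u (x + y) \<le> u x + u y" by simp
      next
        have "(INF p\<in>C. p 0) = (INF p\<in>C. 0 :: real)"
          by (intro INF_cong refl sublinear_le_normD(4)[OF S])
        then show "u 0 = 0" using False by (simp add: u_def)
      next
        fix t :: real and x assume t: "t > 0"
        have "u (t *\<^sub>R x) / t \<le> u x"
        proof (rule ge)
          fix p assume p: "p \<in> C"
          have "p (t *\<^sub>R x) = t * p x" using t by (intro sublinear_le_normD(2)[OF S[OF p]]) simp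
          then show "u (t *\<^sub>R x) / t \<le> p x" using le[OF p, of "t *\<^sub>R x"] t by (simp add: field_simps)
        qed
        then show "u (t *\<^sub>R x) \<le> t * u x" using t by (simp add: field_simps)
      next
        show "u x \<le> norm x" for x using le[OF p, of x] sublinear_le_normD(3)[OF S[OF p], of x] by linarith
      qed
      moreover have "u x \<le> p0 x" for x
      proof -
        have "p x \<le> p0 x" using p CA by (auto simp: A_def)
        with le[OF p, of x] show ?thesis by linarith
      qed
      ultimately show ?thesis using le by (auto simp: A_def P_def)
    qed
  qed
  then obtain m where m: "m \<in> A" and min: "\<And>a. a \<in> A \<Longrightarrow> P m a \<Longrightarrow> a = m" by blast
  have ms: "sublinear_le_norm m" and mp: "m x \<le> p0 x" for x using m by (auto simp: A_def)
  note M = sublinear_le_normD[OF ms]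
  have add: "m (x + y) = m x + m y" for x y
  proof (rule antisym[OF M(1)])
    obtain q where q: "sublinear_le_norm q" "\<And>x. q x \<le> m x" "\<And>x. q x \<le> m (x + y) - m y"
      using sublinear_shift[OF ms] by metis
    have "q x \<le> p0 x" for x using q(2)[of x] mp[of x] by linarith
    then have "q = m" using q by (intro min) (auto simp: A_def P_def)
    then show "m x + m y \<le> m (x + y)" using q(3)[of x] by simp
  qed
  have neg: "m (- x) = - m x" for x using add[of x "- x"] M(4) by simp
  have "linear m"
  proof (rule linearI)
    show "m (x + y) = m x + m y" for x y by (rule add)
    fix r :: real and x
    show "m (r *\<^sub>R x) = r *\<^sub>R m x"
    proof (cases "r \<ge> 0")
      case False
      then have "m ((- r) *\<^sub>R x) = (- r) * m x" by (intro M(2)) simp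
      then show ?thesis using neg[of "r *\<^sub>R x"] by simp
    qed (simp add: M(2))
  qed
  moreover have "m z = norm z"
    using M(3)[of z] mp[of "- z"] p0(2)[of "- z"] neg[of z] by simp
  ultimately show ?thesis using M(3) by (intro that)
qed

text \<open>The usual complexification l(x) - i l(ix) of a real norming functional. Rotating x until
  L x is nonnegative reduces the modulus bound to the real one. At z the real part already exhausts
  this bound, so the imaginary part is 0.\<close>

lemma norming_functional:
  fixes z :: "'a::complex_banach"
  obtains L :: "'a \<Rightarrow> complex" where "bounded_linear L" "\<And>c x. L (scaleC c x) = c * L x"
    "\<And>x. cmod (L x) \<le> norm x" "L z = complex_of_real (norm z)"
proof -
  obtain l :: "'a \<Rightarrow> real" where l: "linear l" "\<And>x. l x \<le> norm x" "l z = norm z"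
    using real_norming_functional by blast
  define L where "L = (\<lambda>x. Complex (l x) (- l (scaleC \<i> x)))"
  have add: "L (x + y) = L x + L y" for x y
    by (simp add: L_def scaleC_add_right linear_add[OF l(1)] complex_eq_iff)
  have scR: "scaleC c (r *\<^sub>R x) = r *\<^sub>R scaleC c x" for c r and x :: 'a
    by (simp add: scaleC_scaleC mult.commute flip: scaleC_of_real)
  have scale: "L (r *\<^sub>R x) = complex_of_real r * L x" for r x
    by (simp add: L_def scR linear_cmul[OF l(1)] complex_eq_iff)
  have ii: "L (scaleC \<i> x) = \<i> * L x" for x
  proof -
    have "scaleC \<i> (scaleC \<i> x) = - x"
      using scaleC_of_real[of "-1" x] by (simp add: scaleC_scaleC)
    then show ?thesis by (simp add: L_def linear_neg[OF l(1)] complex_eq_iff)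
  qed
  have hom: "L (scaleC c x) = c * L x" for c x
  proof -
    have "scaleC c x = scaleC (complex_of_real (Re c) + \<i> * complex_of_real (Im c)) x"
      by (simp add: complex_eq[symmetric])
    also have "\<dots> = Re c *\<^sub>R x + scaleC \<i> (Im c *\<^sub>R x)"
      by (simp add: scaleC_add_left scaleC_of_real flip: scaleC_scaleC)
    finally have "L (scaleC c x) = (complex_of_real (Re c) + \<i> * complex_of_real (Im c)) * L x"
      by (simp add: add scale ii algebra_simps)
    then show ?thesis by (simp add: complex_eq[symmetric])
  qed
  have bd: "cmod (L x) \<le> norm x" for x
  proof (cases "L x = 0")
    case False
    define c where "c = cnj (L x) / complex_of_real (cmod (L x))"
    have c: "cmod c = 1" using False by (simp add: c_def norm_divide)
    have "c * L x = complex_of_real (cmod (L x))"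
      using False by (simp add: c_def complex_norm_square[symmetric] power2_eq_square mult.commute)
    then have "cmod (L x) = Re (L (scaleC c x))" by (simp add: hom)
    also have "\<dots> = l (scaleC c x)" by (simp add: L_def)
    also have "\<dots> \<le> norm (scaleC c x)" by (rule l(2))
    finally show ?thesis by (simp add: norm_scaleC c)
  qed simp
  have "L z = complex_of_real (norm z)"
  proof -
    have "Re (L z) = norm z" by (simp add: L_def l)
    moreover have "(Re (L z))\<^sup>2 + (Im (L z))\<^sup>2 \<le> (norm z)\<^sup>2"
      using power_mono[OF bd[of z] norm_ge_zero, of 2] by (simp add: cmod_power2)
    ultimately show ?thesis by (simp add: complex_eq_iff)
  qed
  moreover have "bounded_linear L"
    by (rule bounded_linear_intro[where K = 1]) (simp_all add: add scale bd scaleR_conv_of_real)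
  ultimately show ?thesis using hom bd by (intro that)
qed

section \<open>Test functions\<close>

text \<open>
  The series samples \<open>1 / \<omega>\<close> at the points \<open>t\<^sub>k = 1 - d / 2\<^sup>k\<close>, weighted by the kernels
  \<open>((1 - t\<^sub>k) / (1 - t\<^sub>k \<zeta>))\<^sup>p\<close> with \<open>p > b\<close>: at radius \<open>r\<close> normality makes the terms decay
  geometrically on both sides of the index with \<open>t\<^sub>k\<close> close to \<open>r\<close>.
\<close>

lemma normal_weight_test_function:
  assumes \<omega>: "normal_weight \<omega>"
  obtains g :: "complex \<Rightarrow> complex" and G :: "real \<Rightarrow> real" and c C :: real
  where "g holomorphic_on ball 0 1" "\<And>x. x \<in> ball 0 1 \<Longrightarrow> cmod (g x) \<le> G (cmod x)"
    "\<And>r. 0 \<le> r \<Longrightarrow> r < 1 \<Longrightarrow> g (complex_of_real r) = complex_of_real (G r)"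
    "\<And>r s. 0 \<le> r \<Longrightarrow> r \<le> s \<Longrightarrow> s < 1 \<Longrightarrow> G r \<le> G s"
    "c > 0" "\<And>r. 0 \<le> r \<Longrightarrow> r < 1 \<Longrightarrow> c / \<omega> r \<le> G r"
    "C > 0" "\<And>r. 0 \<le> r \<Longrightarrow> r < 1 \<Longrightarrow> G r \<le> C / \<omega> r"
proof -
  from \<omega> obtain \<delta> a b where \<delta>: "0 \<le> \<delta>" "\<delta> < 1" and ab: "0 < a" "a < b"
    and anti: "antimono_on {\<delta>..<1} (\<lambda>r. \<omega> r / (1 - r) powr a)"
    and mono: "mono_on {\<delta>..<1} (\<lambda>r. \<omega> r / (1 - r) powr b)"
    unfolding normal_weight_def by auto
  have wp: "\<omega> r > 0" if "0 \<le> r" "r < 1" for r using normal_weight_pos[OF \<omega> that] .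
  \<comment> \<open>Normality as ratio bounds for 1/\<omega> at two radii: \<open>upper_a\<close>
    gives its decay to the left of r, \<open>upper_b\<close> limits its growth to the right of
    s.\<close>
  have upper_a: "1 / \<omega> s \<le> 1 / \<omega> r * ((1 - r) / (1 - s)) powr a" if "\<delta> \<le> s" "s \<le> r" "r < 1" for r s
  proof -
    have "\<omega> r / (1 - r) powr a \<le> \<omega> s / (1 - s) powr a"
      using monotone_onD[OF anti, of s r] that by simp
    moreover have "(1 - r) powr a > 0" "(1 - s) powr a > 0" "\<omega> r > 0" "\<omega> s > 0"
      using that \<delta> wp by auto
    ultimately have "1 / \<omega> s \<le> 1 / \<omega> r * ((1 - r) powr a / (1 - s) powr a)" by (simp add: field_simps)
    then show ?thesis using that by (simp add: powr_divide)
  qed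
  have upper_b: "1 / \<omega> r \<le> 1 / \<omega> s * ((1 - s) / (1 - r)) powr b" if "\<delta> \<le> s" "s \<le> r" "r < 1" for r s
  proof -
    have "\<omega> s / (1 - s) powr b \<le> \<omega> r / (1 - r) powr b"
      using monotone_onD[OF mono, of s r] that by simp
    moreover have "(1 - r) powr b > 0" "(1 - s) powr b > 0" "\<omega> r > 0" "\<omega> s > 0"
      using that \<delta> wp by auto
    ultimately have "1 / \<omega> r \<le> 1 / \<omega> s * ((1 - s) powr b / (1 - r) powr b)" by (simp add: field_simps)
    then show ?thesis using that by (simp add: powr_divide)
  qed
  define d where "d = 1 - \<delta>"
  have d: "0 < d" "d \<le> 1" using \<delta> by (auto simp: d_def)
  define y where "y = (\<lambda>k::nat. d / 2 ^ k)"
  have y: "y k > 0" "y k \<le> d" for k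
    using d by (auto simp: y_def divide_le_eq mult_le_cancel_left1 intro: order_trans[OF _ mult_left_mono])
  have y_ratio: "y (i + j) / y i = (1/2) ^ j" for i j
    using d by (simp add: y_def power_add power_divide)
  have y_mono: "y (i + j) \<le> y i" for i j
    unfolding y_def using d by (intro divide_left_mono power_increasing) auto
  define t where "t = (\<lambda>k. 1 - y k)"
  have t: "\<delta> \<le> t k" "0 \<le> t k" "t k < 1" for k
    using y[of k] \<delta> by (auto simp: t_def d_def)
  \<comment> \<open>With q = y k / (1 - r) \<le> 1 the kernel is at most q^p, while 1/\<omega> grows
    at most like q^(-b); p \<ge> b + 1 leaves a factor q.\<close>
  obtain p :: nat where p: "real p \<ge> b + 1" using real_arch_simple by blast
  define T where "T = (\<lambda>k r. 1 / \<omega> (t k) * (y k / (1 - t k * r)) ^ p)"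
  have den: "1 - t k * r > 0" if "0 \<le> r" "r < 1" for k r
    using mult_strict_mono[OF t(3)[of k] that(2)] t[of k] that by simp
  have T0: "T k r \<ge> 0" if "0 \<le> r" "r < 1" for k r
    using wp[OF t(2,3)[of k]] y(1)[of k] den[OF that, of k] by (simp add: T_def less_imp_le)
  have Tmono: "T k r \<le> T k s" if "0 \<le> r" "r \<le> s" "s < 1" for k r s
  proof -
    have "t k * r \<le> t k * s" using t that by (intro mult_left_mono) auto
    then show ?thesis unfolding T_def
      using wp[OF t(2,3)[of k]] y(1)[of k] den[of r k] den[of s k] that
      by (intro mult_left_mono power_mono divide_left_mono) (auto intro: less_imp_le)
  qed
  \<comment> \<open>The radius r lies between \<open>t m\<close> and \<open>t (Suc m)\<close>; this
    index separates the two regimes of the series.\<close>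
  have index: "\<exists>m. 1 - r \<le> y m \<and> y (Suc m) < 1 - r" if r: "\<delta> \<le> r" "r < 1" for r
  proof -
    obtain k where "(1/2 :: real) ^ k < (1 - r) / d"
      using real_arch_pow_inv[of "(1 - r) / d" "1/2"] r d by auto
    then have k: "y k < 1 - r" using d by (simp add: y_def power_divide field_simps)
    define n where "n = (LEAST k. y k < 1 - r)"
    have n: "y n < 1 - r" unfolding n_def by (rule LeastI[of "\<lambda>k. y k < 1 - r", OF k])
    have "n \<noteq> 0"
    proof
      assume "n = 0"
      with n r show False by (simp add: y_def d_def)
    qed
    then obtain m where m: "n = Suc m" using not0_implies_Suc by blast
    have "\<not> y m < 1 - r" using not_less_Least[of m "\<lambda>k. y k < 1 - r"] m by (simp add: n_def)
    with n m show ?thesis by (intro exI[of _ m]) auto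
  qed
  define \<beta> where "\<beta> = (1/2 :: real) powr a"
  have \<beta>: "0 < \<beta>" "\<beta> < 1" using ab by (auto simp: \<beta>_def powr01_less_one)
  \<comment> \<open>The sums of the geometric series with ratios \<beta> and 1/2.\<close>
  define C0 where "C0 = 1 / (1 - \<beta>) + 2"
  have C0: "C0 > 0" using \<beta> by (simp add: C0_def add_pos_pos)
  have part: "(\<Sum>k<n. T k r) \<le> C0 / \<omega> r" if r: "\<delta> \<le> r" "r < 1" for n r
  proof -
    have r0: "0 \<le> r" "1 - r > 0" using r \<delta> by auto
    have w: "\<omega> r > 0" using wp r0 r by simp
    obtain m where m: "1 - r \<le> y m" "y (Suc m) < 1 - r" using index[OF r] by blast
    \<comment> \<open>Majorant of the terms in units of 1/\<omega>(r). To the left of r the kernel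
      is at most 1 and \<open>upper_a\<close> gives the ratio \<beta>; to the right the kernel
      outweighs the growth allowed by \<open>upper_b\<close>, leaving the ratio 1/2.\<close>
    define B where "B = (\<lambda>k. if k \<le> m then \<beta> ^ (m - k) else (1/2) ^ (k - Suc m))"
    have TB: "T k r \<le> 1 / \<omega> r * B k" for k
    proof (cases "k \<le> m")
      case True
      then obtain j where j: "m = k + j" using le_Suc_ex by blast
      have "y m \<le> y k" using y_mono[of k j] j by simp
      then have tr: "t k \<le> r" using m by (simp add: t_def)
      have "y k \<le> 1 - t k * r" using t[of k] r mult_left_mono[of r 1 "t k"] by (simp add: t_def)
      then have "(y k / (1 - t k * r)) ^ p \<le> 1"
        using y(1)[of k] den[OF r0(1) r(2), of k] by (intro power_le_one) auto
      then have "T k r \<le> 1 / \<omega> (t k)"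
        using wp[OF t(2,3)[of k]] unfolding T_def by (simp add: mult_left_le divide_le_cancel)
      also have "\<dots> \<le> 1 / \<omega> r * ((1 - r) / (1 - t k)) powr a"
        by (rule upper_a[OF t(1) tr r(2)])
      also have "\<dots> \<le> 1 / \<omega> r * (y m / y k) powr a"
        using w m(1) r0 ab y(1)[of k] by (intro mult_left_mono powr_mono2) (auto simp: t_def divide_right_mono)
      also have "(y m / y k) powr a = \<beta> ^ j"
        using y_ratio[of k j] j by (simp add: \<beta>_def powr_realpow[symmetric] powr_powr mult.commute)
      finally show ?thesis using True j by (simp add: B_def)
    next
      case False
      then obtain j where j: "k = Suc m + j" using le_Suc_ex[of "Suc m" k] by auto
      define q where "q = y k / (1 - r)"
      have yk: "y k \<le> y (Suc m)" using y_mono[of "Suc m" j] j by simp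
      have q: "0 < q" "q \<le> 1" using y(1)[of k] r0 yk m by (auto simp: q_def)
      have tr: "r \<le> t k" using yk m by (simp add: t_def)
      have "1 - r \<le> 1 - t k * r" using t[of k] r0 mult_right_mono[of "t k" 1 r] by simp
      then have "(y k / (1 - t k * r)) ^ p \<le> q ^ p"
        unfolding q_def using y(1)[of k] den[OF r0(1) r(2), of k] r0
        by (intro power_mono divide_left_mono) auto
      then have "T k r \<le> 1 / \<omega> (t k) * q ^ p"
        using wp[OF t(2,3)[of k]] unfolding T_def by (intro mult_left_mono) auto
      also have "\<dots> \<le> (1 / \<omega> r * ((1 - r) / (1 - t k)) powr b) * q ^ p"
        using q by (intro mult_right_mono upper_b[OF r(1) tr t(3)]) auto
      also have "\<dots> = 1 / \<omega> r * q powr (real p - b)"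
      proof -
        have "(1 - r) / (1 - t k) = 1 / q" by (simp add: q_def t_def)
        then have "((1 - r) / (1 - t k)) powr b = q powr (- b)"
          using q by (simp add: powr_minus powr_divide inverse_eq_divide)
        then show ?thesis using q by (simp add: powr_realpow[symmetric] powr_add[symmetric])
      qed
      also have "\<dots> \<le> 1 / \<omega> r * q"
        using w q p powr_mono'[of 1 "real p - b" q] by (intro mult_left_mono) auto
      also have "\<dots> \<le> 1 / \<omega> r * (y k / y (Suc m))"
        unfolding q_def using w m y(1) r0 by (intro mult_left_mono divide_left_mono) (auto intro: less_imp_le)
      also have "y k / y (Suc m) = (1/2) ^ j" using y_ratio[of "Suc m" j] j by simp
      finally show ?thesis using False j by (simp add: B_def)
    qed
    have geo: "(\<Sum>k<n. x ^ k) \<le> 1 / (1 - x)" if "0 < x" "x < 1" for x :: real and n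
      using that by (simp add: sum_gp_strict divide_right_mono)
    have "(\<Sum>k<Suc m + n. B k) = (\<Sum>k<Suc m. B k) + (\<Sum>j<n. (1/2) ^ j)"
      by (induction n) (auto simp: B_def)
    also have "(\<Sum>k<Suc m. B k) = (\<Sum>k<Suc m. \<beta> ^ (Suc m - Suc k))"
      by (intro sum.cong) (auto simp: B_def)
    also have "\<dots> = (\<Sum>k<Suc m. \<beta> ^ k)" by (rule sum.nat_diff_reindex)
    also have "(\<Sum>k<Suc m. \<beta> ^ k) + (\<Sum>j<n. (1/2) ^ j) \<le> C0"
    proof -
      have "(\<Sum>j<n. (1/2) ^ j) \<le> (2 :: real)" using geo[of "1/2" n] by simp
      then show ?thesis unfolding C0_def using geo[OF \<beta>, of "Suc m"] by linarith
    qed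
    finally have SB: "(\<Sum>k<Suc m + n. B k) \<le> C0" .
    have "(\<Sum>k<n. T k r) \<le> (\<Sum>k<Suc m + n. T k r)"
      by (rule sum_mono2) (use T0 r0 r in auto)
    also have "\<dots> \<le> (\<Sum>k<Suc m + n. 1 / \<omega> r * B k)" by (rule sum_mono[OF TB])
    also have "\<dots> = 1 / \<omega> r * (\<Sum>k<Suc m + n. B k)" by (rule sum_distrib_left[symmetric])
    also have "\<dots> \<le> 1 / \<omega> r * C0" using w SB by (intro mult_left_mono) auto
    finally show ?thesis by simp
  qed
  have summ\<delta>: "summable (\<lambda>k. T k r)" if "\<delta> \<le> r" "r < 1" for r
    by (rule summableI_nonneg_bounded[OF _ part[OF that]]) (use T0 that \<delta> in auto)
  \<comment> \<open>Below \<delta> normality gives nothing, but the terms increase with r, so those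
    at max r \<delta> are a majorant.\<close>
  have summ: "summable (\<lambda>k. T k r)" if r: "0 \<le> r" "r < 1" for r
  proof (rule summable_comparison_test'[OF summ\<delta>[of "max r \<delta>"]])
    show "norm (T k r) \<le> T k (max r \<delta>)" for k
      using T0[OF r, of k] Tmono[of r "max r \<delta>" k] r \<delta> by simp
  qed (use r \<delta> in auto)
  define G where "G = (\<lambda>r. \<Sum>k. T k r)"
  have Gmono: "G r \<le> G s" if "0 \<le> r" "r \<le> s" "s < 1" for r s
    unfolding G_def by (rule suminf_le) (use Tmono that summ in auto)
  have TG: "T k r \<le> G r" if "0 \<le> r" "r < 1" for k r
    unfolding G_def using sum_le_suminf[OF summ[OF that], of "{k}"] T0[OF that] by simp
  have G\<delta>: "G r \<le> C0 / \<omega> r" if "\<delta> \<le> r" "r < 1" for r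
    unfolding G_def by (rule suminf_le_const[OF summ\<delta>[OF that] part[OF that]])
  \<comment> \<open>Already the term k = m + 1 is large enough: y m = 2 y k gives 1 - t k r = y k +
    t k (1 - r) \<le> 3 y k.\<close>
  have lower: "(1/3) ^ p / \<omega> r \<le> G r" if r: "\<delta> \<le> r" "r < 1" for r
  proof -
    obtain m where m: "1 - r \<le> y m" "y (Suc m) < 1 - r" using index[OF r] by blast
    let ?k = "Suc m"
    have r0: "0 \<le> r" using r \<delta> by simp
    have tr: "r \<le> t ?k" using m by (simp add: t_def)
    have "((1 - t ?k) / (1 - r)) powr a \<le> 1"
      using tr r t(3)[of ?k] ab by (intro powr_le1) auto
    then have "1 / \<omega> (t ?k) * ((1 - t ?k) / (1 - r)) powr a \<le> 1 / \<omega> (t ?k) * 1"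
      using wp[OF t(2,3)[of ?k]] by (intro mult_left_mono) auto
    then have w: "1 / \<omega> r \<le> 1 / \<omega> (t ?k)" using upper_a[OF r(1) tr t(3)] by simp
    have "t ?k * (1 - r) \<le> 1 - r" using t(3)[of ?k] r mult_right_mono[of "t ?k" 1 "1 - r"] by simp
    moreover have "y m = 2 * y ?k" by (simp add: y_def)
    moreover have "1 - t ?k * r = y ?k + t ?k * (1 - r)" by (simp add: t_def algebra_simps)
    ultimately have "1 - t ?k * r \<le> 3 * y ?k" using m by linarith
    then have "1/3 \<le> y ?k / (1 - t ?k * r)" using den[OF r0 r(2), of ?k] by (simp add: field_simps)
    then have "1 / \<omega> r * (1/3) ^ p \<le> T ?k r"
      unfolding T_def using w wp[OF r0 r(2)] wp[OF t(2,3)[of ?k]]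
      by (intro mult_mono power_mono) auto
    then show ?thesis using TG[OF r0 r(2), of ?k] by simp
  qed
  have "continuous_on {0..\<delta>} \<omega>"
    using \<omega> \<delta> unfolding normal_weight_def by (auto intro: continuous_on_subset)
  then obtain x1 x2 where x1: "x1 \<in> {0..\<delta>}" "\<And>x. x \<in> {0..\<delta>} \<Longrightarrow> \<omega> x1 \<le> \<omega> x"
    and x2: "x2 \<in> {0..\<delta>}" "\<And>x. x \<in> {0..\<delta>} \<Longrightarrow> \<omega> x \<le> \<omega> x2"
    using continuous_attains_inf[of "{0..\<delta>}" \<omega>] continuous_attains_sup[of "{0..\<delta>}" \<omega>] \<delta> by force
  have w1: "\<omega> x1 > 0" and w2: "\<omega> x2 > 0" using wp x1(1) x2(1) \<delta> by auto
  \<comment> \<open>On [0,\<delta>] continuity replaces normality: \<omega> lies between its extreme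
    values, while G is at most G(\<delta>) and at least its zeroth term, where t 0 = \<delta> and y
    0 = d.\<close>
  define C where "C = max C0 (\<omega> x2 * G \<delta>)"
  define c where "c = min ((1/3) ^ p) (\<omega> x1 * (1 / \<omega> \<delta> * d ^ p))"
  have C: "C > 0" using C0 by (simp add: C_def)
  have c: "c > 0" using w1 wp[OF \<delta>] d by (simp add: c_def)
  have up: "G r \<le> C / \<omega> r" if r: "0 \<le> r" "r < 1" for r
  proof (cases "\<delta> \<le> r")
    case True
    have "C0 / \<omega> r \<le> C / \<omega> r" using wp[OF r] by (intro divide_right_mono) (auto simp: C_def)
    then show ?thesis using G\<delta>[OF True r(2)] by simp
  next
    case False
    have G0: "0 \<le> G \<delta>" using TG[OF \<delta>, of 0] T0[OF \<delta>, of 0] by linarith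
    have "\<omega> r * G r \<le> \<omega> x2 * G \<delta>"
      using x2(2)[of r] w2 Gmono[of r \<delta>] r False \<delta> G0 wp[OF r] TG[OF r, of 0] T0[OF r, of 0]
      by (intro mult_mono) auto
    also have "\<dots> \<le> C" by (simp add: C_def)
    finally show ?thesis using wp[OF r] by (simp add: field_simps)
  qed
  have low: "c / \<omega> r \<le> G r" if r: "0 \<le> r" "r < 1" for r
  proof (cases "\<delta> \<le> r")
    case True
    have "c / \<omega> r \<le> (1/3) ^ p / \<omega> r" using wp[OF r] by (intro divide_right_mono) (auto simp: c_def)
    then show ?thesis using lower[OF True r(2)] by simp
  next
    case False
    have y0: "y 0 = d" "t 0 = \<delta>" by (auto simp: y_def t_def d_def)
    have "1 - \<delta> * r \<le> 1" using \<delta> r by simp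
    then have "d / 1 \<le> d / (1 - \<delta> * r)"
      using d den[OF r, of 0] y0 by (intro divide_left_mono) auto
    then have "1 / \<omega> \<delta> * d ^ p \<le> T 0 r"
      unfolding T_def y0 using wp[OF \<delta>] d by (intro mult_left_mono power_mono) simp_all
    also have "\<dots> \<le> G r" by (rule TG[OF r])
    finally have *: "1 / \<omega> \<delta> * d ^ p \<le> G r" .
    have "c \<le> \<omega> x1 * (1 / \<omega> \<delta> * d ^ p)" by (simp add: c_def)
    also have "\<dots> \<le> \<omega> r * G r"
      using * x1(2)[of r] w1 r False wp[OF \<delta>] wp[OF r] d by (intro mult_mono) auto
    finally show ?thesis using wp[OF r] by (simp add: field_simps)
  qed
  \<comment> \<open>The same terms at a complex argument. Their coefficients are positive and |1 - t
    k x| \<ge> 1 - t k |x|, so \<open>T k\<close> at |x| is a majorant, with equality for real x in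
    [0,1).\<close>
  define h where "h = (\<lambda>k x. complex_of_real (1 / \<omega> (t k)) *
      (complex_of_real (y k) / (1 - complex_of_real (t k) * x)) ^ p)"
  have dnz: "1 - t k * cmod x \<le> cmod (1 - complex_of_real (t k) * x)" for k x
    using norm_triangle_ineq2[of 1 "complex_of_real (t k) * x"] t(2)[of k] by (simp add: norm_mult)
  have hT: "cmod (h k x) \<le> T k (cmod x)" if "x \<in> ball 0 1" for k x
  proof -
    have "cmod (h k x) = 1 / \<omega> (t k) * (y k / cmod (1 - complex_of_real (t k) * x)) ^ p"
      using wp[OF t(2,3)[of k]] y(1)[of k] by (simp add: h_def norm_mult norm_power norm_divide)
    also have "\<dots> \<le> T k (cmod x)"
    proof -
      have 1: "0 < 1 - t k * cmod x" using den[of "cmod x" k] that by simp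
      with dnz[of k x] have 2: "0 < cmod (1 - complex_of_real (t k) * x)" by linarith
      show ?thesis
        unfolding T_def using dnz[of k x] mult_pos_pos[OF 2 1] 2 wp[OF t(2,3)[of k]] y(1)[of k]
        by (intro mult_left_mono power_mono divide_left_mono) (auto intro: less_imp_le)
    qed
    finally show ?thesis .
  qed
  define g where "g = (\<lambda>x. \<Sum>k. h k x)"
  have "g holomorphic_on ball 0 1"
  proof (rule holomorphic_uniform_sequence[where f = "\<lambda>n x. \<Sum>k<n. h k x"])
    show "(\<lambda>x. \<Sum>k<n. h k x) holomorphic_on ball 0 1" for n
    proof -
      have "1 - complex_of_real (t k) * x \<noteq> 0" if "x \<in> ball 0 1" for k x
        using dnz[of k x] den[of "cmod x" k] that by force
      then show ?thesis unfolding h_def by (intro holomorphic_intros) auto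
    qed
    fix x :: complex assume x: "x \<in> ball 0 1"
    define e where "e = (1 - cmod x) / 2"
    define r where "r = (1 + cmod x) / 2"
    have e: "e > 0" and r: "0 \<le> r" "r < 1" using x by (auto simp: e_def r_def)
    have nr: "cmod z \<le> r" if "z \<in> cball x e" for z
      using norm_triangle_sub[of z x] that by (simp add: e_def r_def dist_norm norm_minus_commute field_simps)
    have sub: "cball x e \<subseteq> ball 0 1"
    proof
      fix z assume "z \<in> cball x e"
      from nr[OF this] r(2) show "z \<in> ball 0 1" by simp
    qed
    have "uniform_limit (cball x e) (\<lambda>n x. \<Sum>k<n. h k x) g sequentially"
      unfolding g_def
    proof (rule Weierstrass_m_test)
      show "cmod (h k z) \<le> T k r" if "z \<in> cball x e" for k z
        using hT[of z k] Tmono[OF norm_ge_zero nr[OF that] r(2), of k] sub that by force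
    qed (rule summ[OF r])
    with e sub show "\<exists>d>0. cball x d \<subseteq> ball 0 1 \<and>
        uniform_limit (cball x d) (\<lambda>n x. \<Sum>k<n. h k x) g sequentially" by blast
  qed simp
  moreover have "cmod (g x) \<le> G (cmod x)" if x: "x \<in> ball 0 1" for x
    unfolding g_def G_def
    by (rule norm_suminf_le[OF hT[OF x] summ]) (use x in auto)
  moreover have "g (complex_of_real r) = complex_of_real (G r)" if r: "0 \<le> r" "r < 1" for r
  proof -
    have "h k (complex_of_real r) = complex_of_real (T k r)" for k by (simp add: h_def T_def)
    then show ?thesis
      unfolding g_def G_def using suminf_of_real[OF summ[OF r], where 'a = complex] by simp
  qed
  ultimately show ?thesis using Gmono c low C up by (intro that[of g G c C]) auto
qed

lemma holo_on_compose_functional: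
  assumes L: "bounded_linear L" "\<And>c x. L (scaleC c x) = c * L x" "\<And>x. cmod (L x) \<le> norm x"
    and F: "\<And>x. x \<in> ball 0 1 \<Longrightarrow> (F has_field_derivative F' x) (at x)"
    and z: "z \<in> ball 0 1"
  shows "((\<lambda>z. F (L z)) has_derivative (\<lambda>h. F' (L z) * L h)) (at z)"
proof -
  have "L z \<in> ball 0 1" using z L(3)[of z] by simp
  from F[OF this] have "(F has_derivative (\<lambda>h. F' (L z) * h)) (at (L z))"
    by (simp add: has_field_derivative_def)
  from has_derivative_compose[OF bounded_linear_imp_has_derivative[OF L(1)] this] show ?thesis .
qed

lemma restrict_ball_holo:
  assumes der: "\<And>z. z \<in> ball 0 1 \<Longrightarrow> (f has_derivative D z) (at z)"
    and D: "\<And>z c x. z \<in> ball 0 1 \<Longrightarrow> D z (scaleC c x) = c * D z x"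
  shows "(\<lambda>z. if z \<in> ball 0 1 then f z else 0) \<in> holo_ball"
    and "z \<in> ball 0 1 \<Longrightarrow> radial_deriv (\<lambda>z. if z \<in> ball 0 1 then f z else 0) z = D z z"
proof -
  have *: "((\<lambda>z. if z \<in> ball 0 1 then f z else 0) has_derivative D z) (at z)" if "z \<in> ball 0 1" for z
    by (rule has_derivative_transform_within_open[OF der[OF that] open_ball that]) simp
  have "holo_on (\<lambda>z. if z \<in> ball 0 1 then f z else 0) (ball 0 1)"
    by (rule holo_onI[OF * D])
  then show "(\<lambda>z. if z \<in> ball 0 1 then f z else 0) \<in> holo_ball" by (simp add: holo_ball_iff)
  show "z \<in> ball 0 1 \<Longrightarrow> radial_deriv (\<lambda>z. if z \<in> ball 0 1 then f z else 0) z = D z z"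
    using fderiv_eq[OF *] by (simp add: radial_deriv_def)
qed

section \<open>Necessity\<close>

lemma bloch_if_compact_cesaro:
  fixes \<phi> :: "'a::complex_banach \<Rightarrow> complex"
  assumes \<phi>: "\<phi> \<in> holo_ball"
    and cpt: "compact_linear_operator (bloch \<omega>) (bloch_norm \<omega>) (bloch \<mu>) (bloch_norm \<mu>) (cesaro_op \<phi>)"
  shows "\<phi> \<in> bloch \<mu>"
proof -
  define u where "u = (\<lambda>z::'a. if z \<in> ball 0 1 then 1 else (0::complex))"
  have u: "u \<in> holo_ball" "\<And>z. z \<in> ball 0 1 \<Longrightarrow> radial_deriv u z = 0"
    unfolding u_def using restrict_ball_holo[of "\<lambda>_. 1" "\<lambda>_ _. 0"] by auto
  have "u \<in> bloch \<omega>" by (rule bloch_normI(1)[OF u(1), of _ "cmod (u 0)"]) (simp add: u(2))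
  then have "cesaro_op \<phi> u \<in> bloch \<mu>" using cpt by (simp add: compact_linear_operator_def)
  then have "bdd_above ((\<lambda>z. \<mu> (norm z) * cmod (radial_deriv (cesaro_op \<phi> u) z)) ` ball 0 1)"
    by (simp add: bloch_def)
  moreover have "radial_deriv (cesaro_op \<phi> u) z = radial_deriv \<phi> z" if "z \<in> ball 0 1" for z
    using radial_deriv_cesaro_op[OF u(1) \<phi> that] that by (simp add: u_def)
  ultimately show ?thesis using \<phi> by (simp add: bloch_def)
qed

text \<open>
  With \<open>F\<close> a primitive of the test function and \<open>L\<close> norming for \<open>z0\<close>, the function
  \<open>F (L z) - F (s L z)\<close> is small on smaller balls when \<open>s\<close> is close to \<open>1\<close>, and large at \<open>z0\<close> when
  \<open>z0\<close> is close enough to the sphere in terms of \<open>s\<close>. Subtracting the dilate replaces the usual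
  quotient \<open>F\<^sup>2 / F(\<bar>z0\<bar>)\<close> and makes the uniform bound on the norms immediate.
\<close>

lemma bloch_peak_functions:
  assumes \<omega>: "normal_weight \<omega>"
  obtains c C :: real and K :: "real \<Rightarrow> real" where "c > 0"
    "\<And>(z0::'a::complex_banach) s. z0 \<in> ball 0 1 \<Longrightarrow> 0 \<le> s \<Longrightarrow> s < 1 \<Longrightarrow>
       \<exists>f\<in>bloch \<omega>. bloch_norm \<omega> f \<le> C \<and>
         (\<forall>z\<in>ball 0 1. cmod (f z) \<le> (1 - s) * K (norm z)) \<and>
         c * weight_integral \<omega> (norm z0) - K s \<le> cmod (f z0)"
proof -
  obtain g :: "complex \<Rightarrow> complex" and G :: "real \<Rightarrow> real" and c C :: real
    where g: "g holomorphic_on ball 0 1" "\<And>x. x \<in> ball 0 1 \<Longrightarrow> cmod (g x) \<le> G (cmod x)"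
    "\<And>r. 0 \<le> r \<Longrightarrow> r < 1 \<Longrightarrow> g (complex_of_real r) = complex_of_real (G r)"
    and G: "\<And>r s. 0 \<le> r \<Longrightarrow> r \<le> s \<Longrightarrow> s < 1 \<Longrightarrow> G r \<le> G s"
    and c: "c > 0" "\<And>r. 0 \<le> r \<Longrightarrow> r < 1 \<Longrightarrow> c / \<omega> r \<le> G r"
    and C: "C > 0" "\<And>r. 0 \<le> r \<Longrightarrow> r < 1 \<Longrightarrow> G r \<le> C / \<omega> r"
    by (rule normal_weight_test_function[OF \<omega>]) (rule that)
  have wp: "\<omega> r > 0" if "0 \<le> r" "r < 1" for r using normal_weight_pos[OF \<omega> that] .
  have G0: "0 \<le> G r" if "0 \<le> r" "r < 1" for r
    using c(2)[OF that] c(1) wp[OF that] by (smt (verit) divide_nonneg_pos)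
  obtain F where F: "\<And>x. x \<in> ball 0 1 \<Longrightarrow> (F has_field_derivative g x) (at x)"
  proof -
    obtain F where F: "\<And>x. x \<in> ball 0 1 \<Longrightarrow> (F has_field_derivative g x) (at x within ball 0 1)"
      using holomorphic_convex_primitive'[OF convex_ball open_ball g(1)] by blast
    have "(F has_field_derivative g x) (at x)" if "x \<in> ball 0 1" for x
      using F[OF that] by (simp only: at_within_open[OF that open_ball])
    then show ?thesis by (rule that)
  qed
  have Fdiff: "cmod (F x - F y) \<le> G r * cmod (x - y)" if "cmod x \<le> r" "cmod y \<le> r" "r < 1" for x y r
  proof (rule field_differentiable_bound[of "cball 0 r"])
    show "(F has_field_derivative g u) (at u within cball 0 r)" if "u \<in> cball 0 r" for u
      using F[of u] that \<open>r < 1\<close> by (auto intro: has_field_derivative_at_within)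
    show "cmod (g u) \<le> G r" if "u \<in> cball 0 r" for u
      using g(2)[of u] G[OF norm_ge_zero, of u r] that \<open>r < 1\<close> by force
  qed (use that in auto)
  \<comment> \<open>On the radius [0,1) the function g is real and at least c/\<omega>, so nothing
    cancels in its primitive.\<close>
  have Flow: "c * weight_integral \<omega> r \<le> cmod (F (complex_of_real r) - F 0)" if r: "0 \<le> r" "r < 1" for r
  proof -
    have "((\<lambda>t. g (complex_of_real t)) has_integral (F (complex_of_real r) - F (complex_of_real 0))) {0..r}"
    proof (rule fundamental_theorem_of_calculus[OF r(1)])
      fix t assume t: "t \<in> {0..r}"
      then have "(F has_field_derivative g (complex_of_real t)) (at (complex_of_real t))"
        using r by (intro F) simp
      from has_vector_derivative_real_field[OF this]
      show "((\<lambda>t. F (complex_of_real t)) has_vector_derivative g (complex_of_real t)) (at t within {0..r})"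
        by (rule has_vector_derivative_at_within)
    qed
    from has_integral_linear[OF this bounded_linear_Re]
    have 1: "((\<lambda>t. Re (g (complex_of_real t))) has_integral Re (F (complex_of_real r) - F 0)) {0..r}"
      by (simp add: o_def)
    have 2: "((\<lambda>t. c * (1 / \<omega> t)) has_integral c * weight_integral \<omega> r) {0..r}"
      unfolding weight_integral_def
      by (intro has_integral_mult_right integrable_integral inverse_weight_integrable[OF \<omega>]) (use r in auto)
    have "c * weight_integral \<omega> r \<le> Re (F (complex_of_real r) - F 0)"
      by (rule has_integral_le[OF 2 1]) (use r g(3) c(2) in auto)
    also have "\<dots> \<le> cmod (F (complex_of_real r) - F 0)" by (rule complex_Re_le_cmod)
    finally show ?thesis .
  qed
  have "\<exists>f\<in>bloch \<omega>. bloch_norm \<omega> f \<le> 2 * C \<and>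
         (\<forall>z\<in>ball 0 1. cmod (f z) \<le> (1 - s) * G (norm z)) \<and>
         c * weight_integral \<omega> (norm z0) - G s \<le> cmod (f z0)"
    if z0: "z0 \<in> ball 0 1" and s: "0 \<le> s" "s < 1" for z0 :: 'a and s
  proof -
    obtain L :: "'a \<Rightarrow> complex" where L: "bounded_linear L" "\<And>c x. L (scaleC c x) = c * L x"
      "\<And>x. cmod (L x) \<le> norm x" "L z0 = complex_of_real (norm z0)"
      using norming_functional by metis
    let ?s = "complex_of_real s"
    have Lb: "L z \<in> ball 0 1" "?s * L z \<in> ball 0 1" "cmod (?s * L z) \<le> s" "cmod (?s * L z) \<le> cmod (L z)"
      if "z \<in> ball 0 1" for z
    proof -
      show *: "L z \<in> ball 0 1" using that L(3)[of z] by simp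
      have "s * cmod (L z) \<le> s * 1" using s * by (intro mult_left_mono) auto
      moreover have "s * cmod (L z) \<le> 1 * cmod (L z)" using s by (intro mult_right_mono) auto
      ultimately show "?s * L z \<in> ball 0 1" "cmod (?s * L z) \<le> s" "cmod (?s * L z) \<le> cmod (L z)"
        using s by (simp_all add: norm_mult)
    qed
    define f where "f = (\<lambda>z. if z \<in> ball 0 1 then F (L z) - F (?s * L z) else 0)"
    define D where "D = (\<lambda>z h. g (L z) * L h - ?s * g (?s * L z) * L h)"
    have der: "((\<lambda>z. F (L z) - F (?s * L z)) has_derivative D z) (at z)" if z: "z \<in> ball 0 1" for z
    proof -
      have "((\<lambda>x. F (?s * x)) has_field_derivative ?s * g (?s * x)) (at x)" if x: "x \<in> ball 0 1" for x
      proof -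
        have "s * cmod x \<le> 1 * cmod x" using s by (intro mult_right_mono) auto
        then have "?s * x \<in> ball 0 1" using x s by (simp add: norm_mult)
        from F[OF this] have "((\<lambda>x. F (?s * x)) has_field_derivative g (?s * x) * ?s) (at x)"
          by (rule DERIV_chain2) (auto intro!: derivative_eq_intros)
        then show ?thesis by (simp add: mult.commute)
      qed
      from has_derivative_diff[OF holo_on_compose_functional[OF L(1-3) F z] holo_on_compose_functional[OF L(1-3) this z]]
      show ?thesis by (simp add: D_def)
    qed
    have Dlin: "D z (scaleC c x) = c * D z x" for z c x by (simp add: D_def L(2) algebra_simps)
    have fh: "f \<in> holo_ball"
      unfolding f_def by (rule restrict_ball_holo(1)[OF der Dlin])
    have rf: "radial_deriv f z = D z z" if "z \<in> ball 0 1" for z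
      unfolding f_def by (rule restrict_ball_holo(2)[OF der Dlin that])
    \<comment> \<open>Both g(Lz) and g(sLz) are at most G(\<parallel>z\<parallel>) \<le>
      C/\<omega>(\<parallel>z\<parallel>), whatever s and z0 are.\<close>
    have rb: "\<omega> (norm z) * cmod (radial_deriv f z) \<le> 2 * C" if z: "z \<in> ball 0 1" for z
    proof -
      have nz: "0 \<le> norm z" "norm z < 1" using z by auto
      have g1: "cmod (g (L z)) \<le> G (norm z)"
        using g(2)[OF Lb(1)[OF z]] G[OF norm_ge_zero L(3) nz(2)] by linarith
      have g2: "cmod (g (?s * L z)) \<le> G (norm z)"
        using g(2)[OF Lb(2)[OF z]] G[OF norm_ge_zero order_trans[OF Lb(4)[OF z] L(3)] nz(2)] by linarith
      have "cmod (radial_deriv f z) = cmod (D z z)" by (simp only: rf[OF z])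
      also have "\<dots> \<le> cmod (g (L z)) * cmod (L z) + s * cmod (g (?s * L z)) * cmod (L z)"
        unfolding D_def using norm_triangle_ineq4[of "g (L z) * L z" "?s * g (?s * L z) * L z"] s
        by (simp add: norm_mult)
      also have "\<dots> \<le> G (norm z) * 1 + 1 * G (norm z) * 1"
        using Lb(1)[OF z] g1 g2 s G0[OF nz] by (intro add_mono mult_mono) auto
      also have "\<dots> \<le> 2 * (C / \<omega> (norm z))" using C(2)[OF nz] by simp
      finally show ?thesis using wp[OF nz] by (simp add: field_simps)
    qed
    have f0: "f 0 = 0" using linear_0[OF bounded_linear.linear[OF L(1)]] by (simp add: f_def)
    have fb: "f \<in> bloch \<omega>" "bloch_norm \<omega> f \<le> 2 * C"
      using bloch_normI[OF fh, of \<omega> "2 * C"] rb f0 by auto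
    have "cmod (f z) \<le> (1 - s) * G (norm z)" if z: "z \<in> ball 0 1" for z
    proof -
      have nz: "0 \<le> norm z" "norm z < 1" using z by auto
      have "cmod (f z) \<le> G (norm z) * cmod (L z - ?s * L z)"
        using Fdiff[OF L(3) order_trans[OF Lb(4)[OF z] L(3)] nz(2)] z by (simp add: f_def)
      also have "L z - ?s * L z = complex_of_real (1 - s) * L z" by (simp add: algebra_simps)
      also have "cmod \<dots> = (1 - s) * cmod (L z)" using s by (simp add: norm_mult del: of_real_diff)
      also have "G (norm z) * \<dots> \<le> G (norm z) * ((1 - s) * 1)"
        using G0[OF nz] s Lb(1)[OF z] by (intro mult_left_mono) auto
      finally show ?thesis by (simp add: mult.commute)
    qed
    moreover have "c * weight_integral \<omega> (norm z0) - G s \<le> cmod (f z0)"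
    proof -
      have nz: "0 \<le> norm z0" "norm z0 < 1" using z0 by auto
      \<comment> \<open>The dilated argument stays in the disc of radius s, so the subtraction costs
        at most G s, however close z0 is to the sphere.\<close>
      have "cmod (F (?s * L z0) - F 0) \<le> G s * cmod (?s * L z0 - 0)"
        using Lb(3)[OF z0] s by (intro Fdiff) auto
      also have "\<dots> \<le> G s * 1" using Lb(3)[OF z0] s G0[OF s] by (intro mult_left_mono) auto
      finally have "cmod (F (?s * L z0) - F 0) \<le> G s" by simp
      moreover have "f z0 = (F (L z0) - F 0) - (F (?s * L z0) - F 0)" using z0 by (simp add: f_def)
      ultimately show ?thesis
        using Flow[OF nz] norm_triangle_ineq2[of "F (L z0) - F 0" "F (?s * L z0) - F 0"]
        by (simp add: L(4))
    qed
    ultimately show ?thesis using fb by blast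
  qed
  then show ?thesis by (rule that[OF c(1)])
qed

lemma compact_linear_operatorD:
  assumes "compact_linear_operator X NX Y NY T"
  shows "f \<in> X \<Longrightarrow> T f \<in> Y"
    and "S \<subseteq> X \<Longrightarrow> (\<And>f. f \<in> S \<Longrightarrow> NX f \<le> C) \<Longrightarrow>
           relatively_compact_in (norm_topology Y NY) (T ` S)"
proof -
  note def = assms[unfolded compact_linear_operator_def]
  show "T f \<in> Y" if "f \<in> X"
    by (rule def[THEN conjunct1, rule_format, OF that])
  show "relatively_compact_in (norm_topology Y NY) (T ` S)" if "S \<subseteq> X" "\<And>f. f \<in> S \<Longrightarrow> NX f \<le> C"
    by (rule def[THEN conjunct2, THEN conjunct2, THEN conjunct2, THEN spec, THEN mp, THEN mp, OF that(1)])
       (intro exI[of _ C] ballI that(2))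
qed

lemma vanishing_if_compact_cesaro:
  fixes \<phi> :: "'a::complex_banach \<Rightarrow> complex"
  assumes \<omega>: "normal_weight \<omega>" and \<mu>: "normal_weight \<mu>" and \<phi>: "\<phi> \<in> holo_ball"
    and inf: "(\<integral>\<^sup>+t\<in>{0..<1}. ennreal (1 / \<omega> t) \<partial>lborel) = \<infinity>"
    and cpt: "compact_linear_operator (bloch \<omega>) (bloch_norm \<omega>) (bloch \<mu>) (bloch_norm \<mu>) (cesaro_op \<phi>)"
    and e: "e > 0"
  shows "\<exists>\<rho>. \<rho> < 1 \<and> (\<forall>z\<in>ball 0 1. norm z > \<rho> \<longrightarrow>
      \<mu> (norm z) * cmod (radial_deriv \<phi> z) * weight_integral \<omega> (norm z) < e)"
proof (rule ccontr)
  let ?m = "\<lambda>z. \<mu> (norm z) * cmod (radial_deriv \<phi> z)"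
  assume nt: "\<not> ?thesis"
  have bad: "\<exists>z\<in>ball 0 1. norm z > \<rho> \<and> e \<le> ?m z * weight_integral \<omega> (norm z)" if "\<rho> < 1" for \<rho>
  proof -
    have "\<not> (\<forall>z\<in>ball 0 1. norm z > \<rho> \<longrightarrow> ?m z * weight_integral \<omega> (norm z) < e)"
      using nt that by blast
    then show ?thesis by (auto simp: not_less)
  qed
  have mp: "\<And>r. r \<in> {0..<1} \<Longrightarrow> \<mu> r > 0" using normal_weight_pos[OF \<mu>] by simp
  obtain c C :: real and K :: "real \<Rightarrow> real" where c: "c > 0"
    and peak: "\<And>(z0::'a) s. z0 \<in> ball 0 1 \<Longrightarrow> 0 \<le> s \<Longrightarrow> s < 1 \<Longrightarrow>
       \<exists>f\<in>bloch \<omega>. bloch_norm \<omega> f \<le> C \<and>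
         (\<forall>z\<in>ball 0 1. cmod (f z) \<le> (1 - s) * K (norm z)) \<and>
         c * weight_integral \<omega> (norm z0) - K s \<le> cmod (f z0)"
    by (rule bloch_peak_functions[OF \<omega>, where 'a = 'a]) (rule that)
  \<comment> \<open>Then \<open>f n\<close> is of size 1/(n + 1) at each fixed point, and
    \<open>z n\<close> is taken so close to the sphere that the loss \<open>K (s n)\<close> is at
    most half of c I(\<parallel>z n\<parallel>).\<close>
  define s where "s = (\<lambda>n. 1 - 1 / real (Suc n))"
  have s: "0 \<le> s n" "s n < 1" for n by (auto simp: s_def)
  have "\<exists>z\<in>ball 0 1. 2 * K (s n) / c \<le> weight_integral \<omega> (norm z) \<and>
      e \<le> ?m z * weight_integral \<omega> (norm z)" for n
  proof -
    obtain \<rho> where \<rho>: "0 \<le> \<rho>" "\<rho> < 1"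
      "\<And>r. \<rho> \<le> r \<Longrightarrow> r < 1 \<Longrightarrow> weight_integral \<omega> r > 2 * K (s n) / c"
      using weight_integral_unbounded[OF \<omega> inf] by metis
    from bad[OF \<rho>(2)] obtain z where "z \<in> ball 0 1" "norm z > \<rho>" "e \<le> ?m z * weight_integral \<omega> (norm z)"
      by blast
    with \<rho>(3)[of "norm z"] show ?thesis by (intro bexI[of _ z]) auto
  qed
  then obtain z where z: "\<And>n. z n \<in> ball 0 1" "\<And>n. 2 * K (s n) / c \<le> weight_integral \<omega> (norm (z n))"
    "\<And>n. e \<le> ?m (z n) * weight_integral \<omega> (norm (z n))"
    by metis
  have "\<exists>f. f \<in> bloch \<omega> \<and> bloch_norm \<omega> f \<le> C \<and>
      (\<forall>w\<in>ball 0 1. cmod (f w) \<le> (1 - s n) * K (norm w)) \<and>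
      c * weight_integral \<omega> (norm (z n)) - K (s n) \<le> cmod (f (z n))" for n
    using peak[OF z(1)[of n] s[of n]] by blast
  then obtain f where f: "\<And>n. f n \<in> bloch \<omega>" "\<And>n. bloch_norm \<omega> (f n) \<le> C"
    and small: "\<And>n w. w \<in> ball 0 1 \<Longrightarrow> cmod (f n w) \<le> (1 - s n) * K (norm w)"
    and large: "\<And>n. c * weight_integral \<omega> (norm (z n)) - K (s n) \<le> cmod (f n (z n))"
    by metis
  have fh: "f n \<in> holo_ball" for n using f(1)[of n] by (simp add: bloch_def)
  let ?T = "cesaro_op \<phi>"
  interpret M: Metric_space "bloch \<mu> :: ('a \<Rightarrow> complex) set" "bloch_dist \<mu>"
    by (rule Metric_space_bloch[OF \<mu>])
  have Tb: "?T (f n) \<in> bloch \<mu>" for n using compact_linear_operatorD(1)[OF cpt f(1)] .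
  have "relatively_compact_in (norm_topology (bloch \<mu>) (bloch_norm \<mu>)) (?T ` range f)"
    by (rule compact_linear_operatorD(2)[OF cpt]) (use f in auto)
  then have "compactin M.mtopology (M.mtopology closure_of (?T ` range f))"
    by (simp add: relatively_compact_in_def norm_topology_def)
  then have "\<forall>\<sigma>. range \<sigma> \<subseteq> M.mtopology closure_of (?T ` range f) \<longrightarrow>
      (\<exists>l r. l \<in> M.mtopology closure_of (?T ` range f) \<and> strict_mono (r :: nat \<Rightarrow> nat) \<and>
        limitin M.mtopology (\<sigma> \<circ> r) l sequentially)"
    unfolding M.compactin_sequentially by (elim conjE)
  moreover have "?T ` range f \<subseteq> M.mtopology closure_of (?T ` range f)"
    by (rule closure_of_subset) (use Tb in auto)
  then have "range (\<lambda>n. ?T (f n)) \<subseteq> M.mtopology closure_of (?T ` range f)"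
    by blast
  ultimately obtain l r where r: "strict_mono (r :: nat \<Rightarrow> nat)"
    and lim: "limitin M.mtopology ((\<lambda>n. ?T (f n)) \<circ> r) l sequentially"
    by blast
  have l: "l \<in> bloch \<mu>" and conv: "\<And>d. d > 0 \<Longrightarrow> \<exists>N. \<forall>n\<ge>N. bloch_norm \<mu> (\<lambda>w. ?T (f (r n)) w - l w) < d"
    using lim Tb unfolding M.limit_metric_sequentially by auto
  have lh: "l \<in> holo_ball" using l by (simp add: bloch_def)
  have bound: "\<mu> (norm w) * cmod (f n w * radial_deriv \<phi> w - radial_deriv l w)
      \<le> bloch_norm \<mu> (\<lambda>w. ?T (f n) w - l w)" if w: "w \<in> ball 0 1" for n w
    using bloch_norm_bounds(1)[OF mp bloch_diff(1)[OF mp Tb l] w, of n]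
      norm_ge_zero[of "?T (f n) 0 - l 0"]
    by (simp add: radial_deriv_diff[OF cesaro_op_holo[OF fh \<phi>] lh w] radial_deriv_cesaro_op[OF fh \<phi> w]
        del: norm_ge_zero)
  have norm0: "(\<lambda>n. bloch_norm \<mu> (\<lambda>w. ?T (f (r n)) w - l w)) \<longlonglongrightarrow> 0"
  proof (rule LIMSEQ_I)
    fix d :: real assume "d > 0"
    from conv[OF this] bloch_norm_bounds(2)[OF mp bloch_diff(1)[OF mp Tb l], of 0]
    show "\<exists>N. \<forall>n\<ge>N. norm (bloch_norm \<mu> (\<lambda>w. ?T (f (r n)) w - l w) - 0) < d"
      by auto
  qed
  \<comment> \<open>Convergence in norm along the subsequence makes f R\<phi> tend to R l at each
    point, whereas the test functions tend to 0 there.\<close>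
  have rl: "radial_deriv l w = 0" if w: "w \<in> ball 0 1" for w
  proof -
    have mw: "\<mu> (norm w) > 0" using mp w by simp
    have "(\<lambda>n. 1 / real (Suc n) * K (norm w)) \<longlonglongrightarrow> 0"
      using tendsto_mult_left_zero[OF LIMSEQ_ignore_initial_segment[OF lim_1_over_n[where 'a = real], of 1]] by simp
    moreover have "\<forall>\<^sub>F n in sequentially. norm (f n w) \<le> 1 / real (Suc n) * K (norm w)"
      using small[OF w] by (intro always_eventually) (simp add: s_def)
    ultimately have "(\<lambda>n. f n w) \<longlonglongrightarrow> 0" by (rule Lim_null_comparison[rotated])
    then have "(\<lambda>n. f (r n) w) \<longlonglongrightarrow> 0" using LIMSEQ_subseq_LIMSEQ[OF _ r] by (auto simp: o_def)
    then have "(\<lambda>n. \<mu> (norm w) * cmod (f (r n) w * radial_deriv \<phi> w - radial_deriv l w))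
        \<longlonglongrightarrow> \<mu> (norm w) * cmod (0 * radial_deriv \<phi> w - radial_deriv l w)"
      by (intro tendsto_intros)
    from tendsto_le[OF sequentially_bot norm0 this] bound[OF w]
    have "\<mu> (norm w) * cmod (0 * radial_deriv \<phi> w - radial_deriv l w) \<le> 0" by simp
    with mw show ?thesis by (simp add: mult_le_0_iff)
  qed
  \<comment> \<open>Because R l = 0, the distance of \<open>?T (f n)\<close> from l is at least the
    value of \<mu>|R\<phi>||f n| at \<open>z n\<close>; this lower bound contradicts
    \<open>norm0\<close>.\<close>
  have "c / 2 * e \<le> bloch_norm \<mu> (\<lambda>w. ?T (f n) w - l w)" for n
  proof -
    have m: "?m (z n) \<ge> 0" using mp z(1)[of n] by (simp add: less_imp_le)
    have "c / 2 * e \<le> c / 2 * (?m (z n) * weight_integral \<omega> (norm (z n)))"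
      using z(3)[of n] c by (intro mult_left_mono) auto
    also have "\<dots> = ?m (z n) * (c / 2 * weight_integral \<omega> (norm (z n)))" by (simp add: mult_ac)
    also have "\<dots> \<le> ?m (z n) * cmod (f n (z n))"
    proof (rule mult_left_mono[OF _ m])
      have "2 * K (s n) \<le> c * weight_integral \<omega> (norm (z n))"
        using z(2)[of n] c by (simp add: field_simps)
      then show "c / 2 * weight_integral \<omega> (norm (z n)) \<le> cmod (f n (z n))" using large[of n] by simp
    qed
    also have "\<dots> \<le> bloch_norm \<mu> (\<lambda>w. ?T (f n) w - l w)"
      using bound[OF z(1)[of n], of n] by (simp add: rl[OF z(1)] norm_mult mult_ac)
    finally show ?thesis .
  qed
  then have "c / 2 * e \<le> 0" by (intro tendsto_lowerbound[OF norm0]) auto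
  then show False using c e by (simp add: mult_le_0_iff)
qed

theorem theorem4p2:
  fixes \<omega> \<mu> :: "real \<Rightarrow> real" and \<phi> :: "'a::complex_banach \<Rightarrow> complex"
  assumes "normal_weight \<omega>" and "normal_weight \<mu>"
    and "\<phi> \<in> holo_ball"
    and "\<And>\<epsilon> \<rho>. \<epsilon> > 0 \<Longrightarrow> 0 < \<rho> \<Longrightarrow> \<rho> < 1 \<Longrightarrow>
           relatively_compact_in (top_of_set (ball 0 1)) (E_set \<mu> \<phi> \<epsilon> \<rho>)"
  shows "((\<integral>\<^sup>+t\<in>{0..<1}. ennreal (1 / \<omega> t) \<partial>lborel) < \<infinity> \<longrightarrow>
            (compact_linear_operator (bloch \<omega>) (bloch_norm \<omega>) (bloch \<mu>) (bloch_norm \<mu>)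
               (cesaro_op \<phi>) \<longleftrightarrow> \<phi> \<in> bloch \<mu>)) \<and>
         ((\<integral>\<^sup>+t\<in>{0..<1}. ennreal (1 / \<omega> t) \<partial>lborel) = \<infinity> \<longrightarrow>
            (compact_linear_operator (bloch \<omega>) (bloch_norm \<omega>) (bloch \<mu>) (bloch_norm \<mu>)
               (cesaro_op \<phi>) \<longleftrightarrow>
             ((\<lambda>z. \<mu> (norm z) * cmod (radial_deriv \<phi> z) * integral {0..norm z} (\<lambda>t. 1 / \<omega> t))
                \<longlongrightarrow> 0) (filtercomap norm (at_left 1))))"
proof (intro conjI impI)
  assume "(\<integral>\<^sup>+t\<in>{0..<1}. ennreal (1 / \<omega> t) \<partial>lborel) < \<infinity>"
  then show "compact_linear_operator (bloch \<omega>) (bloch_norm \<omega>) (bloch \<mu>) (bloch_norm \<mu>)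
      (cesaro_op \<phi>) \<longleftrightarrow> \<phi> \<in> bloch \<mu>"
    using bloch_if_compact_cesaro[OF assms(3)] compact_cesaro_if_integrable[OF assms] by blast
next
  assume inf: "(\<integral>\<^sup>+t\<in>{0..<1}. ennreal (1 / \<omega> t) \<partial>lborel) = \<infinity>"
  let ?m = "\<lambda>z. \<mu> (norm z) * cmod (radial_deriv \<phi> z)"
  let ?v = "\<lambda>z. ?m z * weight_integral \<omega> (norm z)"
  let ?F = "filtercomap norm (at_left (1::real)) :: 'a filter"
  \<comment> \<open>The filter sees only the radius, so its sets contain whole shells \<rho> <
    \<parallel>z\<parallel> < 1; limits along it are uniform over z.\<close>
  have ev: "eventually P ?F \<longleftrightarrow> (\<exists>\<rho><1. \<forall>z\<in>ball 0 1. norm z > \<rho> \<longrightarrow> P z)" for P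
  proof
    assume "eventually P ?F"
    then obtain Q and \<rho> :: real where "\<rho> < 1" "\<And>r. \<rho> < r \<Longrightarrow> r < 1 \<Longrightarrow> Q r" "\<And>z. Q (norm z) \<Longrightarrow> P z"
      unfolding eventually_filtercomap eventually_at_left_field by blast
    then show "\<exists>\<rho><1. \<forall>z\<in>ball 0 1. norm z > \<rho> \<longrightarrow> P z" by (intro exI[of _ \<rho>]) auto
  next
    assume "\<exists>\<rho><1. \<forall>z\<in>ball 0 1. norm z > \<rho> \<longrightarrow> P z"
    then obtain \<rho> :: real where "\<rho> < 1" "\<And>z. z \<in> ball 0 1 \<Longrightarrow> norm z > \<rho> \<Longrightarrow> P z" by blast
    then show "eventually P ?F"
      unfolding eventually_filtercomap eventually_at_left_field
      by (intro exI[of _ "\<lambda>r. \<rho> < r \<and> r < 1"]) auto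
  qed
  have m0: "?m z \<ge> 0" if "z \<in> ball 0 1" for z
    using normal_weight_pos[OF assms(2), of "norm z"] that by simp
  have v0: "?v z \<ge> 0" if "z \<in> ball 0 1" for z
    using m0[OF that] weight_integral_nonneg[OF assms(1), of "norm z"] that by simp
  have "(?v \<longlongrightarrow> 0) ?F \<longleftrightarrow>
      (\<forall>e>0. \<exists>\<rho><1. \<forall>z\<in>ball 0 1. norm z > \<rho> \<longrightarrow> ?v z < e)"
    unfolding tendsto_iff ev using v0 by (auto simp: dist_norm)
  moreover have "compact_linear_operator (bloch \<omega>) (bloch_norm \<omega>) (bloch \<mu>) (bloch_norm \<mu>) (cesaro_op \<phi>)"
    if van: "\<forall>e>0. \<exists>\<rho><1. \<forall>z\<in>ball 0 1. norm z > \<rho> \<longrightarrow> ?v z < e"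
  proof (rule compact_cesaro_if_vanishing[OF assms])
    fix e :: real assume "e > 0"
    with van obtain \<rho>1 where \<rho>1: "\<rho>1 < 1" "\<And>z. z \<in> ball 0 1 \<Longrightarrow> norm z > \<rho>1 \<Longrightarrow> ?v z < e / 2"
      by (meson half_gt_zero)
    \<comment> \<open>Since the integral diverges, I exceeds 1 near the sphere and 1 + I \<le> 2 I
      there; this accounts for e / 2 in the choice of \<rho>1.\<close>
    obtain \<rho>2 where \<rho>2: "0 \<le> \<rho>2" "\<rho>2 < 1"
      "\<And>r. \<rho>2 \<le> r \<Longrightarrow> r < 1 \<Longrightarrow> weight_integral \<omega> r > 1"
      using weight_integral_unbounded[OF assms(1) inf] by metis
    define \<rho> where "\<rho> = max (1/2) (max \<rho>1 \<rho>2)"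
    have "?m z * (1 + weight_integral \<omega> (norm z)) < e" if z: "z \<in> ball 0 1" "norm z > \<rho>" for z
    proof -
      have "?m z * 1 \<le> ?v z"
        using \<rho>2(3)[of "norm z"] z m0[OF z(1)] by (intro mult_left_mono) (auto simp: \<rho>_def)
      then show ?thesis using \<rho>1(2)[of z] z by (simp add: \<rho>_def algebra_simps)
    qed
    then show "\<exists>\<rho>>0. \<rho> < 1 \<and> (\<forall>z\<in>ball 0 1. norm z > \<rho> \<longrightarrow>
        ?m z * (1 + weight_integral \<omega> (norm z)) < e)"
      using \<rho>1(1) \<rho>2(2) by (intro exI[of _ \<rho>]) (auto simp: \<rho>_def)
  qed
  ultimately show "compact_linear_operator (bloch \<omega>) (bloch_norm \<omega>) (bloch \<mu>) (bloch_norm \<mu>)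
      (cesaro_op \<phi>) \<longleftrightarrow>
    ((\<lambda>z. ?m z * integral {0..norm z} (\<lambda>t. 1 / \<omega> t)) \<longlongrightarrow> 0) ?F"
    using vanishing_if_compact_cesaro[OF assms(1-3) inf]
    unfolding weight_integral_def[symmetric] by blast
qed

end
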